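(* Let $G$ be a group with a normal finitely generated abelian subgroup $U$ such that $G/U$ is finite. For each prime $p$ let $d_p(G) = d(G/U^p)$, and put $\alpha = \max_p d_p(G)$ and $\beta = \min_p d_p(G)$, where $p$ ranges over all primes. Then $$\alpha = d(\widehat{G}) \leq d(G) \leq k := \max\{\alpha, \beta + 1\} \leq d(\widehat{G}) + 1 .$$ Moreover, for every positive integer $N$ there exists a generating set $S = \{g_1, \ldots, g_k\}$ of $G$ of size $k$ such that the first $d(\widehat{G})$ elements $g_1, \ldots, g_{d(\widehat{G})}$ generate a subgroup of (finite) index in $G$ coprime to $N$. The same result holds for finitely generated virtually nilpotent groups, that is, when $U$ is assumed to be a finitely generated nilpotent (instead of abelian) normal subgroup of $G$ with $G/U$ finite, and $d_p(G) = d(G/U^p)$, $\alpha = \max_p d_p(G)$, $\beta = \min_p d_p(G)$ are defined in the same way from this $U$, one has $$\alpha = d(\widehat{G}) \leq d(G) \leq k := \max\{\alpha, \beta + 1\} \leq d(\widehat{G}) + 1 ,$$ and for every positive integer $N$ there exists a generating set $S = \{g_1, \ldots, g_k\}$ of $G$ of size $k$ such that the first $d(\widehat{G})$ elements $g_1, \ldots, g_{d(\widehat{G})}$ generate a subgroup of (finite) index in $G$ coprime to $N$.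
   Context: For a finitely generated group $G$, $d(G)$ denotes the minimal size of a generating set of $G$. $\widehat{G}$ denotes the profinite completion of $G$, and $d(\widehat{G})$ denotes the minimal size of a (topological) generating set of $\widehat{G}$; equivalently, $d(\widehat{G}) = \max\{ d(G/N) : N \vartriangleleft G,\ G/N \text{ finite}\}$. For a group $U$ and an integer $n$, $U^n$ denotes the subgroup generated by all $n$-th powers of elements of $U$. *)

theory Defs
  imports "HOL-Algebra.Product_Groups" "HOL-Analysis.Analysis"
begin

definition finitely_generated :: "('a, 'b) monoid_scheme \<Rightarrow> bool" where
  "finitely_generated G \<longleftrightarrow> (\<exists>S. finite S \<and> S \<subseteq> carrier G \<and> generate G S = carrier G)"

text \<open>The minimal size of a generating set. The value is meaningful only for finitely
  generated groups.\<close>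

definition min_gens :: "('a, 'b) monoid_scheme \<Rightarrow> nat" where
  "min_gens G = (LEAST n. \<exists>S. finite S \<and> card S = n \<and> S \<subseteq> carrier G \<and> generate G S = carrier G)"

primrec lower_central :: "('a, 'b) monoid_scheme \<Rightarrow> nat \<Rightarrow> 'a set" where
  "lower_central G 0 = carrier G"
| "lower_central G (Suc n) =
     generate G (\<Union>x \<in> carrier G. \<Union>y \<in> lower_central G n.
       {x \<otimes>\<^bsub>G\<^esub> y \<otimes>\<^bsub>G\<^esub> inv\<^bsub>G\<^esub> x \<otimes>\<^bsub>G\<^esub> inv\<^bsub>G\<^esub> y})"

definition nilpotent_group :: "('a, 'b) monoid_scheme \<Rightarrow> bool" where
  "nilpotent_group G \<longleftrightarrow> group G \<and> (\<exists>n. lower_central G n = {\<one>\<^bsub>G\<^esub>})"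

definition power_subgroup :: "('a, 'b) monoid_scheme \<Rightarrow> 'a set \<Rightarrow> nat \<Rightarrow> 'a set" where
  "power_subgroup G U n = generate G ((\<lambda>u. u [^]\<^bsub>G\<^esub> n) ` U)"

definition finite_index_normals :: "('a, 'b) monoid_scheme \<Rightarrow> 'a set set" where
  "finite_index_normals G = {N. N \<lhd> G \<and> finite (carrier (G Mod N))}"

text \<open>The profinite completion is the inverse limit of the finite quotients of \<open>G\<close>: the subgroup
  of their product formed by the families that are compatible with the canonical projections
  \<open>G/M \<rightarrow> G/N\<close>, \<open>C \<mapsto> NC\<close>, for \<open>M \<subseteq> N\<close>. It carries the topology induced from the product of
  the discrete topologies.\<close>

definition profinite_completion :: "('a, 'b) monoid_scheme \<Rightarrow> ('a set \<Rightarrow> 'a set) monoid" where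
  "profinite_completion G =
     (product_group (finite_index_normals G) (\<lambda>N. G Mod N))
       \<lparr>carrier := {x \<in> (\<Pi>\<^sub>E N \<in> finite_index_normals G. carrier (G Mod N)).
          \<forall>M \<in> finite_index_normals G. \<forall>N \<in> finite_index_normals G.
            M \<subseteq> N \<longrightarrow> N <#>\<^bsub>G\<^esub> x M = x N}\<rparr>"

definition profinite_topology :: "('a, 'b) monoid_scheme \<Rightarrow> ('a set \<Rightarrow> 'a set) topology" where
  "profinite_topology G =
     subtopology
       (product_topology (\<lambda>N. discrete_topology (carrier (G Mod N))) (finite_index_normals G))
       (carrier (profinite_completion G))"

text \<open>The minimal size of a topological generating set of the profinite completion of \<open>G\<close>.
  If \<open>G\<close> is finitely generated, such finite sets exist, since \<open>G\<close> has dense image in its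
  profinite completion.\<close>

definition profinite_min_gens :: "('a, 'b) monoid_scheme \<Rightarrow> nat" where
  "profinite_min_gens G =
     (LEAST n. \<exists>S. finite S \<and> card S = n \<and> S \<subseteq> carrier (profinite_completion G) \<and>
        profinite_topology G closure_of (generate (profinite_completion G) S)
          = carrier (profinite_completion G))"

definition d_mod :: "('a, 'b) monoid_scheme \<Rightarrow> 'a set \<Rightarrow> nat \<Rightarrow> nat" where
  "d_mod G U p = min_gens (G Mod (power_subgroup G U p))"

text \<open>The following facts show that the maximum and the minimum of \<open>d_mod G U p\<close> over all
  primes \<open>p\<close> are taken over finite sets.\<close>

lemma finitely_generated_extension:
  fixes G (structure)
  assumes "U \<lhd> G" "finitely_generated (G\<lparr>carrier := U\<rparr>)" "finite (carrier (G Mod U))"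
  shows "finitely_generated G"
proof -
  interpret normal U G by fact
  obtain S where S: "finite S" "S \<subseteq> U" "generate (G\<lparr>carrier := U\<rparr>) S = U"
    using assms(2) by (auto simp: finitely_generated_def)
  have gS: "generate G S = U"
    using S generate_consistent[OF S(2) is_subgroup] by simp
  define r where "r = (\<lambda>C. SOME g. g \<in> carrier G \<and> C = U #> g)"
  have r: "r C \<in> carrier G \<and> C = U #> r C" if "C \<in> carrier (G Mod U)" for C
  proof -
    have "\<exists>g. g \<in> carrier G \<and> C = U #> g"
      using that by (auto simp: FactGroup_def RCOSETS_def)
    then show ?thesis unfolding r_def by (rule someI_ex)
  qed
  let ?T = "S \<union> r ` carrier (G Mod U)"
  have T: "?T \<subseteq> carrier G" "finite ?T"
    using S r subset assms(3) by auto
  have "carrier G \<subseteq> generate G ?T"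
  proof
    fix g assume g: "g \<in> carrier G"
    let ?C = "U #> g"
    have C: "?C \<in> carrier (G Mod U)"
      using g by (auto simp: FactGroup_def RCOSETS_def)
    have "g \<in> U #> r ?C"
      using r[OF C] rcos_self[OF g is_subgroup] by simp
    then obtain u where u: "u \<in> U" "g = u \<otimes> r ?C"
      by (auto simp: r_coset_def)
    have "u \<in> generate G ?T"
      using u(1) gS mono_generate[of S ?T] by auto
    moreover have "r ?C \<in> generate G ?T"
      using C by (intro generate.incl) auto
    ultimately show "g \<in> generate G ?T"
      using u(2) generate.eng by metis
  qed
  then show ?thesis
    using T generate_incl[OF T(1)] unfolding finitely_generated_def by blast
qed

lemma power_subgroup_normal:
  fixes G (structure)
  assumes "U \<lhd> G"
  shows "power_subgroup G U n \<lhd> G"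
proof -
  interpret normal U G by fact
  have conj: "g \<otimes> u [^] n \<otimes> inv g = (g \<otimes> u \<otimes> inv g) [^] n"
    if "g \<in> carrier G" "u \<in> carrier G" for g u and n :: nat
  proof (induction n)
    case 0
    then show ?case using that by simp
  next
    case (Suc n)
    have "(g \<otimes> u \<otimes> inv g) [^] Suc n = (g \<otimes> u [^] n \<otimes> inv g) \<otimes> (g \<otimes> u \<otimes> inv g)"
      using Suc by simp
    also have "\<dots> = g \<otimes> u [^] n \<otimes> (inv g \<otimes> g) \<otimes> u \<otimes> inv g"
      using that by (simp only: m_assoc m_closed inv_closed nat_pow_closed)
    also have "\<dots> = g \<otimes> u [^] Suc n \<otimes> inv g"
      using that by (simp add: m_assoc)
    finally show ?case by simp
  qed
  show ?thesis
    unfolding power_subgroup_def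
  proof (rule normal_generateI)
    show "(\<lambda>u. u [^] n) ` U \<subseteq> carrier G"
      using subset by auto
  next
    fix h g assume h: "h \<in> (\<lambda>u. u [^] n) ` U" and g: "g \<in> carrier G"
    then obtain u where u: "u \<in> U" "h = u [^] n" by auto
    have "g \<otimes> h \<otimes> inv g = (g \<otimes> u \<otimes> inv g) [^] n"
      using conj[OF g] u subset by auto
    moreover have "g \<otimes> u \<otimes> inv g \<in> U"
      using inv_op_closed2[OF g u(1)] .
    ultimately show "g \<otimes> h \<otimes> inv g \<in> (\<lambda>u. u [^] n) ` U"
      by blast
  qed
qed

lemma min_gens_Mod_le:
  fixes G (structure)
  assumes "N \<lhd> G" "finitely_generated G"
  shows "min_gens (G Mod N) \<le> min_gens G"
proof -
  interpret normal N G by fact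
  have "\<exists>n S. finite S \<and> card S = n \<and> S \<subseteq> carrier G \<and> generate G S = carrier G"
    using assms(2) by (auto simp: finitely_generated_def)
  then have "\<exists>S. finite S \<and> card S = min_gens G \<and> S \<subseteq> carrier G \<and> generate G S = carrier G"
    unfolding min_gens_def by (rule LeastI_ex)
  then obtain S where S: "finite S" "card S = min_gens G" "S \<subseteq> carrier G"
      "generate G S = carrier G"
    by blast
  interpret h: group_hom G "G Mod N" "(#>) N"
    by (intro group_hom.intro group_hom_axioms.intro is_group factorgroup_is_group r_coset_hom_Mod)
  have "generate (G Mod N) ((#>) N ` S) = (#>) N ` carrier G"
    using h.generate_img[OF S(3)] S(4) by simp
  also have "\<dots> = carrier (G Mod N)"
    by (auto simp: FactGroup_def RCOSETS_def)
  finally have "min_gens (G Mod N) \<le> card ((#>) N ` S)"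
    unfolding min_gens_def using S(1,3)
    by (intro Least_le exI[of _ "(#>) N ` S"]) auto
  also have "\<dots> \<le> min_gens G"
    using card_image_le[OF S(1)] S(2) by simp
  finally show ?thesis .
qed

lemma finite_range_d_mod:
  assumes "U \<lhd> G" "finitely_generated (G\<lparr>carrier := U\<rparr>)" "finite (carrier (G Mod U))"
  shows "finite (d_mod G U ` A)"
proof (rule finite_subset)
  show "d_mod G U ` A \<subseteq> {..min_gens G}"
    using min_gens_Mod_le[OF power_subgroup_normal finitely_generated_extension] assms
    by (auto simp: d_mod_def)
qed simp

end

theory Submission
  imports Defs "HOL-Algebra.Multiplicative_Group" "HOL-Algebra.Zassenhaus"
begin

text \<open>Write \<open>d\<^sub>p\<close> for the number of generators of \<open>G/U\<^sup>p\<close>. An abelian group is nilpotent, so \<open>U\<close> is a finitely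
  generated nilpotent group throughout.

  The powers \<open>U\<^sup>p\<close> act as a Frattini subgroup, one prime at a time. If a subgroup \<open>H\<close> satisfies
  \<open>U\<^sup>qH = G\<close> for a prime \<open>q\<close>, then it has finite index prime to \<open>q\<close>
  (\<open>coprime_index_of_supplement\<close>), and conversely \<open>U\<^sup>mH = G\<close> whenever \<open>UH = G\<close> and the index of \<open>H\<close> is
  finite and prime to \<open>m\<close> (\<open>supplement_of_coprime_index\<close>). So a set that generates \<open>G\<close> modulo \<open>U\<^sup>p\<close> for
  all \<open>p\<close> generates \<open>G\<close>, and a set that generates modulo a single \<open>U\<^sup>q\<close> does so modulo \<open>U\<^sup>p\<close> for all
  but finitely many \<open>p\<close>.

  Generators modulo different primes are combined by two tools. Elements of \<open>G\<close> can be prescribed modulo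
  finitely many \<open>U\<^sup>p\<close> if the prescriptions agree modulo \<open>U\<close> (\<open>simultaneous_approximation\<close>), and
  Gaschuetz's lemma (\<open>gaschuetz_mod\<close>) makes them agree: if a list of given length and with a given initial part
  generates \<open>G\<close> modulo \<open>U\<^sup>p\<close>, then its free entries can be chosen in any cosets of \<open>U\<close> that
  generate \<open>G/U\<close> together with the initial part.

  The core is \<open>generators_exist\<close>. Suppose \<open>d\<^sub>p \<le> n + 1\<close> for all primes and \<open>d\<^sub>p \<le> n\<close> for the primes in a
  finite nonempty set \<open>Q\<close>. Choose elements one after the other, and keep the invariant that for all \<open>p\<close> the
  list chosen so far extends to \<open>n + 1\<close> generators modulo \<open>U\<^sup>p\<close>, and for \<open>p \<in> Q\<close> even to \<open>n\<close> generators. An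
  extension to \<open>n\<close> generators modulo one prime is one modulo almost every prime. At a prime that admits such an
  extension every choice of the next element is harmless, because there is one entry to spare; at the
  finitely many others, and at those in \<open>Q\<close>, the next element is prescribed. After \<open>n\<close> elements only finitely
  many primes are left, and one more element settles them.

  If the \<open>d\<^sub>p\<close> are not all equal, then \<open>k = \<alpha>\<close>; take \<open>n = \<alpha> - 1\<close> and for \<open>Q\<close> a prime with \<open>d\<^sub>p = \<beta>\<close>, and the
  \<open>\<alpha>\<close> elements generate \<open>G\<close> itself. If they are all equal, then \<open>k = \<alpha> + 1\<close>; take \<open>n = \<alpha>\<close> and let \<open>Q\<close> contain
  the prime divisors of \<open>N\<close>, so that the first \<open>\<alpha>\<close> elements generate a subgroup of index prime to \<open>N\<close>.

  For the profinite completion, \<open>\<alpha>\<close> generators modulo each \<open>U\<^sup>p\<close> yield \<open>\<alpha>\<close> generators modulo each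
  \<open>U\<^sup>m\<close> (\<open>generates_mod_power\<close>); by Gaschuetz's lemma they can be chosen compatibly along the chain
  \<open>U\<^sup>n\<^sup>!\<close>, which is cofinal among the normal subgroups of finite index, and their limits generate a dense
  subgroup (\<open>profinite_generators\<close>). The reverse inequality holds because the completion maps onto
  each finite group \<open>G/U\<^sup>p\<close>.\<close>

section \<open>Products with normal subgroups and indices\<close>

lemma (in group) normal_mult_subgroup:
  assumes "K \<lhd> G" "subgroup H G"
  shows "subgroup (K <#> H) G"
  using mult_norm_subgroup assms by blast

lemma (in group) set_mult_memI: "h \<in> H \<Longrightarrow> k \<in> K \<Longrightarrow> h \<otimes> k \<in> H <#> K"
  by (auto simp: set_mult_def)

lemma (in group) subset_normal_mult:
  assumes "K \<lhd> G" "subgroup H G"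
  shows "K \<subseteq> K <#> H" "H \<subseteq> K <#> H"
proof -
  interpret K: normal K G by fact
  interpret H: subgroup H G by fact
  show "K \<subseteq> K <#> H"
  proof
    fix k assume k: "k \<in> K"
    then show "k \<in> K <#> H" using set_mult_memI[OF k H.one_closed] by simp
  qed
  show "H \<subseteq> K <#> H"
  proof
    fix k assume k: "k \<in> H"
    then show "k \<in> K <#> H" using set_mult_memI[OF K.one_closed k] by simp
  qed
qed

lemma (in group) generate_normal_Un:
  assumes K: "K \<lhd> G" and S: "S \<subseteq> carrier G"
  shows "generate G (K \<union> S) = K <#> generate G S"
proof
  interpret K: normal K G by fact
  have sub: "subgroup (K <#> generate G S) G"
    using normal_mult_subgroup[OF K generate_is_subgroup[OF S]] .
  show "generate G (K \<union> S) \<subseteq> K <#> generate G S"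
    using subset_normal_mult[OF K generate_is_subgroup[OF S]]
    by (intro generate_subgroup_incl[OF _ sub]) (auto intro: generate.incl)
  show "K <#> generate G S \<subseteq> generate G (K \<union> S)"
  proof
    fix x assume "x \<in> K <#> generate G S"
    then obtain k s where "k \<in> K" "s \<in> generate G S" "x = k \<otimes> s"
      by (auto simp: set_mult_def)
    then show "x \<in> generate G (K \<union> S)"
      using mono_generate[of S "K \<union> S"] by (auto intro: generate.eng generate.incl)
  qed
qed

text \<open>Choose a representative \<open>r(C)\<close> of every coset \<open>C\<close> of \<open>K\<close>; then \<open>(C, Hk) \<mapsto> Hkr(C)\<close> is a bijection.
  A bijection, rather than an equation between cardinalities, also shows when the indices are finite.\<close>

lemma (in group) index_tower:
  assumes H: "subgroup H G" and K: "subgroup K G" and HK: "H \<subseteq> K"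
  shows "\<exists>f. bij_betw f ((rcosets K) \<times> (rcosets\<^bsub>G\<lparr>carrier := K\<rparr>\<^esub> H)) (rcosets H)"
proof -
  interpret H: subgroup H G by fact
  interpret K: subgroup K G by fact
  define r where "r C = (SOME g. g \<in> carrier G \<and> C = K #> g)" for C
  have r: "r C \<in> carrier G" "C = K #> r C" if C: "C \<in> rcosets K" for C
  proof -
    have "\<exists>g. g \<in> carrier G \<and> C = K #> g" using C by (auto simp: RCOSETS_def)
    then have "r C \<in> carrier G \<and> C = K #> r C" unfolding r_def by (rule someI_ex)
    then show "r C \<in> carrier G" "C = K #> r C" by auto
  qed
  have rcK: "rcosets\<^bsub>G\<lparr>carrier := K\<rparr>\<^esub> H = (\<lambda>k. H #> k) ` K"
    by (auto simp: RCOSETS_def)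
  have rcH: "rcosets H = (\<lambda>k. H #> k) ` carrier G"
    by (auto simp: RCOSETS_def)
  define f where "f = (\<lambda>(C, D). D #> r C)"
  have f: "f (C, H #> k) = H #> (k \<otimes> r C)" if "C \<in> rcosets K" "k \<in> K" for C k
    using that r coset_mult_assoc[OF H.subset] by (simp add: f_def)
  have eqH: "x \<otimes> inv y \<in> H" if "H #> x = H #> y" "x \<in> carrier G" "y \<in> carrier G" for x y
  proof -
    have "x \<in> H #> y" using rcos_self[OF that(2) H] that(1) by simp
    then show ?thesis using H.rcos_module[OF group_axioms that(3,2)] by simp
  qed
  have "inj_on f ((rcosets K) \<times> (rcosets\<^bsub>G\<lparr>carrier := K\<rparr>\<^esub> H))"
  proof (rule inj_onI)
    fix x y assume xy: "x \<in> (rcosets K) \<times> (rcosets\<^bsub>G\<lparr>carrier := K\<rparr>\<^esub> H)"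
      "y \<in> (rcosets K) \<times> (rcosets\<^bsub>G\<lparr>carrier := K\<rparr>\<^esub> H)" "f x = f y"
    obtain C k where x: "x = (C, H #> k)" "C \<in> rcosets K" "k \<in> K" using xy(1) rcK by auto
    obtain D l where y: "y = (D, H #> l)" "D \<in> rcosets K" "l \<in> K" using xy(2) rcK by auto
    have kl: "k \<in> carrier G" "l \<in> carrier G" using x y by auto
    have eq: "H #> (k \<otimes> r C) = H #> (l \<otimes> r D)" using xy(3) x y f by simp
    have "k \<otimes> r C \<otimes> inv (l \<otimes> r D) \<in> H"
      using eqH[OF eq] r(1)[OF x(2)] r(1)[OF y(2)] kl by simp
    then have "k \<otimes> r C \<otimes> inv (l \<otimes> r D) \<in> K" using HK by auto
    then have "inv k \<otimes> (k \<otimes> r C \<otimes> inv (l \<otimes> r D)) \<otimes> l \<in> K"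
      using x(3) y(3) by auto
    moreover have "inv k \<otimes> (k \<otimes> r C \<otimes> inv (l \<otimes> r D)) \<otimes> l = r C \<otimes> inv (r D)"
      using r(1)[OF x(2)] r(1)[OF y(2)] kl
      by (simp add: inv_mult_group m_assoc flip: m_assoc[of "inv k" k])
    ultimately have "r C \<in> K #> r D"
      using K.rcos_module[OF group_axioms r(1)[OF y(2)] r(1)[OF x(2)]] by simp
    then have "C = D"
      using repr_independence[OF _ r(1)[OF y(2)] K] r(2)[OF x(2)] r(2)[OF y(2)] by simp
    have "H #> k = H #> (k \<otimes> r C) #> inv (r C)"
      using kl r(1)[OF x(2)] coset_mult_assoc[OF H.subset] by (simp add: m_assoc)
    also have "\<dots> = H #> (l \<otimes> r C) #> inv (r C)" using eq \<open>C = D\<close> by simp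
    also have "\<dots> = H #> l"
      using kl r(1)[OF x(2)] coset_mult_assoc[OF H.subset] by (simp add: m_assoc)
    finally show "x = y" using x y \<open>C = D\<close> by simp
  qed
  moreover have "f ` ((rcosets K) \<times> (rcosets\<^bsub>G\<lparr>carrier := K\<rparr>\<^esub> H)) = rcosets H"
  proof
    show "f ` ((rcosets K) \<times> (rcosets\<^bsub>G\<lparr>carrier := K\<rparr>\<^esub> H)) \<subseteq> rcosets H"
      using f r by (auto simp: rcK rcH)
    show "rcosets H \<subseteq> f ` ((rcosets K) \<times> (rcosets\<^bsub>G\<lparr>carrier := K\<rparr>\<^esub> H))"
    proof
      fix D assume "D \<in> rcosets H"
      then obtain g where g: "g \<in> carrier G" "D = H #> g" using rcH by auto
      let ?C = "K #> g"
      have C: "?C \<in> rcosets K" using g rcosetsI K.subset by auto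
      have "g \<in> K #> r ?C" using r(2)[OF C] rcos_self[OF g(1) K] by simp
      then obtain k where k: "k \<in> K" "g = k \<otimes> r ?C" by (auto simp: r_coset_def)
      have "D = f (?C, H #> k)" using f[OF C k(1)] g(2) k(2) by simp
      then show "D \<in> f ` ((rcosets K) \<times> (rcosets\<^bsub>G\<lparr>carrier := K\<rparr>\<^esub> H))"
        using C k(1) rcK by blast
    qed
  qed
  ultimately show ?thesis unfolding bij_betw_def by blast
qed

lemma (in group) rcosets_nonempty: "rcosets H \<noteq> {}"
  by (auto simp: RCOSETS_def)

lemma (in group) finite_index_tower:
  assumes H: "subgroup H G" and K: "subgroup K G" and HK: "H \<subseteq> K"
  shows "finite (rcosets H) \<longleftrightarrow> finite (rcosets K) \<and> finite (rcosets\<^bsub>G\<lparr>carrier := K\<rparr>\<^esub> H)"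
proof -
  interpret K: group "G\<lparr>carrier := K\<rparr>" using subgroup_imp_group[OF K] .
  obtain f where "bij_betw f ((rcosets K) \<times> (rcosets\<^bsub>G\<lparr>carrier := K\<rparr>\<^esub> H)) (rcosets H)"
    using index_tower[OF assms] by blast
  then have "finite (rcosets H) = finite ((rcosets K) \<times> (rcosets\<^bsub>G\<lparr>carrier := K\<rparr>\<^esub> H))"
    by (simp add: bij_betw_finite)
  then show ?thesis
    using K.rcosets_nonempty[of H] rcosets_nonempty[of K] by (simp add: finite_cartesian_product_iff)
qed

lemma (in group) card_index_tower:
  assumes H: "subgroup H G" and K: "subgroup K G" and HK: "H \<subseteq> K"
  shows "card (rcosets H) = card (rcosets K) * card (rcosets\<^bsub>G\<lparr>carrier := K\<rparr>\<^esub> H)"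
proof -
  obtain f where "bij_betw f ((rcosets K) \<times> (rcosets\<^bsub>G\<lparr>carrier := K\<rparr>\<^esub> H)) (rcosets H)"
    using index_tower[OF assms] by blast
  from bij_betw_same_card[OF this] show ?thesis by (simp add: card_cartesian_product)
qed

text \<open>Intersecting the cosets of \<open>H\<close> with \<open>U\<close> is inverse to \<open>(H \<inter> U)u \<mapsto> Hu\<close>; this moves questions about
  the index of \<open>H\<close> into the supplement \<open>U\<close>.\<close>

lemma (in group) index_Int:
  assumes H: "subgroup H G" and U: "subgroup U G" and HU: "carrier G = H <#> U"
  shows "\<exists>f. bij_betw f (rcosets\<^bsub>G\<lparr>carrier := U\<rparr>\<^esub> (H \<inter> U)) (rcosets H)"
proof -
  interpret H: subgroup H G by fact
  interpret U: subgroup U G by fact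
  let ?W = "H \<inter> U"
  have W: "subgroup ?W G" using subgroups_Inter_pair[OF H U] .
  have rcU: "rcosets\<^bsub>G\<lparr>carrier := U\<rparr>\<^esub> ?W = (\<lambda>k. ?W #> k) ` U"
    by (auto simp: RCOSETS_def)
  have rcH: "rcosets H = (\<lambda>k. H #> k) ` carrier G"
    by (auto simp: RCOSETS_def)
  have HW: "H <#> ?W = H"
    using set_mult_subgroup_idem[OF H, of ?W] subgroup_incl[OF W H] by auto
  have f: "H <#> (?W #> u) = H #> u" if "u \<in> U" for u
    using that HW setmult_rcos_assoc[of H ?W u] H.subset U.subset by auto
  have "inj_on (\<lambda>C. H <#> C) (rcosets\<^bsub>G\<lparr>carrier := U\<rparr>\<^esub> ?W)"
  proof (rule inj_onI)
    fix C D assume CD: "C \<in> rcosets\<^bsub>G\<lparr>carrier := U\<rparr>\<^esub> ?W" "D \<in> rcosets\<^bsub>G\<lparr>carrier := U\<rparr>\<^esub> ?W"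
      "H <#> C = H <#> D"
    obtain u v where u: "u \<in> U" "C = ?W #> u" and v: "v \<in> U" "D = ?W #> v"
      using CD rcU by auto
    have "H #> u = H #> v" using CD(3) f u v by simp
    then have "u \<in> H #> v" using rcos_self[OF _ H, of u] u by auto
    then have "u \<otimes> inv v \<in> H" using H.rcos_module[OF group_axioms, of v u] u v by auto
    then have "u \<otimes> inv v \<in> ?W" using u v by auto
    then have "u \<in> ?W #> v"
      using subgroup.rcos_module[OF W group_axioms, of v u] u v by auto
    then show "C = D" using repr_independence[OF _ _ W, of u v] u v by auto
  qed
  moreover have "(\<lambda>C. H <#> C) ` (rcosets\<^bsub>G\<lparr>carrier := U\<rparr>\<^esub> ?W) = rcosets H"
  proof
    show "(\<lambda>C. H <#> C) ` (rcosets\<^bsub>G\<lparr>carrier := U\<rparr>\<^esub> ?W) \<subseteq> rcosets H"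
      using f by (auto simp: rcU rcH)
    show "rcosets H \<subseteq> (\<lambda>C. H <#> C) ` (rcosets\<^bsub>G\<lparr>carrier := U\<rparr>\<^esub> ?W)"
    proof
      fix C assume "C \<in> rcosets H"
      then obtain g where g: "g \<in> carrier G" "C = H #> g" using rcH by auto
      then obtain h u where hu: "h \<in> H" "u \<in> U" "g = h \<otimes> u" using HU by (auto simp: set_mult_def)
      have "C = (H #> h) #> u" using g hu coset_mult_assoc[OF H.subset] by simp
      also have "\<dots> = H #> u" using hu(1) H.rcos_const by (simp add: group_axioms)
      also have "\<dots> = H <#> (?W #> u)" using f hu by simp
      finally show "C \<in> (\<lambda>C. H <#> C) ` (rcosets\<^bsub>G\<lparr>carrier := U\<rparr>\<^esub> ?W)"
        using hu(2) rcU by blast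
    qed
  qed
  ultimately show ?thesis unfolding bij_betw_def by blast
qed

lemma (in group) subgroup_pow_closed: "subgroup H G \<Longrightarrow> h \<in> H \<Longrightarrow> h [^] (n::nat) \<in> H"
  by (induction n) (auto intro: subgroup.m_closed subgroup.one_closed)

text \<open>Finiteness and coprimality travel together along chains of subgroups; for \<open>r = 1\<close> only finiteness
  remains.\<close>

definition (in group) coprime_index :: "nat \<Rightarrow> 'a set \<Rightarrow> bool" where
  "coprime_index r H \<longleftrightarrow> finite (rcosets H) \<and> coprime (card (rcosets H)) r"

lemma (in group) coprime_index_carrier: "coprime_index r (carrier G)"
proof -
  have "rcosets (carrier G) = {carrier G}"
    using coset_join2[OF _ subgroup_self] by (auto simp: RCOSETS_def)
  then show ?thesis by (simp add: coprime_index_def)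
qed

text \<open>Adjoining to \<open>L\<close> one element that normalizes it produces a cyclic quotient, whose order divides
  every exponent that carries the new element into \<open>L\<close>; then the index is multiplicative.\<close>

lemma (in group) coprime_index_insert:
  assumes L: "subgroup L G" and f: "f \<in> carrier G"
    and norm: "\<And>x. x \<in> L \<Longrightarrow> f \<otimes> x \<otimes> inv f \<in> L" "\<And>x. x \<in> L \<Longrightarrow> inv f \<otimes> x \<otimes> f \<in> L"
    and e: "f [^] e \<in> L" "e > 0" "coprime e r"
    and ind: "coprime_index r (generate G (insert f L))"
  shows "coprime_index r L"
proof -
  interpret L: subgroup L G by fact
  let ?M = "generate G (insert f L)"
  have sM: "subgroup ?M G" using f L.subset by (intro generate_is_subgroup) auto
  interpret M: group "G\<lparr>carrier := ?M\<rparr>" using subgroup_imp_group[OF sM] .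
  have LM: "L \<subseteq> ?M" "f \<in> ?M" by (auto intro: generate.incl)
  have nn: "g \<otimes> x \<otimes> inv g \<in> L \<and> inv g \<otimes> x \<otimes> g \<in> L" if "g \<in> ?M" "x \<in> L" for g x
    using that
  proof (induction arbitrary: x rule: generate.induct)
    case one then show ?case by simp
  next
    case (incl h)
    then consider "h = f" | "h \<in> L" by blast
    then show ?case using norm[OF incl(2)] incl(2) by cases simp_all
  next
    case (inv h)
    then consider "h = f" | "h \<in> L" by blast
    then show ?case using norm[OF inv(2)] inv(2) f by cases simp_all
  next
    case (eng g h)
    have gh: "g \<in> carrier G" "h \<in> carrier G"
      using subgroup.mem_carrier[OF sM] eng(1,2) by simp_all
    have "g \<otimes> (h \<otimes> x \<otimes> inv h) \<otimes> inv g \<in> L" "inv h \<otimes> (inv g \<otimes> x \<otimes> g) \<otimes> h \<in> L"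
      using eng(3)[of "h \<otimes> x \<otimes> inv h"] eng(3)[of x] eng(4)[of x]
        eng(4)[of "inv g \<otimes> x \<otimes> g"] eng(5) by blast+
    then show ?case using gh L.mem_carrier[OF eng(5)] by (simp add: inv_mult_group m_assoc)
  qed
  have N: "L \<lhd> G\<lparr>carrier := ?M\<rparr>"
  proof (rule M.normal_invI)
    show "subgroup L (G\<lparr>carrier := ?M\<rparr>)" using subgroup_incl[OF L sM LM(1)] .
    show "x \<otimes>\<^bsub>G\<lparr>carrier := ?M\<rparr>\<^esub> h \<otimes>\<^bsub>G\<lparr>carrier := ?M\<rparr>\<^esub> inv\<^bsub>G\<lparr>carrier := ?M\<rparr>\<^esub> x \<in> L"
      if "x \<in> carrier (G\<lparr>carrier := ?M\<rparr>)" "h \<in> L" for x h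
      using that nn[of x h] m_inv_consistent[OF sM, of x] by simp
  qed
  interpret N: normal L "G\<lparr>carrier := ?M\<rparr>" by fact
  let ?Q = "(G\<lparr>carrier := ?M\<rparr>) Mod L"
  interpret Q: group ?Q by (rule N.factorgroup_is_group)
  have "(#>\<^bsub>G\<lparr>carrier := ?M\<rparr>\<^esub>) L = (#>) L"
    by (rule ext) simp
  then interpret h: group_hom "G\<lparr>carrier := ?M\<rparr>" ?Q "(#>) L"
    using N.r_coset_hom_Mod
    by (intro group_hom.intro group_hom_axioms.intro M.group_axioms Q.group_axioms) simp
  have cQ: "carrier ?Q = (#>) L ` ?M" by (simp add: carrier_FactGroup)
  have LfQ: "L #> f \<in> carrier ?Q" using cQ LM by auto
  have "generate ?Q ((#>) L ` (insert f L)) = (#>) L ` generate (G\<lparr>carrier := ?M\<rparr>) (insert f L)"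
    using LM by (intro h.generate_img) auto
  also have "generate (G\<lparr>carrier := ?M\<rparr>) (insert f L) = ?M"
    using generate_consistent[OF _ sM, of "insert f L"] LM by auto
  finally have gen: "generate ?Q ((#>) L ` (insert f L)) = carrier ?Q" using cQ by simp
  have "(#>) L ` (insert f L) \<subseteq> generate ?Q {L #> f}"
  proof -
    have "L #> x = \<one>\<^bsub>?Q\<^esub>" if "x \<in> L" for x
      using that coset_join2[OF _ L] L.mem_carrier by simp
    then show ?thesis
      using generate.one[of ?Q "{L #> f}"] by (auto intro: generate.incl)
  qed
  then have "carrier ?Q \<subseteq> generate ?Q {L #> f}"
    using gen Q.generate_subgroup_incl[OF _ Q.generate_is_subgroup[of "{L #> f}"]] LfQ by blast
  then have gen1: "generate ?Q {L #> f} = carrier ?Q"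
    using Q.generate_incl[of "{L #> f}"] LfQ by blast
  have "(L #> f) [^]\<^bsub>?Q\<^esub> e = L #> (f [^]\<^bsub>G\<lparr>carrier := ?M\<rparr>\<^esub> e)"
    using N.FactGroup_pow[of f e] LM(2) by simp
  also have "\<dots> = L #> (f [^] e)" by (simp flip: nat_pow_consistent)
  also have "\<dots> = L" using e(1) coset_join2[OF _ L] L.mem_carrier by blast
  finally have pe: "(L #> f) [^]\<^bsub>?Q\<^esub> e = \<one>\<^bsub>?Q\<^esub>" by simp
  then have od: "Q.ord (L #> f) dvd e" using Q.pow_eq_id[OF LfQ] by simp
  then have ne: "Q.ord (L #> f) \<noteq> 0" using e(2) by auto
  have oc: "Q.ord (L #> f) = card (carrier ?Q)"
    using Q.generate_pow_card[OF LfQ] gen1 by simp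
  have "card (carrier ?Q) \<noteq> 0" using ne unfolding oc .
  then have "finite (carrier ?Q)" by (rule contrapos_np) (rule card.infinite)
  then have fin: "finite (rcosets\<^bsub>G\<lparr>carrier := ?M\<rparr>\<^esub> L)" by (simp add: FactGroup_def)
  have "card (rcosets\<^bsub>G\<lparr>carrier := ?M\<rparr>\<^esub> L) dvd e" using od oc by (simp add: FactGroup_def)
  then have "coprime (card (rcosets\<^bsub>G\<lparr>carrier := ?M\<rparr>\<^esub> L)) r"
    by (rule coprime_divisors[OF _ dvd_refl e(3)])
  then show ?thesis
    using ind fin finite_index_tower[OF L sM LM(1)] card_index_tower[OF L sM LM(1)]
    unfolding coprime_index_def by simp
qed

section \<open>The lower central series\<close>

context group
begin

abbreviation commutator :: "'a \<Rightarrow> 'a \<Rightarrow> 'a" where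
  "commutator x y \<equiv> x \<otimes> y \<otimes> inv x \<otimes> inv y"

lemma lower_central_Suc:
  "lower_central G (Suc i) = generate G {commutator x y | x y. x \<in> carrier G \<and> y \<in> lower_central G i}"
  by (auto intro!: arg_cong[where f = "generate G"])

declare lower_central.simps(2) [simp del]

lemma conj_commutator:
  assumes "g \<in> carrier G" "x \<in> carrier G" "y \<in> carrier G"
  shows "g \<otimes> commutator x y \<otimes> inv g = commutator (g \<otimes> x \<otimes> inv g) (g \<otimes> y \<otimes> inv g)"
proof -
  have 1: "inv g \<otimes> (g \<otimes> z) = z" if "z \<in> carrier G" for z
    using assms that by (simp flip: m_assoc)
  show ?thesis using assms by (simp add: inv_mult_group m_assoc 1)
qed

lemma lower_central_normal: "lower_central G i \<lhd> G"
proof (induction i)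
  case 0
  then show ?case using normal_self by simp
next
  case (Suc i)
  interpret n: normal "lower_central G i" G by fact
  show ?case
    unfolding lower_central_Suc
  proof (rule normal_generateI)
    show "{commutator x y |x y. x \<in> carrier G \<and> y \<in> lower_central G i} \<subseteq> carrier G"
      using n.subset by auto
    fix h g
    assume "h \<in> {commutator x y |x y. x \<in> carrier G \<and> y \<in> lower_central G i}" and g: "g \<in> carrier G"
    then obtain x y where xy: "x \<in> carrier G" "y \<in> lower_central G i" "h = commutator x y" by auto
    have "g \<otimes> h \<otimes> inv g = commutator (g \<otimes> x \<otimes> inv g) (g \<otimes> y \<otimes> inv g)"
      using conj_commutator[OF g xy(1)] xy n.mem_carrier by simp
    moreover have "g \<otimes> y \<otimes> inv g \<in> lower_central G i"
      using n.inv_op_closed2[OF g xy(2)] .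
    ultimately show "g \<otimes> h \<otimes> inv g \<in> {commutator x y |x y. x \<in> carrier G \<and> y \<in> lower_central G i}"
      using g xy by blast
  qed
qed

lemma lower_central_subgroup: "subgroup (lower_central G i) G"
  using lower_central_normal normal_imp_subgroup by blast

lemma lower_central_carrier: "y \<in> lower_central G i \<Longrightarrow> y \<in> carrier G"
  using subgroup.mem_carrier[OF lower_central_subgroup] by blast

lemma commutator_lower_central:
  assumes "x \<in> carrier G" "y \<in> lower_central G i"
  shows "commutator x y \<in> lower_central G (Suc i)"
  unfolding lower_central_Suc using assms by (intro generate.incl) blast

lemma lower_central_Suc_subset: "lower_central G (Suc i) \<subseteq> lower_central G i"
proof -
  interpret n: normal "lower_central G i" G by (rule lower_central_normal)
  show ?thesis
    unfolding lower_central_Suc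
  proof (rule generate_subgroup_incl[OF _ lower_central_subgroup])
    show "{commutator x y |x y. x \<in> carrier G \<and> y \<in> lower_central G i} \<subseteq> lower_central G i"
      using n.inv_op_closed2 n.m_closed n.m_inv_closed by auto
  qed
qed

lemma commutator_swap:
  assumes "x \<in> carrier G" "y \<in> carrier G"
  shows "commutator y x = inv (commutator x y)"
  using assms by (simp add: inv_mult_group m_assoc)

lemma commutator_lower_central':
  assumes "x \<in> lower_central G i" "y \<in> carrier G"
  shows "commutator x y \<in> lower_central G (Suc i)"
  using commutator_lower_central[OF assms(2,1)] commutator_swap[of y x] assms lower_central_carrier
    subgroup.m_inv_closed[OF lower_central_subgroup] by metis

lemma commutator_mult_left:
  assumes "x \<in> carrier G" "x' \<in> carrier G" "y \<in> carrier G"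
  shows "commutator (x \<otimes> x') y = x \<otimes> commutator x' y \<otimes> inv x \<otimes> commutator x y"
proof -
  have 1: "inv x \<otimes> (x \<otimes> z) = z" "inv y \<otimes> (y \<otimes> z) = z" if "z \<in> carrier G" for z
    using assms that by (simp_all flip: m_assoc)
  show ?thesis using assms by (simp add: inv_mult_group m_assoc 1)
qed

lemma commutator_mult_right:
  assumes "x \<in> carrier G" "y' \<in> carrier G" "y \<in> carrier G"
  shows "commutator x (y \<otimes> y') = commutator x y \<otimes> (y \<otimes> commutator x y' \<otimes> inv y)"
proof -
  have 1: "inv x \<otimes> (x \<otimes> z) = z" "inv y \<otimes> (y \<otimes> z) = z" if "z \<in> carrier G" for z
    using assms that by (simp_all flip: m_assoc)
  show ?thesis using assms by (simp add: inv_mult_group m_assoc 1)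
qed

lemma commutator_inv_left:
  assumes "x \<in> carrier G" "y \<in> carrier G"
  shows "commutator (inv x) y = inv x \<otimes> inv (commutator x y) \<otimes> x"
proof -
  have 1: "inv x \<otimes> (x \<otimes> z) = z" "inv y \<otimes> (y \<otimes> z) = z" if "z \<in> carrier G" for z
    using assms that by (simp_all flip: m_assoc)
  show ?thesis using assms by (simp add: inv_mult_group m_assoc 1)
qed

lemma commutator_inv_right:
  assumes "x \<in> carrier G" "y \<in> carrier G"
  shows "commutator x (inv y) = inv y \<otimes> inv (commutator x y) \<otimes> y"
proof -
  have 1: "inv x \<otimes> (x \<otimes> z) = z" "inv y \<otimes> (y \<otimes> z) = z" if "z \<in> carrier G" for z
    using assms that by (simp_all flip: m_assoc)
  show ?thesis using assms by (simp add: inv_mult_group m_assoc 1)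
qed

text \<open>Modulo \<open>D\<close> the set below is a centralizer. With its right-hand counterpart it allows commutators
  to be tested on generators only.\<close>

lemma subgroup_commutators_left:
  assumes D: "D \<lhd> G" and y: "y \<in> carrier G"
  shows "subgroup {x \<in> carrier G. commutator x y \<in> D} G"
proof -
  interpret D: normal D G by fact
  show ?thesis
  proof (rule subgroupI)
    show "{x \<in> carrier G. commutator x y \<in> D} \<noteq> {}" using y by (auto intro!: exI[of _ \<one>])
    fix a assume a: "a \<in> {x \<in> carrier G. commutator x y \<in> D}"
    then show "inv a \<in> {x \<in> carrier G. commutator x y \<in> D}"
      using y commutator_inv_left[of a y] D.inv_op_closed1[of a "inv (commutator a y)"] D.m_inv_closed by simp
    fix b assume "b \<in> {x \<in> carrier G. commutator x y \<in> D}"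
    then show "a \<otimes> b \<in> {x \<in> carrier G. commutator x y \<in> D}"
      using a y commutator_mult_left[of a b y] D.inv_op_closed2[of a "commutator b y"] D.m_closed by simp
  qed auto
qed

lemma subgroup_commutators_right:
  assumes D: "D \<lhd> G" and x: "x \<in> carrier G"
  shows "subgroup {y \<in> carrier G. commutator x y \<in> D} G"
proof -
  interpret D: normal D G by fact
  show ?thesis
  proof (rule subgroupI)
    show "{y \<in> carrier G. commutator x y \<in> D} \<noteq> {}" using x by (auto intro!: exI[of _ \<one>])
    fix a assume a: "a \<in> {y \<in> carrier G. commutator x y \<in> D}"
    then show "inv a \<in> {y \<in> carrier G. commutator x y \<in> D}"
      using x commutator_inv_right[of x a] D.inv_op_closed1[of a "inv (commutator x a)"] D.m_inv_closed by simp
    fix b assume "b \<in> {y \<in> carrier G. commutator x y \<in> D}"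
    then show "a \<otimes> b \<in> {y \<in> carrier G. commutator x y \<in> D}"
      using a x commutator_mult_right[of x b a] D.inv_op_closed2[of a "commutator x b"] D.m_closed by simp
  qed auto
qed

text \<open>Modulo the second next term of the series the commutator is bilinear, so the commutators of
  generators of \<open>G\<close> with generators of the \<open>i\<close>-th factor generate the next factor.\<close>

lemma lower_central_finitely_generated_mod:
  assumes "finitely_generated G"
  shows "\<exists>F. finite F \<and> F \<subseteq> lower_central G i \<and> generate G (F \<union> lower_central G (Suc i)) = lower_central G i"
proof (induction i)
  case 0
  obtain S where S: "finite S" "S \<subseteq> carrier G" "generate G S = carrier G"
    using assms by (auto simp: finitely_generated_def)
  have "generate G (S \<union> lower_central G (Suc 0)) = carrier G"
    using S mono_generate[of S "S \<union> lower_central G (Suc 0)"]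
      generate_incl[of "S \<union> lower_central G (Suc 0)"] lower_central_carrier[of _ "Suc 0"] by auto
  then show ?case using S by auto
next
  case (Suc i)
  obtain S where S: "finite S" "S \<subseteq> carrier G" "generate G S = carrier G"
    using assms by (auto simp: finitely_generated_def)
  obtain F where F: "finite F" "F \<subseteq> lower_central G i"
    "generate G (F \<union> lower_central G (Suc i)) = lower_central G i" using Suc by blast
  let ?C = "(\<lambda>(s, x). commutator s x) ` (S \<times> F)"
  let ?D = "generate G (?C \<union> lower_central G (Suc (Suc i)))"
  have C: "?C \<subseteq> lower_central G (Suc i)"
    using S(2) F(2) by (auto intro!: commutator_lower_central)
  have CC: "?C \<union> lower_central G (Suc (Suc i)) \<subseteq> lower_central G (Suc i)"
    using C lower_central_Suc_subset[of "Suc i"] by auto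
  have DC: "?D \<subseteq> lower_central G (Suc i)"
    using generate_subgroup_incl[OF CC lower_central_subgroup] .
  have CG: "?C \<union> lower_central G (Suc (Suc i)) \<subseteq> carrier G"
    using CC lower_central_carrier by blast
  have sD: "subgroup ?D G" using generate_is_subgroup[OF CG] .
  have LD: "lower_central G (Suc (Suc i)) \<subseteq> ?D" by (auto intro: generate.incl)
  \<comment> \<open>\<open>?D\<close> lies between two consecutive terms of the series and is therefore normal.\<close>
  have D: "?D \<lhd> G"
  proof (rule normal_invI[OF sD])
    fix x h assume x: "x \<in> carrier G" and h: "h \<in> ?D"
    have hc: "h \<in> carrier G" using subgroup.mem_carrier[OF sD h] .
    have "commutator x h \<in> ?D"
      using commutator_lower_central[OF x] h DC LD by blast
    then have "commutator x h \<otimes> h \<in> ?D" using subgroup.m_closed[OF sD] h by blast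
    then show "x \<otimes> h \<otimes> inv x \<in> ?D" using x hc by (simp add: m_assoc)
  qed
  have 1: "commutator u x \<in> ?D" if "x \<in> F" "u \<in> carrier G" for x u
  proof -
    have xc: "x \<in> carrier G" using that F lower_central_carrier by blast
    have "S \<subseteq> {u \<in> carrier G. commutator u x \<in> ?D}"
      using S that by (auto intro!: generate.incl)
    then have "generate G S \<subseteq> {u \<in> carrier G. commutator u x \<in> ?D}"
      by (rule generate_subgroup_incl[OF _ subgroup_commutators_left[OF D xc]])
    then show ?thesis using S that by auto
  qed
  have 2: "commutator u y \<in> ?D" if u: "u \<in> carrier G" and y: "y \<in> lower_central G i" for u y
  proof -
    have "commutator u x \<in> ?D" if "x \<in> lower_central G (Suc i)" for x
      using commutator_lower_central[OF u that] LD by blast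
    then have "F \<union> lower_central G (Suc i) \<subseteq> {y \<in> carrier G. commutator u y \<in> ?D}"
      using 1 u F(2) lower_central_carrier by blast
    then have "generate G (F \<union> lower_central G (Suc i)) \<subseteq> {y \<in> carrier G. commutator u y \<in> ?D}"
      by (rule generate_subgroup_incl[OF _ subgroup_commutators_right[OF D u]])
    then show ?thesis using F y by auto
  qed
  have "lower_central G (Suc i) \<subseteq> ?D"
    unfolding lower_central_Suc[of i]
    using 2 by (intro generate_subgroup_incl[OF _ sD[unfolded lower_central_Suc[of i]]]) auto
  then have "?D = lower_central G (Suc i)" using DC by auto
  then show ?case using S F C by (intro exI[of _ ?C]) auto
qed

text \<open>The hypothesis \<open>xy = cyx\<close> says that \<open>c\<close> is the commutator of \<open>x\<close> and \<open>y\<close>. Since \<open>c\<close> is central, each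
  exchange of an \<open>x\<close> with a \<open>y\<close> costs one factor \<open>c\<close>, and \<open>nm\<close> exchanges are made.\<close>

lemma central_commutator_pow:
  assumes x: "x \<in> carrier G" and y: "y \<in> carrier G" and c: "c \<in> carrier G"
    and central: "\<And>g. g \<in> carrier G \<Longrightarrow> c \<otimes> g = g \<otimes> c"
    and xy: "x \<otimes> y = c \<otimes> y \<otimes> x"
  shows "x [^] (n::nat) \<otimes> y [^] (m::nat) = c [^] (n * m) \<otimes> y [^] m \<otimes> x [^] n"
proof -
  have cp: "c [^] k \<otimes> g = g \<otimes> c [^] k" if "g \<in> carrier G" for g and k :: nat
    using group_commutes_pow[OF central[OF that] c that] .
  have 1: "x [^] k \<otimes> y = c [^] k \<otimes> y \<otimes> x [^] k" for k :: nat
  proof (induction k)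
    case 0 then show ?case using y by simp
  next
    case (Suc k)
    have xk: "x [^] k \<in> carrier G" and ck: "c [^] k \<in> carrier G" using x c by auto
    have "x [^] Suc k \<otimes> y = x [^] k \<otimes> (x \<otimes> y)" using x y xk by (simp add: m_assoc)
    also have "\<dots> = (x [^] k \<otimes> c) \<otimes> y \<otimes> x" using x y xy xk c by (simp add: m_assoc)
    also have "\<dots> = c \<otimes> (x [^] k \<otimes> y) \<otimes> x"
      using x y c xk by (simp add: m_assoc flip: central[of "x [^] k"])
    also have "\<dots> = (c \<otimes> c [^] k) \<otimes> y \<otimes> (x [^] k \<otimes> x)"
      using Suc x y c xk ck by (simp add: m_assoc)
    also have "\<dots> = c [^] Suc k \<otimes> y \<otimes> x [^] Suc k"
      using cp[OF c, of k] by simp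
    finally show ?case .
  qed
  show ?thesis
  proof (induction m)
    case 0 then show ?case using x by simp
  next
    case (Suc m)
    have "x [^] n \<otimes> y [^] Suc m = (x [^] n \<otimes> y [^] m) \<otimes> y" using x y by (simp add: m_assoc)
    also have "\<dots> = c [^] (n * m) \<otimes> y [^] m \<otimes> (x [^] n \<otimes> y)" using Suc x y c by (simp add: m_assoc)
    also have "\<dots> = c [^] (n * m) \<otimes> (y [^] m \<otimes> c [^] n) \<otimes> y \<otimes> x [^] n"
      using 1 x y c by (simp add: m_assoc)
    also have "\<dots> = c [^] (n * m) \<otimes> (c [^] n \<otimes> y [^] m) \<otimes> y \<otimes> x [^] n"
      using cp[of "y [^] m" n] y by simp
    also have "\<dots> = (c [^] (n * m) \<otimes> c [^] n) \<otimes> (y [^] m \<otimes> y) \<otimes> x [^] n"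
      using x y c by (simp add: m_assoc)
    also have "\<dots> = c [^] (n * Suc m) \<otimes> y [^] Suc m \<otimes> x [^] n"
      using c nat_pow_mult[OF c, of "n * m" n] by (simp add: add.commute)
    finally show ?case .
  qed
qed

text \<open>Suppose that \<open>Z\<close> is central and generated by commutators, and that \<open>x\<^sup>n = wz\<close> and \<open>y\<^sup>m = w'z'\<close> with \<open>w\<close>, \<open>w'\<close> in \<open>W\<close>.
  Then the \<open>nm\<close>-th power of the commutator of \<open>x\<close> and \<open>y\<close> is the commutator of \<open>x\<^sup>n\<close> and \<open>y\<^sup>m\<close>, which is that of
  \<open>w\<close> and \<open>w'\<close>. So every element of \<open>Z\<close> has a power in \<open>W\<close>, and the factor \<open>Z\<close> can be removed from the
  hypothesis.\<close>

lemma power_in_of_central: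
  fixes r :: nat
  assumes W: "subgroup W G" and Z: "Z \<subseteq> carrier G"
    and central: "\<And>z g. z \<in> Z \<Longrightarrow> g \<in> carrier G \<Longrightarrow> z \<otimes> g = g \<otimes> z"
    and X: "X \<subseteq> carrier G"
    and ZX: "Z = generate G {commutator x y | x y. x \<in> carrier G \<and> y \<in> X}"
    and pow: "\<And>a. a \<in> carrier G \<Longrightarrow> \<exists>e>0. coprime e r \<and> a [^] (e::nat) \<in> W <#> Z"
    and a: "a \<in> carrier G"
  shows "\<exists>e>0. coprime e r \<and> a [^] (e::nat) \<in> W"
proof -
  interpret W: subgroup W G by fact
  let ?C = "{commutator x y | x y. x \<in> carrier G \<and> y \<in> X}"
  have CG: "?C \<subseteq> carrier G" using X by auto
  have sZ: "subgroup Z G" unfolding ZX by (rule generate_is_subgroup[OF CG])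
  let ?P = "\<lambda>z. \<exists>e>0. coprime e r \<and> z [^] (e::nat) \<in> W"
  have com: "?P c" if "c \<in> ?C" for c
  proof -
    have "\<exists>x y. c = commutator x y \<and> x \<in> carrier G \<and> y \<in> X" using that by (rule CollectD)
    then obtain x y where xy: "x \<in> carrier G" "y \<in> X" "c = commutator x y" by (elim exE conjE)
    have y: "y \<in> carrier G" using xy(2) X by blast
    have cZ: "c \<in> Z" unfolding ZX using that by (rule generate.incl)
    have c: "c \<in> carrier G" using cZ Z by blast
    obtain n where n: "n > 0" "coprime n r" "x [^] (n::nat) \<in> W <#> Z" using pow[OF xy(1)] by auto
    obtain m where m: "m > 0" "coprime m r" "y [^] (m::nat) \<in> W <#> Z" using pow[OF y] by auto
    obtain w z where w: "w \<in> W" "z \<in> Z" "x [^] n = w \<otimes> z" using n(3) by (auto simp: set_mult_def)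
    obtain w' z' where w': "w' \<in> W" "z' \<in> Z" "y [^] m = w' \<otimes> z'" using m(3) by (auto simp: set_mult_def)
    have cl: "w \<in> carrier G" "z \<in> carrier G" "w' \<in> carrier G" "z' \<in> carrier G"
      using w(1,2) w'(1,2) Z by auto
    have "x \<otimes> y = c \<otimes> y \<otimes> x" unfolding xy(3) using xy(1) y by (simp add: m_assoc)
    then have "x [^] n \<otimes> y [^] m = c [^] (n * m) \<otimes> y [^] m \<otimes> x [^] n"
      using central_commutator_pow[OF xy(1) y c central[OF cZ]] by blast
    then have eq: "(w \<otimes> z) \<otimes> (w' \<otimes> z') = c [^] (n * m) \<otimes> (w' \<otimes> z') \<otimes> (w \<otimes> z)"
      using w w' by simp
    have l: "(w \<otimes> z) \<otimes> (w' \<otimes> z') = (w \<otimes> w') \<otimes> (z \<otimes> z')"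
    proof -
      have "(w \<otimes> z) \<otimes> (w' \<otimes> z') = w \<otimes> (z \<otimes> w') \<otimes> z'" using cl by (simp add: m_assoc)
      also have "\<dots> = w \<otimes> (w' \<otimes> z) \<otimes> z'" using central[OF w(2) cl(3)] by simp
      finally show ?thesis using cl by (simp add: m_assoc)
    qed
    have rr: "c [^] (n * m) \<otimes> (w' \<otimes> z') \<otimes> (w \<otimes> z) = (c [^] (n * m) \<otimes> (w' \<otimes> w)) \<otimes> (z \<otimes> z')"
    proof -
      have "(w' \<otimes> z') \<otimes> (w \<otimes> z) = w' \<otimes> (z' \<otimes> (w \<otimes> z))" using cl by (simp add: m_assoc)
      also have "\<dots> = w' \<otimes> ((w \<otimes> z) \<otimes> z')" using central[OF w'(2), of "w \<otimes> z"] cl by simp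
      finally have "(w' \<otimes> z') \<otimes> (w \<otimes> z) = (w' \<otimes> w) \<otimes> (z \<otimes> z')" using cl by (simp add: m_assoc)
      then show ?thesis using cl c by (simp add: m_assoc)
    qed
    have "w \<otimes> w' = c [^] (n * m) \<otimes> (w' \<otimes> w)"
      using eq l rr cl c right_cancel[of "z \<otimes> z'" "w \<otimes> w'" "c [^] (n * m) \<otimes> (w' \<otimes> w)"] by simp
    then have "c [^] (n * m) = (w \<otimes> w') \<otimes> inv (w' \<otimes> w)"
      using cl c by (simp add: inv_solve_right)
    then have "c [^] (n * m) \<in> W" using w(1) w'(1) by simp
    then show ?thesis using n m by (intro exI[of _ "n * m"]) simp
  qed
  have PZ: "?P z" if "z \<in> Z" for z
    using that unfolding ZX
  proof (induction rule: generate.induct)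
    case one then show ?case by (intro exI[of _ 1]) simp
  next
    case (incl h) then show ?case using com by blast
  next
    case (inv h)
    then obtain e where e: "e > 0" "coprime e r" "h [^] (e::nat) \<in> W" using com by blast
    have "h \<in> carrier G" using CG inv by (rule subsetD)
    then have "(inv h) [^] e \<in> W" using e(3) by (simp add: nat_pow_inv)
    then show ?case using e by blast
  next
    case (eng g h)
    then obtain n m where n: "n > 0" "coprime n r" "g [^] (n::nat) \<in> W"
      and m: "m > 0" "coprime m r" "h [^] (m::nat) \<in> W" by blast
    have gh: "g \<in> Z" "h \<in> Z" using eng ZX by auto
    then have ghc: "g \<in> carrier G" "h \<in> carrier G" using Z by auto
    have "(g \<otimes> h) [^] (n * m) = g [^] (n * m) \<otimes> h [^] (n * m)"
      using pow_mult_distrib[OF central[OF gh(1) ghc(2)] ghc] .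
    also have "\<dots> = (g [^] n) [^] m \<otimes> (h [^] m) [^] n"
      using ghc by (simp add: nat_pow_pow mult.commute)
    also have "\<dots> \<in> W" using n m subgroup_pow_closed[OF W] by simp
    finally show ?case using n m by (intro exI[of _ "n * m"]) simp
  qed
  obtain e where e: "e > 0" "coprime e r" "a [^] (e::nat) \<in> W <#> Z" using pow[OF a] by auto
  obtain w z where w: "w \<in> W" "z \<in> Z" "a [^] e = w \<otimes> z" using e(3) by (auto simp: set_mult_def)
  obtain f where f: "f > 0" "coprime f r" "z [^] (f::nat) \<in> W" using PZ[OF w(2)] by auto
  have cl: "w \<in> carrier G" "z \<in> carrier G" using w Z by auto
  have "a [^] (e * f) = (w \<otimes> z) [^] f" using a w by (simp flip: nat_pow_pow)
  also have "\<dots> = w [^] f \<otimes> z [^] f"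
    using pow_mult_distrib[OF _ cl] central[OF w(2) cl(1)] by simp
  also have "\<dots> \<in> W" using f w subgroup_pow_closed[OF W] by simp
  finally show ?thesis using e f by (intro exI[of _ "e * f"]) simp
qed

end

section \<open>Powers and indices in nilpotent groups\<close>

lemma (in normal) Mod_group_hom: "group_hom G (G Mod H) ((#>) H)"
  by (intro group_hom.intro group_hom_axioms.intro is_group factorgroup_is_group r_coset_hom_Mod)

lemma (in normal) coset_eq_iff:
  assumes "x \<in> carrier G" "y \<in> carrier G"
  shows "H #> x = H #> y \<longleftrightarrow> x \<otimes> inv y \<in> H"
  using repr_independence[OF _ assms(2) is_subgroup] rcos_self[OF assms(1) is_subgroup]
    rcos_module[OF is_group assms(2,1)] by blast

lemma (in normal) coset_mem_image_iff:
  assumes L: "subgroup L G" and HL: "H \<subseteq> L" and x: "x \<in> carrier G"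
  shows "H #> x \<in> (#>) H ` L \<longleftrightarrow> x \<in> L"
proof
  interpret L: subgroup L G by fact
  assume "H #> x \<in> (#>) H ` L"
  then obtain l where l: "l \<in> L" "H #> x = H #> l" by blast
  then have "x \<otimes> inv l \<in> L" using coset_eq_iff[OF x L.mem_carrier[OF l(1)]] HL by blast
  then have "x \<otimes> inv l \<otimes> l \<in> L" using l(1) by simp
  then show "x \<in> L" using x L.mem_carrier[OF l(1)] by (simp add: m_assoc)
qed auto

text \<open>In the factor group by the smaller term of the series the larger term is central and generated by
  commutators, so \<open>power_in_of_central\<close> applies there.\<close>

lemma (in group) power_in_lower_central_step:
  fixes r :: nat
  assumes W: "subgroup W G"
    and pow: "\<And>a. a \<in> carrier G \<Longrightarrow> \<exists>e>0. coprime e r \<and> a [^] (e::nat) \<in> lower_central G (Suc i) <#> W"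
    and a: "a \<in> carrier G"
  shows "\<exists>e>0. coprime e r \<and> a [^] (e::nat) \<in> lower_central G (Suc (Suc i)) <#> W"
proof -
  let ?K = "lower_central G (Suc (Suc i))" and ?Z = "lower_central G (Suc i)" and ?X = "lower_central G i"
  interpret K: normal ?K G by (rule lower_central_normal)
  let ?Q = "G Mod ?K" and ?f = "(#>) ?K"
  interpret h: group_hom G ?Q ?f by (rule K.Mod_group_hom)
  interpret W: subgroup W G by fact
  have cQ: "carrier ?Q = ?f ` carrier G" by (simp add: carrier_FactGroup)
  have ZG: "?Z \<subseteq> carrier G" and XG: "?X \<subseteq> carrier G" using lower_central_carrier by auto
  have hcom: "?f (commutator x y) = h.H.commutator (?f x) (?f y)"
    if "x \<in> carrier G" "y \<in> carrier G" for x y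
    using that by (simp del: mult_FactGroup)
  have main: "\<exists>e>0. coprime e r \<and> ?f a [^]\<^bsub>?Q\<^esub> (e::nat) \<in> ?f ` W"
  proof (rule h.H.power_in_of_central[where Z = "?f ` ?Z" and X = "?f ` ?X"])
    show "subgroup (?f ` W) ?Q" using h.subgroup_img_is_subgroup[OF W] .
    show "?f ` ?Z \<subseteq> carrier ?Q" "?f ` ?X \<subseteq> carrier ?Q" using ZG XG unfolding cQ by blast+
    show "?f a \<in> carrier ?Q" using a unfolding cQ by blast
  next
    fix z g assume "z \<in> ?f ` ?Z" "g \<in> carrier ?Q"
    then obtain z' g' where zg: "z' \<in> ?Z" "z = ?f z'" "g' \<in> carrier G" "g = ?f g'"
      unfolding cQ by blast
    have z': "z' \<in> carrier G" using zg(1) ZG by blast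
    have "z' \<otimes> g' \<otimes> inv (g' \<otimes> z') \<in> ?K"
      using commutator_lower_central'[OF zg(1,3)] zg(3) z' by (simp add: inv_mult_group m_assoc)
    then have "?f (z' \<otimes> g') = ?f (g' \<otimes> z')"
      using K.coset_eq_iff[of "z' \<otimes> g'" "g' \<otimes> z'"] zg(3) z' by simp
    then show "z \<otimes>\<^bsub>?Q\<^esub> g = g \<otimes>\<^bsub>?Q\<^esub> z"
      using h.hom_mult[OF z' zg(3)] h.hom_mult[OF zg(3) z'] zg(2,4) by simp
  next
    have "?f ` ?Z = generate ?Q (?f ` {commutator x y |x y. x \<in> carrier G \<and> y \<in> ?X})"
      unfolding lower_central_Suc[of i]
      by (rule h.generate_img[symmetric]) (use lower_central_carrier in auto)
    also have "?f ` {commutator x y |x y. x \<in> carrier G \<and> y \<in> ?X} =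
        {h.H.commutator x y |x y. x \<in> carrier ?Q \<and> y \<in> ?f ` ?X}" (is "?A = ?B")
    proof
      show "?A \<subseteq> ?B"
      proof
        fix u assume "u \<in> ?A"
        then obtain x y where xy: "x \<in> carrier G" "y \<in> ?X" "u = ?f (commutator x y)" by fast
        then have "u = h.H.commutator (?f x) (?f y)" using hcom[OF xy(1)] XG by fast
        then show "u \<in> ?B" using xy(1,2) cQ by fast
      qed
      show "?B \<subseteq> ?A"
      proof
        fix u assume "u \<in> ?B"
        then obtain x y where xy: "x \<in> carrier G" "y \<in> ?X" "u = h.H.commutator (?f x) (?f y)"
          unfolding cQ by fast
        then have "u = ?f (commutator x y)" using hcom[OF xy(1), of y] XG by fast
        then show "u \<in> ?A" using xy(1,2) by fast
      qed
    qed
    finally show "?f ` ?Z = generate ?Q {h.H.commutator x y |x y. x \<in> carrier ?Q \<and> y \<in> ?f ` ?X}" .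
  next
    fix b assume "b \<in> carrier ?Q"
    then obtain b' where b: "b' \<in> carrier G" "b = ?f b'" unfolding cQ by blast
    obtain e where e: "e > 0" "coprime e r" "b' [^] (e::nat) \<in> ?Z <#> W" using pow[OF b(1)] by blast
    obtain z w where zw: "z \<in> ?Z" "w \<in> W" "b' [^] e = z \<otimes> w" using e(3) by (auto simp: set_mult_def)
    have z: "z \<in> carrier G" using zw(1) ZG by blast
    have "commutator w z \<in> ?K" using commutator_lower_central[OF W.mem_carrier[OF zw(2)] zw(1)] .
    then have "w \<otimes> z \<otimes> inv (z \<otimes> w) \<in> ?K" using zw(2) z by (simp add: inv_mult_group m_assoc)
    then have "?f (w \<otimes> z) = ?f (z \<otimes> w)"
      using K.coset_eq_iff[of "w \<otimes> z" "z \<otimes> w"] zw(2) z by simp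
    then have "b [^]\<^bsub>?Q\<^esub> e = ?f w \<otimes>\<^bsub>?Q\<^esub> ?f z"
      using b(2) zw(3) h.hom_mult[OF W.mem_carrier[OF zw(2)] z] h.hom_nat_pow[OF b(1), of e] by simp
    then have "b [^]\<^bsub>?Q\<^esub> e \<in> ?f ` W <#>\<^bsub>?Q\<^esub> ?f ` ?Z"
      using zw(1,2) unfolding set_mult_def by blast
    then show "\<exists>e>0. coprime e r \<and> b [^]\<^bsub>?Q\<^esub> (e::nat) \<in> ?f ` W <#>\<^bsub>?Q\<^esub> ?f ` ?Z"
      using e(1,2) by blast
  qed
  then obtain e where e: "e > 0" "coprime e r" "?f a [^]\<^bsub>?Q\<^esub> (e::nat) \<in> ?f ` W" by blast
  have KW: "subgroup (?K <#> W) G" "?K \<subseteq> ?K <#> W" "W \<subseteq> ?K <#> W"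
    using normal_mult_subgroup[OF lower_central_normal W] subset_normal_mult[OF lower_central_normal W] by blast+
  have "?f (a [^] e) \<in> ?f ` W" using e(3) h.hom_nat_pow[OF a, of e] by simp
  then have "?f (a [^] e) \<in> ?f ` (?K <#> W)" using KW(3) by blast
  then have "a [^] e \<in> ?K <#> W"
    using K.coset_mem_image_iff[OF KW(1,2), of "a [^] e"] a by simp
  then show ?thesis using e(1,2) by blast
qed

text \<open>Whether all elements of a nilpotent group have a power with admissible exponent in \<open>W\<close> is decided
  in the abelianization: the step above replaces the commutator subgroup by ever smaller terms of the
  lower central series.\<close>

lemma (in group) power_in_of_abelianization:
  fixes r :: nat
  assumes nil: "nilpotent_group G" and W: "subgroup W G"
    and pow: "\<And>a. a \<in> carrier G \<Longrightarrow> \<exists>e>0. coprime e r \<and> a [^] (e::nat) \<in> lower_central G 1 <#> W"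
    and a: "a \<in> carrier G"
  shows "\<exists>e>0. coprime e r \<and> a [^] (e::nat) \<in> W"
proof -
  have step: "\<exists>e>0. coprime e r \<and> b [^] (e::nat) \<in> lower_central G (Suc i) <#> W"
    if "b \<in> carrier G" for i b
    using that
  proof (induction i arbitrary: b)
    case 0 then show ?case using pow by simp
  next
    case (Suc i)
    show ?case by (rule power_in_lower_central_step[OF W Suc])
  qed
  obtain c where c: "lower_central G c = {\<one>}" using nil by (auto simp: nilpotent_group_def)
  have "lower_central G (Suc c) = {\<one>}"
    using c lower_central_Suc_subset[of c] subgroup.one_closed[OF lower_central_subgroup, of "Suc c"] by auto
  moreover have "{\<one>} <#> W = W" using subgroup.subset[OF W] by (force simp: set_mult_def)
  ultimately show ?thesis using step[OF a, of c] by simp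
qed

text \<open>Each element of \<open>F\<close> normalizes every subgroup that contains its commutators, so the elements of \<open>F\<close> can be
  adjoined to \<open>L\<close> one at a time.\<close>

lemma (in group) coprime_index_adjoin:
  fixes r :: nat
  assumes L: "subgroup L G" and F: "finite F" "F \<subseteq> carrier G"
    and com: "\<And>f x. f \<in> F \<Longrightarrow> x \<in> carrier G \<Longrightarrow> commutator f x \<in> L"
    and pow: "\<And>f. f \<in> F \<Longrightarrow> \<exists>e>0. coprime e r \<and> f [^] (e::nat) \<in> L"
    and ind: "coprime_index r (generate G (F \<union> L))"
  shows "coprime_index r L"
  using F(1) L F(2) com pow ind
proof (induction F arbitrary: L rule: finite_induct)
  case empty
  then show ?case
    using generateI[of L L] by simp
next
  case (insert f F)
  interpret L: subgroup L G by fact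
  have f: "f \<in> carrier G" using insert by blast
  let ?M = "generate G (insert f L)"
  have fL: "insert f L \<subseteq> carrier G" using f L.subset by blast
  have sM: "subgroup ?M G" using generate_is_subgroup[OF fL] .
  have LM: "L \<subseteq> ?M" by (auto intro: generate.incl)
  have "coprime_index r ?M"
  proof (rule insert.IH[OF sM])
    show "F \<subseteq> carrier G" using insert.prems(2) by blast
    show "commutator g x \<in> ?M" if "g \<in> F" "x \<in> carrier G" for g x
      using insert.prems(3)[of g x] that LM by blast
    show "\<exists>e>0. coprime e r \<and> g [^] (e::nat) \<in> ?M" if "g \<in> F" for g
      using insert.prems(4)[of g] that LM by blast
    have "generate G (F \<union> ?M) = generate G (insert f F \<union> L)"
    proof
      have sub: "insert f F \<union> L \<subseteq> carrier G" using insert.prems(2) L.subset by blast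
      have "?M \<subseteq> generate G (insert f F \<union> L)" by (rule mono_generate) blast
      then show "generate G (F \<union> ?M) \<subseteq> generate G (insert f F \<union> L)"
        by (intro generate_subgroup_incl[OF _ generate_is_subgroup[OF sub]]) (auto intro: generate.incl)
      have "insert f F \<union> L \<subseteq> F \<union> ?M" by (auto intro: generate.incl)
      then show "generate G (insert f F \<union> L) \<subseteq> generate G (F \<union> ?M)" by (rule mono_generate)
    qed
    then show "coprime_index r (generate G (F \<union> ?M))" using insert.prems(5) by simp
  qed
  note M = this
  obtain e where e: "e > 0" "coprime e r" "f [^] (e::nat) \<in> L"
    using insert.prems(4)[of f] by blast
  show ?case
  proof (rule coprime_index_insert[OF insert.prems(1) f _ _ e(3,1,2) M])
    fix x assume xL: "x \<in> L"
    then have x: "x \<in> carrier G" by simp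
    have "commutator f x \<otimes> x \<in> L" using insert.prems(3)[of f x] xL x by simp
    then show "f \<otimes> x \<otimes> inv f \<in> L" using f x by (simp add: m_assoc)
    have y: "inv f \<otimes> x \<otimes> f \<in> carrier G" using f x by simp
    have "commutator f (inv f \<otimes> x \<otimes> f) \<in> L" using insert.prems(3)[OF _ y, of f] by simp
    moreover have "f \<otimes> (inv f \<otimes> x \<otimes> f) \<otimes> inv f = x"
      using f x by (simp add: m_assoc) (simp flip: m_assoc)
    ultimately have c: "x \<otimes> inv (inv f \<otimes> x \<otimes> f) \<in> L" by simp
    have "inv (x \<otimes> inv (inv f \<otimes> x \<otimes> f)) \<otimes> x \<in> L" using L.m_closed[OF L.m_inv_closed[OF c] xL] .
    moreover have "inv (x \<otimes> inv (inv f \<otimes> x \<otimes> f)) \<otimes> x = inv f \<otimes> x \<otimes> f"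
      using x y by (simp add: inv_mult_group m_assoc)
    ultimately show "inv f \<otimes> x \<otimes> f \<in> L" by simp
  qed
qed

text \<open>Climb from \<open>W\<close> to \<open>G\<close> through the subgroups \<open>\<gamma>\<^sub>iW\<close>, where \<open>\<gamma>\<^sub>i\<close> is the \<open>i\<close>-th term of the lower central
  series: one passes from \<open>\<gamma>\<^sub>i\<^sub>+\<^sub>1W\<close> to \<open>\<gamma>\<^sub>iW\<close> by adjoining finitely many elements of \<open>\<gamma>\<^sub>i\<close>, and their
  commutators lie in \<open>\<gamma>\<^sub>i\<^sub>+\<^sub>1\<close>.\<close>

lemma (in group) coprime_index_of_pow:
  fixes r :: nat
  assumes nil: "nilpotent_group G" and fg: "finitely_generated G" and W: "subgroup W G"
    and pow: "\<And>a. a \<in> carrier G \<Longrightarrow> \<exists>e>0. coprime e r \<and> a [^] (e::nat) \<in> W"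
  shows "coprime_index r W"
proof -
  have step: "coprime_index r (lower_central G i <#> W)" for i
  proof (induction i)
    case 0
    have "carrier G <#> W = carrier G"
      using subset_normal_mult(1)[OF normal_self W] set_mult_closed[OF subset_refl subgroup.subset[OF W]]
      by blast
    then show ?case using coprime_index_carrier by simp
  next
    case (Suc i)
    let ?K = "lower_central G (Suc i)"
    obtain F where F: "finite F" "F \<subseteq> lower_central G i" "generate G (F \<union> ?K) = lower_central G i"
      using lower_central_finitely_generated_mod[OF fg] by blast
    have FG: "F \<subseteq> carrier G" using F(2) lower_central_carrier by blast
    have KW: "subgroup (?K <#> W) G" "?K \<subseteq> ?K <#> W" "W \<subseteq> ?K <#> W"
      using normal_mult_subgroup[OF lower_central_normal W] subset_normal_mult[OF lower_central_normal W] by blast+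
    have sub: "F \<union> (?K <#> W) \<subseteq> carrier G" using FG subgroup.subset[OF KW(1)] by blast
    show ?case
    proof (rule coprime_index_adjoin[OF KW(1) F(1) FG])
      show "commutator f x \<in> ?K <#> W" if "f \<in> F" "x \<in> carrier G" for f x
        using commutator_lower_central'[of f i x] that F(2) KW(2) by blast
      show "\<exists>e>0. coprime e r \<and> f [^] (e::nat) \<in> ?K <#> W" if "f \<in> F" for f
        using pow[of f] that FG KW(3) by blast
      have "generate G (F \<union> (?K <#> W)) = lower_central G i <#> W"
      proof
        have iW: "subgroup (lower_central G i <#> W) G" "lower_central G i \<subseteq> lower_central G i <#> W"
          using normal_mult_subgroup[OF lower_central_normal W] subset_normal_mult[OF lower_central_normal W] by blast+
        show "generate G (F \<union> (?K <#> W)) \<subseteq> lower_central G i <#> W"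
          using F(2) iW(2) mono_set_mult[OF lower_central_Suc_subset[of i] subset_refl]
          by (intro generate_subgroup_incl[OF _ iW(1)]) blast
        have "lower_central G i \<subseteq> generate G (F \<union> (?K <#> W))"
          unfolding F(3)[symmetric] using KW(2) by (intro mono_generate) blast
        moreover have "W \<subseteq> generate G (F \<union> (?K <#> W))"
          using KW(3) by (auto intro: generate.incl)
        ultimately show "lower_central G i <#> W \<subseteq> generate G (F \<union> (?K <#> W))"
          by (auto simp: set_mult_def intro: generate.eng)
      qed
      then show "coprime_index r (generate G (F \<union> (?K <#> W)))" using Suc by simp
    qed
  qed
  obtain c where c: "lower_central G c = {\<one>}" using nil by (auto simp: nilpotent_group_def)
  moreover have "{\<one>} <#> W = W" using subgroup.subset[OF W] by (force simp: set_mult_def)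
  ultimately show ?thesis using step[of c] by simp
qed

text \<open>Write \<open>t = c\<^sup>q\<close> and \<open>c\<^sup>e = zt\<^sup>s\<close> with \<open>z\<close> in the subgroup generated by \<open>T\<close>. Then \<open>t\<^sup>e = z\<^sup>qt\<^sup>s\<^sup>q\<close>, so the power of \<open>t\<close> with
  exponent \<open>e - sq\<close> lies in that subgroup, and this exponent is prime to \<open>q\<close>. Hence \<open>t\<close> can be dropped at
  the cost of a larger exponent.\<close>

lemma (in comm_group) divisible_exponent_step:
  fixes q :: nat
  assumes q: "q > 1" and div: "\<And>b. b \<in> carrier G \<Longrightarrow> \<exists>c\<in>carrier G. b = c [^] q"
    and t: "t \<in> carrier G" and T: "T \<subseteq> carrier G"
    and e: "e > 0" "coprime e q" "\<And>b. b \<in> carrier G \<Longrightarrow> b [^] (e::nat) \<in> generate G (insert t T)"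
  shows "\<exists>e'>0. coprime e' q \<and> (\<forall>b\<in>carrier G. b [^] (e'::nat) \<in> generate G T)"
proof -
  let ?T = "generate G T"
  have sT: "subgroup ?T G" using generate_is_subgroup[OF T] .
  have st: "subgroup (generate G {t}) G" using t by (intro generate_is_subgroup) simp
  have Tc: "y \<in> carrier G" if "y \<in> ?T" for y using subgroup.mem_carrier[OF sT that] .
  have dec: "\<exists>z\<in>?T. \<exists>s::int. y = z \<otimes> t [^] s" if "y \<in> generate G (insert t T)" for y
  proof -
    have sub: "subgroup (?T <#> generate G {t}) G" using mult_subgroups[OF sT st] .
    have "T \<subseteq> ?T <#> generate G {t}"
      using set_mult_memI[OF generate.incl generate.one[of G "{t}"]] T by fastforce
    moreover have "t \<in> ?T <#> generate G {t}"
      using set_mult_memI[OF generate.one[of G T] generate.incl[of t "{t}"]] t by simp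
    ultimately have "generate G (insert t T) \<subseteq> ?T <#> generate G {t}"
      by (intro generate_subgroup_incl[OF _ sub]) simp
    then have "y \<in> ?T <#> generate G {t}" using that by blast
    then show ?thesis unfolding set_mult_def generate_pow[OF t] by blast
  qed
  obtain c where c: "c \<in> carrier G" "t = c [^] q" using div[OF t] by blast
  obtain z s where zs: "z \<in> ?T" "c [^] e = z \<otimes> t [^] (s::int)"
    using dec[OF e(3)[OF c(1)]] by blast
  let ?d = "int e - s * int q"
  have "t [^] e = (c [^] e) [^] q" using c by (simp add: nat_pow_pow mult.commute)
  also have "\<dots> = z [^] q \<otimes> (t [^] s) [^] q"
    using zs Tc t by (simp add: nat_pow_distrib)
  also have "(t [^] s) [^] q = t [^] (s * int q)"
    using int_pow_pow[OF t, of s "int q"] int_pow_int[of G "t [^] s" q] by simp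
  finally have "t [^] int e = z [^] q \<otimes> t [^] (s * int q)" by (simp add: int_pow_int)
  then have "t [^] ?d = z [^] q"
    using t Tc[OF zs(1)] by (simp add: int_pow_diff m_assoc)
  then have td: "t [^] ?d \<in> ?T" using subgroup_pow_closed[OF sT zs(1)] by simp
  define f where "f = nat \<bar>?d\<bar>"
  have tf: "t [^] f \<in> ?T"
  proof (cases "?d \<ge> 0")
    case True then show ?thesis using td t by (simp add: f_def flip: int_pow_int)
  next
    case False
    then have "t [^] f = inv (t [^] ?d)" using t by (simp add: f_def int_pow_neg[symmetric] flip: int_pow_int)
    then show ?thesis using subgroup.m_inv_closed[OF sT td] by simp
  qed
  have cop: "coprime ?d (int q)"
  proof -
    have "coprime (int e) (int q)" using e(2) by simp
    then have "gcd (int e) (int q) = 1" by simp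
    then have "gcd ?d (int q) = 1"
      by (metis gcd.commute gcd_diff1 gcd_add_mult mult.commute diff_add_cancel add.commute)
    then show ?thesis by (simp add: coprime_iff_gcd_eq_1)
  qed
  have "?d \<noteq> 0" using cop q by auto
  then have f0: "f > 0" by (simp add: f_def)
  have fq: "coprime f q" using cop unfolding f_def by (metis coprime_abs_left_iff coprime_int_iff abs_ge_zero nat_0_le)
  have "b [^] (e * f) \<in> ?T" if b: "b \<in> carrier G" for b
  proof -
    obtain y s where ys: "y \<in> ?T" "b [^] e = y \<otimes> t [^] (s::int)" using dec[OF e(3)[OF b]] by blast
    have "b [^] (e * f) = (y \<otimes> t [^] s) [^] f" using b ys by (simp flip: nat_pow_pow)
    also have "\<dots> = y [^] f \<otimes> (t [^] s) [^] f" using Tc[OF ys(1)] t by (simp add: nat_pow_distrib)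
    also have "(t [^] s) [^] f = (t [^] f) [^] s"
      using int_pow_pow[OF t, of s "int f"] int_pow_pow[OF t, of "int f" s]
        int_pow_int[of G "t [^] s" f] int_pow_int[of G t f] by (simp add: mult.commute)
    finally show ?thesis
      using subgroup_pow_closed[OF sT ys(1), of f] subgroup_int_pow_closed[OF sT tf, of s]
        subgroup.m_closed[OF sT] by simp
  qed
  then show ?thesis using f0 fq e(1,2) by (intro exI[of _ "e * f"]) simp
qed

text \<open>A finitely generated abelian group on which \<open>q\<close>-th powers are surjective is finite of order prime to \<open>q\<close>.
  Only the exponent is needed, and dropping the generators one at a time produces it.\<close>

lemma (in comm_group) divisible_exponent:
  fixes q :: nat
  assumes q: "q > 1" and div: "\<And>b. b \<in> carrier G \<Longrightarrow> \<exists>c\<in>carrier G. b = c [^] q"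
    and fg: "finitely_generated G"
  shows "\<exists>e>0. coprime e q \<and> (\<forall>b\<in>carrier G. b [^] (e::nat) = \<one>)"
proof -
  have "\<exists>e>0. coprime e q \<and> (\<forall>b\<in>carrier G. b [^] (e::nat) \<in> generate G {})"
    if "finite T" "T \<subseteq> carrier G"
      "\<exists>e>0. coprime e q \<and> (\<forall>b\<in>carrier G. b [^] (e::nat) \<in> generate G T)" for T
    using that
  proof (induction T rule: finite_induct)
    case (insert t T)
    obtain e where e: "e > 0" "coprime e q" "\<And>b. b \<in> carrier G \<Longrightarrow> b [^] (e::nat) \<in> generate G (insert t T)"
      using insert.prems(2) by blast
    show ?case
      using insert.IH divisible_exponent_step[OF q div _ _ e] insert.prems(1) by simp
  qed simp
  moreover obtain S where S: "finite S" "S \<subseteq> carrier G" "generate G S = carrier G"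
    using fg by (auto simp: finitely_generated_def)
  moreover have "\<exists>e>0. coprime e q \<and> (\<forall>b\<in>carrier G. b [^] (e::nat) \<in> generate G S)"
    using S by (intro exI[of _ 1]) simp
  ultimately show ?thesis by (simp add: generate_empty)
qed

lemma (in normal) finitely_generated_Mod:
  assumes "finitely_generated G"
  shows "finitely_generated (G Mod H)"
proof -
  interpret h: group_hom G "G Mod H" "(#>) H" by (rule Mod_group_hom)
  obtain S where S: "finite S" "S \<subseteq> carrier G" "generate G S = carrier G"
    using assms by (auto simp: finitely_generated_def)
  have "generate (G Mod H) ((#>) H ` S) = carrier (G Mod H)"
    using h.generate_img[OF S(2)] S(3) by (simp add: carrier_FactGroup)
  moreover have "(#>) H ` S \<subseteq> carrier (G Mod H)" using S(2) by (auto simp: carrier_FactGroup)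
  ultimately show ?thesis using S(1) unfolding finitely_generated_def by blast
qed

context group
begin

lemma power_subgroup_carrier_normal: "power_subgroup G (carrier G) m \<lhd> G"
  using power_subgroup_normal[OF normal_self] .

lemma pow_mem_power_subgroup: "a \<in> U \<Longrightarrow> a [^] m \<in> power_subgroup G U m"
  unfolding power_subgroup_def by (rule generate.incl) simp

text \<open>Every element has its \<open>m\<close>-th power in the subgroup; coprimality to \<open>1\<close> is no condition.\<close>

lemma finite_index_power_subgroup:
  assumes "nilpotent_group G" "finitely_generated G" "m > 0"
  shows "finite (rcosets (power_subgroup G (carrier G) m))"
proof -
  have "coprime_index 1 (power_subgroup G (carrier G) m)"
    using coprime_index_of_pow[OF assms(1,2) normal_imp_subgroup[OF power_subgroup_carrier_normal], of 1 m]
      pow_mem_power_subgroup assms(3) by auto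
  then show ?thesis by (simp add: coprime_index_def)
qed

text \<open>Let \<open>V\<close> be the product of \<open>W\<close> with the subgroup generated by \<open>m\<close>-th powers. All \<open>m\<close>-th powers lie in \<open>V\<close>, so
  its index is prime to whatever is prime to \<open>m\<close>, in particular to the index of \<open>W\<close>, which it divides.\<close>

lemma power_supplement_of_coprime_index:
  assumes nil: "nilpotent_group G" and fg: "finitely_generated G" and W: "subgroup W G"
    and fin: "finite (rcosets W)" and cop: "coprime m (card (rcosets W))" and m: "m > 0"
  shows "power_subgroup G (carrier G) m <#> W = carrier G"
proof -
  let ?V = "power_subgroup G (carrier G) m <#> W"
  have V: "subgroup ?V G" "power_subgroup G (carrier G) m \<subseteq> ?V" "W \<subseteq> ?V"
    using normal_mult_subgroup[OF power_subgroup_carrier_normal W]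
      subset_normal_mult[OF power_subgroup_carrier_normal W] by blast+
  have "coprime_index (card (rcosets W)) ?V"
  proof (rule coprime_index_of_pow[OF nil fg V(1)])
    fix a assume "a \<in> carrier G"
    then show "\<exists>e>0. coprime e (card (rcosets W)) \<and> a [^] (e::nat) \<in> ?V"
      using pow_mem_power_subgroup[of a "carrier G" m] V(2) m cop by blast
  qed
  moreover have "card (rcosets ?V) dvd card (rcosets W)"
    using card_index_tower[OF W V(1,3)] by simp
  ultimately have "card (rcosets ?V) = 1"
    unfolding coprime_index_def using coprime_absorb_left by fastforce
  then obtain C where C: "rcosets ?V = {C}" by (auto simp: card_1_singleton_iff)
  have "?V \<in> rcosets ?V" using subgroup.subgroup_in_rcosets[OF V(1) group_axioms] .
  then have "rcosets ?V = {?V}" using C by simp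
  then have "\<Union> (rcosets ?V) = ?V" by simp
  then show ?thesis using rcosets_part_G[OF V(1)] by simp
qed

text \<open>Let \<open>\<gamma>\<^sub>1\<close> be the commutator subgroup. In the abelian group \<open>G/\<gamma>\<^sub>1W\<close> every element is a \<open>q\<close>-th power, so an exponent prime to \<open>q\<close> kills it. By
  \<open>power_in_of_abelianization\<close> every element of \<open>G\<close> then has a power in \<open>W\<close> with exponent prime to \<open>q\<close>.\<close>

lemma coprime_index_of_power_supplement:
  assumes nil: "nilpotent_group G" and fg: "finitely_generated G" and W: "subgroup W G"
    and q: "q > 1" and WK: "power_subgroup G (carrier G) q <#> W = carrier G"
  shows "coprime_index q W"
proof (rule coprime_index_of_pow[OF nil fg W])
  fix a assume a: "a \<in> carrier G"
  show "\<exists>e>0. coprime e q \<and> a [^] (e::nat) \<in> W"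
  proof (rule power_in_of_abelianization[OF nil W _ a])
    fix b assume b: "b \<in> carrier G"
    let ?D = "lower_central G 1" and ?J = "lower_central G 1 <#> W"
    have J: "subgroup ?J G" "?D \<subseteq> ?J" "W \<subseteq> ?J"
      using normal_mult_subgroup[OF lower_central_normal W]
        subset_normal_mult[OF lower_central_normal W] by blast+
    have com: "commutator x y \<in> ?J" if "x \<in> carrier G" "y \<in> carrier G" for x y
      using commutator_lower_central[of x y 0] that J(2) by auto
    have "?J \<lhd> G"
    proof (rule normal_invI[OF J(1)])
      fix x h assume x: "x \<in> carrier G" and h: "h \<in> ?J"
      have hc: "h \<in> carrier G" using subgroup.mem_carrier[OF J(1) h] .
      have "commutator x h \<otimes> h \<in> ?J" using subgroup.m_closed[OF J(1) com[OF x hc] h] .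
      then show "x \<otimes> h \<otimes> inv x \<in> ?J" using x hc by (simp add: m_assoc)
    qed
    then interpret J: normal ?J G .
    let ?Q = "G Mod ?J" and ?f = "(#>) ?J"
    interpret h: group_hom G ?Q ?f by (rule J.Mod_group_hom)
    have cQ: "carrier ?Q = ?f ` carrier G" by (simp add: carrier_FactGroup)
    interpret Q: comm_group ?Q
    proof (rule h.H.group_comm_groupI)
      fix u v assume "u \<in> carrier ?Q" "v \<in> carrier ?Q"
      then obtain x y where xy: "x \<in> carrier G" "y \<in> carrier G" "u = ?f x" "v = ?f y"
        unfolding cQ by blast
      have "(x \<otimes> y) \<otimes> inv (y \<otimes> x) \<in> ?J" using com[OF xy(1,2)] xy(1,2) by (simp add: inv_mult_group m_assoc)
      then have "?f (x \<otimes> y) = ?f (y \<otimes> x)" using J.coset_eq_iff[of "x \<otimes> y" "y \<otimes> x"] xy(1,2) by simp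
      then show "u \<otimes>\<^bsub>?Q\<^esub> v = v \<otimes>\<^bsub>?Q\<^esub> u"
        using h.hom_mult[OF xy(1,2)] h.hom_mult[OF xy(2,1)] xy(3,4) by simp
    qed
    let ?K = "power_subgroup G (carrier G) q"
    have KG: "?K \<subseteq> carrier G" using normal_imp_subgroup[OF power_subgroup_carrier_normal] subgroup.subset by blast
    have pw: "\<exists>c\<in>carrier ?Q. ?f k = c [^]\<^bsub>?Q\<^esub> q" if "k \<in> ?K" for k
      using that[unfolded power_subgroup_def]
    proof (induction rule: generate.induct)
      case one
      show ?case
        by (intro bexI[OF _ h.H.one_closed]) (simp only: h.hom_one h.H.nat_pow_one)
    next
      case (incl h)
      then obtain x where x: "x \<in> carrier G" "h = x [^] q" by blast
      then show ?case using h.hom_nat_pow[OF x(1), of q] h.hom_closed[OF x(1)] by blast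
    next
      case (inv h)
      then obtain x where x: "x \<in> carrier G" "h = x [^] q" by blast
      then have "inv h = (inv x) [^] q" by (simp add: nat_pow_inv)
      then show ?case
        using h.hom_nat_pow[of "inv x" q] h.hom_closed[of "inv x"] x(1) by (metis inv_closed)
    next
      case (eng k l)
      then obtain c d where cd: "c \<in> carrier ?Q" "?f k = c [^]\<^bsub>?Q\<^esub> q"
        "d \<in> carrier ?Q" "?f l = d [^]\<^bsub>?Q\<^esub> q" by blast
      have kl: "k \<in> carrier G" "l \<in> carrier G"
        using eng(1,2) KG unfolding power_subgroup_def by blast+
      have "?f (k \<otimes> l) = (c \<otimes>\<^bsub>?Q\<^esub> d) [^]\<^bsub>?Q\<^esub> q"
        using h.hom_mult[OF kl] cd Q.nat_pow_distrib[OF cd(1,3), of q] by simp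
      then show ?case using h.H.m_closed[OF cd(1,3)] by blast
    qed
    have div: "\<exists>c\<in>carrier ?Q. u = c [^]\<^bsub>?Q\<^esub> q" if "u \<in> carrier ?Q" for u
    proof -
      have "u \<in> ?f ` carrier G" using that unfolding cQ .
      then obtain x where x: "u = ?f x" "x \<in> carrier G" by (rule imageE)
      have "x \<in> ?K <#> W" using x(2) unfolding WK .
      then obtain k w where kw: "k \<in> ?K" "w \<in> W" "x = k \<otimes> w"
        unfolding set_mult_def by (elim UN_E) (simp only: singleton_iff)
      have kG: "k \<in> carrier G" using kw(1) KG by blast
      have "x \<otimes> inv k \<in> ?J"
      proof -
        have "k \<otimes> w \<otimes> inv k \<in> ?J" using J.inv_op_closed2[OF kG] kw(2) J(3) by blast
        then show ?thesis using kw(3) by simp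
      qed
      then have "u = ?f k" using J.coset_eq_iff[OF x(2) kG] x(1) by simp
      then show ?thesis using pw[OF kw(1)] by simp
    qed
    obtain e where e: "e > 0" "coprime e q" "\<forall>u\<in>carrier ?Q. u [^]\<^bsub>?Q\<^esub> (e::nat) = \<one>\<^bsub>?Q\<^esub>"
      using Q.divisible_exponent[OF q div J.finitely_generated_Mod[OF fg]] by blast
    have "?f b \<in> carrier ?Q" using b unfolding cQ by blast
    then have "?f b [^]\<^bsub>?Q\<^esub> e = \<one>\<^bsub>?Q\<^esub>" using e(3) by blast
    then have "?f (b [^] e) = ?J" using h.hom_nat_pow[OF b, of e] by simp
    then have "b [^] e \<in> ?J" using rcos_self[OF nat_pow_closed[OF b] J(1), of e] by simp
    then show "\<exists>e>0. coprime e q \<and> b [^] (e::nat) \<in> ?J" using e(1,2) by blast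
  qed
qed

end

lemma comm_group_imp_nilpotent:
  fixes G (structure)
  assumes "comm_group G"
  shows "nilpotent_group G"
proof -
  interpret comm_group G by fact
  have "{commutator x y | x y. x \<in> carrier G \<and> y \<in> carrier G} \<subseteq> {\<one>}"
  proof
    fix c assume "c \<in> {commutator x y | x y. x \<in> carrier G \<and> y \<in> carrier G}"
    then obtain x y where xy: "x \<in> carrier G" "y \<in> carrier G" "c = commutator x y" by blast
    then have "c = \<one>" using m_comm[of x y] by (simp add: m_assoc flip: inv_mult_group)
    then show "c \<in> {\<one>}" by simp
  qed
  then have "lower_central G 1 = {\<one>}"
    using generate_subgroup_incl[OF _ one_is_normal[THEN normal_imp_subgroup]] generate.one
    unfolding One_nat_def lower_central_Suc lower_central.simps(1) by blast
  then show ?thesis using is_group unfolding nilpotent_group_def by blast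
qed

section \<open>Gaschuetz's lemma\<close>

lemma card_list_all2:
  assumes "\<And>h. h \<in> set hs \<Longrightarrow> finite {x. P x h} \<and> card {x. P x h} = n"
  shows "finite {t. list_all2 P t hs} \<and> card {t. list_all2 P t hs} = n ^ length hs"
  using assms
proof (induction hs)
  case Nil
  have "{t. list_all2 P t []} = {[]}" by auto
  then show ?case by simp
next
  case (Cons h hs)
  let ?f = "\<lambda>(x, t). x # t"
  have eq: "{t. list_all2 P t (h # hs)} = ?f ` ({x. P x h} \<times> {t. list_all2 P t hs})"
    by (auto simp: list_all2_Cons2 image_iff)
  have inj: "inj_on ?f ({x. P x h} \<times> {t. list_all2 P t hs})" by (auto simp: inj_on_def)
  have "finite {t. list_all2 P t hs} \<and> card {t. list_all2 P t hs} = n ^ length hs"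
    using Cons by simp
  moreover have "finite {x. P x h} \<and> card {x. P x h} = n" using Cons.prems by simp
  ultimately show ?case
    unfolding eq using card_image[OF inj] by (simp add: card_cartesian_product)
qed

lemma list_all2_ex_preimage:
  assumes "list_all2 (\<lambda>c y. \<exists>g. R g y \<and> c = f g) cs ys"
  shows "\<exists>t. list_all2 R t ys \<and> map f t = cs"
  using assms
proof (induction rule: list_all2_induct)
  case (Cons c cs y ys)
  then obtain g t where "R g y" "c = f g" "list_all2 R t ys" "map f t = cs" by blast
  then show ?case by (intro exI[of _ "g # t"]) simp
qed simp

context group
begin

text \<open>The lifts are sorted by the subgroup that they generate together with \<open>A\<close>; it has to be exactly \<open>C\<close>,
  so that different \<open>C\<close> give disjoint sets.\<close>

definition lifts_generating :: "'a set \<Rightarrow> 'a set \<Rightarrow> 'a list \<Rightarrow> 'a set \<Rightarrow> 'a list set" where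
  "lifts_generating N A hs C = {t. list_all2 (\<lambda>x h. x \<in> N #> h) t hs \<and> generate G (A \<union> set t) = C}"

lemma card_Int_rcoset:
  assumes N: "N \<lhd> G" and C: "subgroup C G" and NC: "N <#> C = carrier G" and h: "h \<in> carrier G"
  shows "card ((N #> h) \<inter> C) = card (N \<inter> C)"
proof -
  interpret N: normal N G by fact
  interpret C: subgroup C G by fact
  have "h \<in> N <#> C" using h NC by simp
  then obtain n c where nc: "n \<in> N" "c \<in> C" "h = n \<otimes> c" unfolding set_mult_def by blast
  have c: "c \<in> carrier G" and n: "n \<in> carrier G" using nc by auto
  have "N #> h = N #> c"
    using N.coset_eq_iff[OF h c] nc(1) nc(3) c n by (simp add: m_assoc)
  moreover have "(N #> c) \<inter> C = (N \<inter> C) #> c"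
  proof
    show "(N \<inter> C) #> c \<subseteq> (N #> c) \<inter> C" using nc(2) unfolding r_coset_def by auto
    show "(N #> c) \<inter> C \<subseteq> (N \<inter> C) #> c"
    proof
      fix x assume "x \<in> (N #> c) \<inter> C"
      then obtain k where k: "k \<in> N" "x = k \<otimes> c" "x \<in> C" unfolding r_coset_def by blast
      have kG: "k \<in> carrier G" using N.mem_carrier[OF k(1)] .
      have "x \<otimes> inv c \<in> C" using C.m_closed[OF k(3) C.m_inv_closed[OF nc(2)]] .
      then have "k \<in> C" using k(2) kG c by (simp add: m_assoc)
      then show "x \<in> (N \<inter> C) #> c" using k unfolding r_coset_def by blast
    qed
  qed
  moreover have "card ((N \<inter> C) #> c) = card (N \<inter> C)"
  proof -
    have "(N \<inter> C) #> c = (\<lambda>x. x \<otimes> c) ` (N \<inter> C)" unfolding r_coset_def by blast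
    moreover have "inj_on (\<lambda>x. x \<otimes> c) (N \<inter> C)"
      using c by (intro inj_onI) auto
    ultimately show ?thesis using card_image by metis
  qed
  ultimately show ?thesis by simp
qed

text \<open>The number of lifts that generate \<open>C\<close> is the same for all lists that generate \<open>G\<close> modulo \<open>N\<close> together
  with \<open>A\<close>. If \<open>A\<close> is not contained in \<open>C\<close> or \<open>NC\<close> is not \<open>G\<close>, there are no such lifts. Otherwise each entry
  has \<open>|N \<inter> C|\<close> lifts in \<open>C\<close>, and from the number of all lists of lifts in \<open>C\<close> one subtracts those that generate a proper
  subgroup of \<open>C\<close>, whose number is known by induction on the order of \<open>C\<close>.\<close>

lemma card_lifts_generating:
  assumes fin: "finite (carrier G)" and N: "N \<lhd> G" and A: "A \<subseteq> carrier G"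
    and ys: "set ys \<subseteq> carrier G" "generate G (N \<union> (A \<union> set ys)) = carrier G"
    and zs: "set zs \<subseteq> carrier G" "generate G (N \<union> (A \<union> set zs)) = carrier G"
    and len: "length ys = length zs" and C: "subgroup C G"
  shows "card (lifts_generating N A ys C) = card (lifts_generating N A zs C)"
  using C
proof (induction "card C" arbitrary: C rule: less_induct)
  case less
  interpret N: normal N G by fact
  show ?case
  proof (cases "A \<subseteq> C \<and> N <#> C = carrier G")
    case True
    let ?X = "\<lambda>hs. {t. list_all2 (\<lambda>x h. x \<in> N #> h \<and> x \<in> C) t hs}"
    let ?S = "{D. subgroup D G \<and> D \<subseteq> C}"
    have finC: "finite C" using finite_subset[OF subgroup.subset[OF less.prems] fin] .
    have finS: "finite ?S" using finC by (intro finite_subset[of ?S "Pow C"]) auto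
    have key: "card (lifts_generating N A hs C) + (\<Sum>D\<in>?S - {C}. card (lifts_generating N A hs D))
        = card (N \<inter> C) ^ length hs" if hs: "set hs \<subseteq> carrier G" for hs
    proof -
      have cX: "finite (?X hs) \<and> card (?X hs) = card (N \<inter> C) ^ length hs"
      proof (rule card_list_all2)
        fix h assume "h \<in> set hs"
        then have h: "h \<in> carrier G" using hs by blast
        have "{x. x \<in> N #> h \<and> x \<in> C} = (N #> h) \<inter> C" by blast
        then show "finite {x. x \<in> N #> h \<and> x \<in> C} \<and> card {x. x \<in> N #> h \<and> x \<in> C} = card (N \<inter> C)"
          using card_Int_rcoset[OF N less.prems _ h] True finC by simp
      qed
      have XU: "?X hs = (\<Union>D\<in>?S. lifts_generating N A hs D)"
      proof
        show "?X hs \<subseteq> (\<Union>D\<in>?S. lifts_generating N A hs D)"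
        proof
          fix t assume "t \<in> ?X hs"
          then have t: "list_all2 (\<lambda>x h. x \<in> N #> h \<and> x \<in> C) t hs" by simp
          then have "list_all2 (\<lambda>x h. x \<in> N #> h) t hs" by (rule list_all2_mono) simp
          moreover have tC: "set t \<subseteq> C"
            using t by (auto simp: list_all2_conv_all_nth in_set_conv_nth)
          have "A \<union> set t \<subseteq> C" using tC True by simp
          then have "subgroup (generate G (A \<union> set t)) G" "generate G (A \<union> set t) \<subseteq> C"
            using generate_is_subgroup[of "A \<union> set t"] generate_subgroup_incl[OF _ less.prems]
              subgroup.subset[OF less.prems] by (meson subset_trans, blast)
          ultimately show "t \<in> (\<Union>D\<in>?S. lifts_generating N A hs D)"
            unfolding lifts_generating_def by blast
        qed
        show "(\<Union>D\<in>?S. lifts_generating N A hs D) \<subseteq> ?X hs"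
        proof
          fix t assume "t \<in> (\<Union>D\<in>?S. lifts_generating N A hs D)"
          then obtain D where D: "D \<subseteq> C" "list_all2 (\<lambda>x h. x \<in> N #> h) t hs" "generate G (A \<union> set t) = D"
            unfolding lifts_generating_def by blast
          have "set t \<subseteq> C" using D(1,3) by (auto intro: generate.incl)
          then show "t \<in> ?X hs" using D(2) by (auto simp: list_all2_conv_all_nth)
        qed
      qed
      have sub: "lifts_generating N A hs D \<subseteq> ?X hs" if "D \<in> ?S" for D
        using XU that by blast
      have "card (?X hs) = (\<Sum>D\<in>?S. card (lifts_generating N A hs D))"
        unfolding XU
      proof (rule card_UN_disjoint[OF finS])
        show "\<forall>D\<in>?S. finite (lifts_generating N A hs D)"
          using sub cX finite_subset by meson
        show "\<forall>D\<in>?S. \<forall>E\<in>?S. D \<noteq> E \<longrightarrow> lifts_generating N A hs D \<inter> lifts_generating N A hs E = {}"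
          unfolding lifts_generating_def by blast
      qed
      also have "\<dots> = card (lifts_generating N A hs C) + (\<Sum>D\<in>?S - {C}. card (lifts_generating N A hs D))"
        using less.prems by (intro sum.remove[OF finS]) simp
      finally show ?thesis using cX by simp
    qed
    have "(\<Sum>D\<in>?S - {C}. card (lifts_generating N A ys D)) = (\<Sum>D\<in>?S - {C}. card (lifts_generating N A zs D))"
    proof (rule sum.cong[OF refl])
      fix D assume "D \<in> ?S - {C}"
      then have "D \<subset> C" "subgroup D G" by blast+
      then show "card (lifts_generating N A ys D) = card (lifts_generating N A zs D)"
        using less.hyps[OF psubset_card_mono[OF finC]] by blast
    qed
    then show ?thesis using key[OF ys(1)] key[OF zs(1)] len by simp
  next
    case False
    have "lifts_generating N A hs C = {}"
      if hs: "set hs \<subseteq> carrier G" "generate G (N \<union> (A \<union> set hs)) = carrier G" for hs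
    proof (rule ccontr)
      assume "lifts_generating N A hs C \<noteq> {}"
      then obtain t where t: "list_all2 (\<lambda>x h. x \<in> N #> h) t hs" "generate G (A \<union> set t) = C"
        unfolding lifts_generating_def by blast
      have AC: "A \<subseteq> C" "set t \<subseteq> C" using t(2) by (auto intro: generate.incl)
      have NC: "subgroup (N <#> C) G" "N \<subseteq> N <#> C" "C \<subseteq> N <#> C"
        using normal_mult_subgroup[OF N less.prems] subset_normal_mult[OF N less.prems] by blast+
      have "set hs \<subseteq> N <#> C"
      proof
        fix h assume h: "h \<in> set hs"
        then obtain i where i: "i < length hs" "h = hs ! i" by (auto simp: in_set_conv_nth)
        let ?x = "t ! i"
        have x: "?x \<in> N #> h" "?x \<in> C"
          using t(1) i AC(2) by (auto simp: list_all2_conv_all_nth)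
        obtain n where n: "n \<in> N" "?x = n \<otimes> h" using x(1) unfolding r_coset_def by blast
        have hG: "h \<in> carrier G" using h hs(1) by blast
        have "h = inv n \<otimes> ?x" unfolding n(2) using N.mem_carrier[OF n(1)] hG by (simp flip: m_assoc)
        then show "h \<in> N <#> C" using set_mult_memI[OF N.m_inv_closed[OF n(1)] x(2)] by simp
      qed
      then have "N \<union> (A \<union> set hs) \<subseteq> N <#> C" using AC(1) NC(2,3) by blast
      then have "carrier G \<subseteq> N <#> C" using generate_subgroup_incl[OF _ NC(1)] hs(2) by blast
      then have "N <#> C = carrier G" using subgroup.subset[OF NC(1)] by blast
      then show False using False AC(1) by blast
    qed
    then show ?thesis using ys zs by simp
  qed
qed

text \<open>Gaschuetz's lemma, with a set \<open>A\<close> of generators that stay fixed. The lists \<open>zs\<close> and \<open>ys\<close> have equally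
  many lifts that generate \<open>G\<close> together with \<open>A\<close>, and \<open>zs\<close> is such a lift of itself.\<close>

lemma gaschuetz:
  assumes fin: "finite (carrier G)" and N: "N \<lhd> G" and A: "A \<subseteq> carrier G"
    and ys: "set ys \<subseteq> carrier G" "generate G (N \<union> (A \<union> set ys)) = carrier G"
    and zs: "set zs \<subseteq> carrier G" "generate G (A \<union> set zs) = carrier G"
    and len: "length ys = length zs"
  shows "\<exists>t. list_all2 (\<lambda>x y. x \<in> N #> y) t ys \<and> generate G (A \<union> set t) = carrier G"
proof -
  have NG: "N \<subseteq> carrier G" using normal_imp_subgroup[OF N] subgroup.subset by blast
  have zs2: "generate G (N \<union> (A \<union> set zs)) = carrier G"
    using mono_generate[of "A \<union> set zs" "N \<union> (A \<union> set zs)"] zs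
      generate_incl[of "N \<union> (A \<union> set zs)"] A NG by blast
  have refl: "list_all2 (\<lambda>x h. x \<in> N #> h) zs zs"
    using zs(1) rcos_self[OF _ normal_imp_subgroup[OF N]]
    by (auto simp: list_all2_conv_all_nth dest: nth_mem)
  then have ne: "lifts_generating N A zs (carrier G) \<noteq> {}"
    using zs(2) unfolding lifts_generating_def by blast
  have "finite (lifts_generating N A zs (carrier G))"
  proof (rule finite_subset)
    show "lifts_generating N A zs (carrier G) \<subseteq> {t. set t \<subseteq> carrier G \<and> length t = length zs}"
      using generate.incl[of _ "A \<union> set _" G] list_all2_lengthD
      unfolding lifts_generating_def by blast
    show "finite {t. set t \<subseteq> carrier G \<and> length t = length zs}"
      using finite_lists_length_eq[OF fin] .
  qed
  then have "card (lifts_generating N A zs (carrier G)) \<noteq> 0" using ne by simp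
  then have "card (lifts_generating N A ys (carrier G)) \<noteq> 0"
    using card_lifts_generating[OF fin N A ys zs(1) zs2 len subgroup_self] by simp
  then have "lifts_generating N A ys (carrier G) \<noteq> {}" by auto
  then show ?thesis unfolding lifts_generating_def by blast
qed

text \<open>The image of \<open>S\<close> generates \<open>G/K\<close>; see \<open>generates_Mod_iff\<close> below.\<close>

definition generates_mod :: "'a set \<Rightarrow> 'a set \<Rightarrow> bool" where
  "generates_mod K S \<longleftrightarrow> S \<subseteq> carrier G \<and> generate G (K \<union> S) = carrier G"

lemma generates_mod_iff_mult:
  assumes "K \<lhd> G"
  shows "generates_mod K S \<longleftrightarrow> S \<subseteq> carrier G \<and> K <#> generate G S = carrier G"
  using generate_normal_Un[OF assms] unfolding generates_mod_def by metis

lemma generates_mod_mono: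
  assumes "generates_mod K S" "K \<subseteq> K'" "K' \<subseteq> carrier G" "S \<subseteq> S'" "S' \<subseteq> carrier G"
  shows "generates_mod K' S'"
proof -
  have "generate G (K \<union> S) \<subseteq> generate G (K' \<union> S')" using assms by (intro mono_generate) blast
  moreover have "generate G (K' \<union> S') \<subseteq> carrier G" using assms by (intro generate_incl) blast
  ultimately show ?thesis using assms unfolding generates_mod_def by blast
qed

lemma generates_mod_subset:
  assumes T: "generates_mod K T" and S: "S \<subseteq> carrier G" and K: "K \<subseteq> carrier G"
    and sub: "T \<subseteq> generate G (K \<union> S)"
  shows "generates_mod K S"
proof -
  have KS: "K \<union> S \<subseteq> carrier G" using S K by blast
  have "K \<subseteq> generate G (K \<union> S)" by (auto intro: generate.incl)
  then have "generate G (K \<union> T) \<subseteq> generate G (K \<union> S)"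
    using sub by (intro generate_subgroup_incl[OF _ generate_is_subgroup[OF KS]]) simp
  then show ?thesis using T S generate_incl[OF KS] unfolding generates_mod_def by blast
qed

lemma mem_generate_of_coset:
  assumes K: "K \<lhd> G" and x: "x \<in> carrier G" and g: "g \<in> K #> x" and gS: "g \<in> S" and S: "S \<subseteq> carrier G"
  shows "x \<in> generate G (K \<union> S)"
proof -
  interpret K: normal K G by fact
  obtain k where k: "k \<in> K" "g = k \<otimes> x" using g unfolding r_coset_def by blast
  have "x = inv k \<otimes> g" unfolding k(2) using K.mem_carrier[OF k(1)] x by (simp flip: m_assoc)
  moreover have "inv k \<in> generate G (K \<union> S)" using k(1) by (auto intro: generate.incl)
  moreover have "g \<in> generate G (K \<union> S)" using gS by (auto intro: generate.incl)
  ultimately show ?thesis using generate.eng by metis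
qed

lemma generates_mod_insert_coset:
  assumes K: "K \<lhd> G" and gen: "generates_mod K (insert x S)" and g: "g \<in> K #> x"
  shows "generates_mod K (insert g S)"
proof (rule generates_mod_subset[OF gen])
  interpret K: normal K G by fact
  have x: "x \<in> carrier G" and S: "S \<subseteq> carrier G" using gen unfolding generates_mod_def by auto
  have gG: "g \<in> carrier G" using g x r_coset_subset_G[OF K.subset x] by blast
  show gS: "insert g S \<subseteq> carrier G" using gG S by blast
  show "K \<subseteq> carrier G" by (rule K.subset)
  show "insert x S \<subseteq> generate G (K \<union> insert g S)"
    using mem_generate_of_coset[OF K x g _ gS] by (auto intro: generate.incl)
qed

lemma generates_Mod_iff:
  assumes K: "K \<lhd> G" and S: "S \<subseteq> carrier G"
  shows "generate (G Mod K) ((#>) K ` S) = carrier (G Mod K) \<longleftrightarrow> generates_mod K S"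
proof -
  interpret K: normal K G by fact
  interpret h: group_hom G "G Mod K" "(#>) K" by (rule K.Mod_group_hom)
  have sS: "subgroup (generate G S) G" using generate_is_subgroup[OF S] .
  have KS: "subgroup (K <#> generate G S) G" "K \<subseteq> K <#> generate G S" "generate G S \<subseteq> K <#> generate G S"
    using normal_mult_subgroup[OF K sS] subset_normal_mult[OF K sS] by blast+
  have gen: "generate (G Mod K) ((#>) K ` S) = (#>) K ` generate G S" by (rule h.generate_img[OF S])
  have eq: "(#>) K ` (K <#> generate G S) = (#>) K ` generate G S"
  proof
    show "(#>) K ` (K <#> generate G S) \<subseteq> (#>) K ` generate G S"
    proof
      fix c assume "c \<in> (#>) K ` (K <#> generate G S)"
      then obtain k s where ks: "k \<in> K" "s \<in> generate G S" "c = K #> (k \<otimes> s)"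
        unfolding set_mult_def by blast
      have "s \<in> carrier G" using subgroup.mem_carrier[OF sS ks(2)] .
      then have "c = K #> s"
        using K.coset_eq_iff[of "k \<otimes> s" s] ks(1,3) K.mem_carrier[OF ks(1)] by (simp add: m_assoc)
      then show "c \<in> (#>) K ` generate G S" using ks(2) by blast
    qed
    show "(#>) K ` generate G S \<subseteq> (#>) K ` (K <#> generate G S)" using KS(3) by blast
  qed
  have "(#>) K ` (K <#> generate G S) = (#>) K ` carrier G \<longleftrightarrow> K <#> generate G S = carrier G"
  proof
    assume a: "(#>) K ` (K <#> generate G S) = (#>) K ` carrier G"
    have "x \<in> K <#> generate G S" if x: "x \<in> carrier G" for x
      using K.coset_mem_image_iff[OF KS(1,2) x] x a by blast
    then show "K <#> generate G S = carrier G" using subgroup.subset[OF KS(1)] by blast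
  qed simp
  then show ?thesis
    unfolding gen using eq generates_mod_iff_mult[OF K] S by (simp add: carrier_FactGroup)
qed

text \<open>Gaschuetz's lemma in the finite group \<open>G/K\<close>, expressed by representatives in the possibly infinite
  group \<open>G\<close>.\<close>

lemma gaschuetz_mod:
  assumes K: "K \<lhd> G" and fin: "finite (carrier (G Mod K))" and N: "N \<lhd> G" and KN: "K \<subseteq> N"
    and ys: "set ys \<subseteq> carrier G" "generates_mod N (A \<union> set ys)"
    and zs: "generates_mod K (A \<union> set zs)"
    and len: "length ys = length zs"
  shows "\<exists>t. list_all2 (\<lambda>x y. x \<in> N #> y) t ys \<and> generates_mod K (A \<union> set t)"
proof -
  interpret K: normal K G by fact
  interpret N: normal N G by fact
  let ?Q = "G Mod K" and ?f = "(#>) K"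
  interpret h: group_hom G ?Q ?f by (rule K.Mod_group_hom)
  have A: "A \<subseteq> carrier G" and zsG: "set zs \<subseteq> carrier G" using zs unfolding generates_mod_def by auto
  have cQ: "carrier ?Q = ?f ` carrier G" by (simp add: carrier_FactGroup)
  have NQ: "?f ` N \<lhd> ?Q"
    using N.surj_hom_normal_subgroup[OF h.group_hom_axioms] cQ by simp
  have "\<exists>t. list_all2 (\<lambda>x y. x \<in> ?f ` N #>\<^bsub>?Q\<^esub> y) t (map ?f ys) \<and> generate ?Q (?f ` A \<union> set t) = carrier ?Q"
  proof (rule h.H.gaschuetz[OF fin NQ])
    show "?f ` A \<subseteq> carrier ?Q" "set (map ?f ys) \<subseteq> carrier ?Q" "set (map ?f zs) \<subseteq> carrier ?Q"
      using A ys zsG unfolding cQ by auto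
    show "length (map ?f ys) = length (map ?f zs)" using len by simp
    show "generate ?Q (?f ` A \<union> set (map ?f zs)) = carrier ?Q"
      using generates_Mod_iff[OF K, of "A \<union> set zs"] zs A zsG by (simp add: image_Un)
    have sub: "N \<union> (A \<union> set ys) \<subseteq> carrier G" using N.subset A ys(1) by blast
    have "generate ?Q (?f ` (N \<union> (A \<union> set ys))) = ?f ` generate G (N \<union> (A \<union> set ys))"
      by (rule h.generate_img[OF sub])
    then show "generate ?Q (?f ` N \<union> (?f ` A \<union> set (map ?f ys))) = carrier ?Q"
      using ys(2) unfolding generates_mod_def cQ by (simp add: image_Un)
  qed
  then obtain c where c: "list_all2 (\<lambda>x y. x \<in> ?f ` N #>\<^bsub>?Q\<^esub> y) c (map ?f ys)"
    "generate ?Q (?f ` A \<union> set c) = carrier ?Q" by blast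
  have "list_all2 (\<lambda>x y. x \<in> ?f ` N #>\<^bsub>?Q\<^esub> ?f y) c ys"
    using c(1) by (simp add: list_all2_map2)
  then have "list_all2 (\<lambda>x y. \<exists>g. g \<in> N #> y \<and> x = ?f g) c ys"
  proof (rule list.rel_mono_strong)
    fix x y assume "x \<in> set c" and y: "y \<in> set ys" and x: "x \<in> ?f ` N #>\<^bsub>?Q\<^esub> ?f y"
    then obtain n where n: "n \<in> N" "x = ?f n \<otimes>\<^bsub>?Q\<^esub> ?f y" unfolding r_coset_def[of ?Q] by blast
    have yG: "y \<in> carrier G" using ys(1) y by (rule subsetD)
    have "x = ?f (n \<otimes> y)" unfolding n(2) using h.hom_mult[OF N.mem_carrier[OF n(1)] yG] by (rule sym)
    moreover have "n \<otimes> y \<in> N #> y" using rcosI[OF n(1) N.subset yG] .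
    ultimately show "\<exists>g. g \<in> N #> y \<and> x = ?f g" by (intro exI conjI)
  qed
  then have "\<exists>t. list_all2 (\<lambda>g y. g \<in> N #> y) t ys \<and> map ?f t = c"
    by (rule list_all2_ex_preimage)
  then obtain t where t: "list_all2 (\<lambda>g y. g \<in> N #> y) t ys" "map ?f t = c"
    by (elim exE conjE)
  have tG: "set t \<subseteq> carrier G"
  proof
    fix x assume "x \<in> set t"
    then obtain i where i: "i < length t" "x = t ! i" by (auto simp: in_set_conv_nth)
    then have "x \<in> N #> ys ! i" "ys ! i \<in> carrier G"
      using t(1) ys(1) by (auto simp: list_all2_conv_all_nth)
    then show "x \<in> carrier G" using r_coset_subset_G[OF N.subset] by blast
  qed
  have "set c = ?f ` set t" unfolding t(2)[symmetric] by (rule set_map)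
  then have "generate ?Q (?f ` (A \<union> set t)) = carrier ?Q"
    using c(2) by (simp only: image_Un)
  then have "generates_mod K (A \<union> set t)"
    using generates_Mod_iff[OF K, of "A \<union> set t"] A tG by (simp only: Un_subset_iff simp_thms)
  then show ?thesis using t(1) by (intro exI conjI)
qed

end

section \<open>Supplements of power subgroups in virtually nilpotent groups\<close>

locale virtually_nilpotent = normal U G for U and G (structure) +
  assumes nilpotent: "nilpotent_group (G\<lparr>carrier := U\<rparr>)"
    and U_finitely_generated: "finitely_generated (G\<lparr>carrier := U\<rparr>)"
    and finite_quotient: "finite (carrier (G Mod U))"
begin

sublocale U: group "G\<lparr>carrier := U\<rparr>"
  using subgroup_imp_group[OF is_subgroup] .

abbreviation P :: "nat \<Rightarrow> 'a set" where "P \<equiv> power_subgroup G U"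

lemma power_subgroup_U: "power_subgroup (G\<lparr>carrier := U\<rparr>) (carrier (G\<lparr>carrier := U\<rparr>)) m = P m"
proof -
  have "(\<lambda>u. u [^] m) ` U \<subseteq> U" using subgroup_pow_closed[OF is_subgroup] by blast
  then show ?thesis
    unfolding power_subgroup_def using generate_consistent[OF _ is_subgroup] nat_pow_consistent[of _ m U] by simp
qed

lemma P_normal: "P m \<lhd> G"
  using power_subgroup_normal[OF normal_axioms] .

lemma P_subgroup: "subgroup (P m) G"
  using normal_imp_subgroup[OF P_normal] .

lemma P_subset: "P m \<subseteq> U"
  unfolding power_subgroup_def
  using subgroup_pow_closed[OF is_subgroup] by (intro generate_subgroup_incl[OF _ is_subgroup]) blast

lemma P_one: "P 1 = U"
proof
  show "U \<subseteq> P 1"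
  proof
    fix u assume u: "u \<in> U"
    then show "u \<in> P 1" using pow_mem_power_subgroup[OF u, of 1] by simp
  qed
qed (rule P_subset)

lemma P_dvd:
  assumes "a dvd b"
  shows "P b \<subseteq> P a"
proof -
  obtain c where c: "b = a * c" using assms by blast
  have "u [^] b \<in> P a" if u: "u \<in> U" for u
    using subgroup_pow_closed[OF P_subgroup pow_mem_power_subgroup[OF u], of a c] u
    by (simp add: c nat_pow_pow)
  then show ?thesis
    unfolding power_subgroup_def[of G U b] by (intro generate_subgroup_incl[OF _ P_subgroup]) blast
qed

lemma U_finite_index: "finite (rcosets U)"
  using finite_quotient by (simp add: FactGroup_def)

lemma P_finite_index: "m > 0 \<Longrightarrow> finite (carrier (G Mod P m))"
  using U.finite_index_power_subgroup[OF nilpotent U_finitely_generated, of m]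
    finite_index_tower[OF P_subgroup is_subgroup P_subset] U_finite_index
  by (simp add: power_subgroup_U[simplified] FactGroup_def)

lemma index_Int_U:
  assumes H: "subgroup H G" and HU: "U <#> H = carrier G"
  shows "\<exists>f. bij_betw f (rcosets\<^bsub>G\<lparr>carrier := U\<rparr>\<^esub> (H \<inter> U)) (rcosets H)"
  using index_Int[OF H is_subgroup] HU commut_normal[OF H normal_axioms] by simp

lemma Int_U_subgroup: "subgroup H G \<Longrightarrow> subgroup (H \<inter> U) (G\<lparr>carrier := U\<rparr>)"
  using subgroup_incl[OF subgroups_Inter_pair is_subgroup] is_subgroup by blast

lemma supplement_mono:
  assumes "subgroup H G" "K \<subseteq> K'" "K' \<lhd> G" "K <#> H = carrier G"
  shows "K' <#> H = carrier G"
  using mono_set_mult[OF assms(2) subset_refl[of H]] assms(4)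
    subgroup.subset[OF normal_mult_subgroup[OF assms(3,1)]] by blast

text \<open>By Dedekind's law \<open>H \<inter> U\<close> supplements \<open>U\<^sup>q\<close> in \<open>U\<close>, where the result for nilpotent groups applies.\<close>

lemma coprime_index_of_supplement:
  assumes H: "subgroup H G" and q: "q > 1" and HP: "P q <#> H = carrier G"
  shows "coprime_index q H"
proof -
  let ?W = "H \<inter> U"
  have "P q <#> ?W = U"
  proof
    show "P q <#> ?W \<subseteq> U" using P_subset unfolding set_mult_def by blast
    show "U \<subseteq> P q <#> ?W"
    proof
      fix u assume u: "u \<in> U"
      then have "u \<in> P q <#> H" using HP by simp
      then obtain k h where kh: "k \<in> P q" "h \<in> H" "u = k \<otimes> h" unfolding set_mult_def by blast
      have k: "k \<in> U" using kh(1) P_subset by blast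
      have hG: "h \<in> carrier G" using subgroup.mem_carrier[OF H kh(2)] .
      have "inv k \<otimes> u \<in> U" using subgroup.m_closed[OF is_subgroup m_inv_closed[OF k] u] .
      moreover have "inv k \<otimes> u = h" unfolding kh(3) using mem_carrier[OF k] hG by (simp flip: m_assoc)
      ultimately have "h \<in> ?W" using kh(2) by simp
      then show "u \<in> P q <#> ?W" unfolding kh(3) by (rule set_mult_memI[OF kh(1)])
    qed
  qed
  then have "U.coprime_index q ?W"
    using U.coprime_index_of_power_supplement[OF nilpotent U_finitely_generated Int_U_subgroup[OF H] q]
    by (simp add: power_subgroup_U[simplified])
  moreover have "U <#> H = carrier G"
    using supplement_mono[OF H P_subset normal_axioms HP] .
  ultimately show ?thesis
    using index_Int_U[OF H] unfolding U.coprime_index_def coprime_index_def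
    by (auto dest: bij_betw_same_card bij_betw_finite)
qed

lemma supplement_of_coprime_index:
  assumes H: "subgroup H G" and HU: "U <#> H = carrier G"
    and fin: "finite (rcosets H)" and cop: "coprime m (card (rcosets H))" and m: "m > 0"
  shows "P m <#> H = carrier G"
proof -
  let ?W = "H \<inter> U"
  obtain f where f: "bij_betw f (rcosets\<^bsub>G\<lparr>carrier := U\<rparr>\<^esub> ?W) (rcosets H)"
    using index_Int_U[OF H HU] by blast
  have "P m <#> ?W = U"
    using U.power_supplement_of_coprime_index[OF nilpotent U_finitely_generated Int_U_subgroup[OF H] _ _ m]
      bij_betw_same_card[OF f] bij_betw_finite[OF f] fin cop
    by (simp add: power_subgroup_U[simplified])
  have PH: "subgroup (P m <#> H) G" using normal_mult_subgroup[OF P_normal H] .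
  have "U \<subseteq> P m <#> H"
    using \<open>P m <#> ?W = U\<close> mono_set_mult[OF subset_refl[of "P m"], of ?W H] by blast
  moreover have "H \<subseteq> P m <#> H" using subset_normal_mult[OF P_normal H] by blast
  ultimately have "U <#> H \<subseteq> P m <#> H"
    using subgroup.m_closed[OF PH] unfolding set_mult_def[of G U H] by blast
  then show ?thesis using HU subgroup.subset[OF PH] by blast
qed

text \<open>The index of \<open>H\<close> is finite and prime to every prime divisor of \<open>m\<close>, hence to \<open>m\<close>. For \<open>m = 1\<close> there is no
  prime divisor that could ensure finiteness, but then \<open>U\<^sup>m = U\<close>.\<close>

lemma supplement_of_prime_supplements:
  assumes H: "subgroup H G" and HU: "U <#> H = carrier G" and m: "m > 0"
    and sup: "\<And>p. prime p \<Longrightarrow> p dvd m \<Longrightarrow> P p <#> H = carrier G"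
  shows "P m <#> H = carrier G"
proof (cases "m = 1")
  case True
  then show ?thesis using HU P_one by simp
next
  case False
  then obtain q where q: "prime q" "q dvd m" using prime_factor_nat by blast
  have cop: "coprime_index p H" if "prime p" "p dvd m" for p
    using coprime_index_of_supplement[OF H prime_gt_1_nat sup] that by blast
  have fin: "finite (rcosets H)" using cop[OF q] by (simp add: coprime_index_def)
  have "coprime m (card (rcosets H))"
  proof (rule ccontr)
    assume "\<not> coprime m (card (rcosets H))"
    then have "gcd m (card (rcosets H)) \<noteq> 1" by (simp add: coprime_iff_gcd_eq_1)
    then obtain p where "prime p" "p dvd gcd m (card (rcosets H))" using prime_factor_nat by blast
    then have p: "prime p" "p dvd m" "p dvd card (rcosets H)" by auto
    then have "coprime (card (rcosets H)) p" using cop[OF p(1,2)] by (simp add: coprime_index_def)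
    then show False using p(1,3) by (metis coprime_absorb_right not_prime_unit)
  qed
  then show ?thesis using supplement_of_coprime_index[OF H HU fin _ m] by blast
qed

text \<open>The index of \<open>H\<close> is not divisible by any prime.\<close>

lemma eq_carrier_of_prime_supplements:
  assumes H: "subgroup H G" and sup: "\<And>p. prime p \<Longrightarrow> P p <#> H = carrier G"
  shows "H = carrier G"
proof -
  have cop: "coprime_index p H" if "prime p" for p
    using coprime_index_of_supplement[OF H prime_gt_1_nat sup] that by blast
  have "card (rcosets H) = 1"
  proof (rule ccontr)
    assume "card (rcosets H) \<noteq> 1"
    then obtain p where p: "prime p" "p dvd card (rcosets H)" using prime_factor_nat by blast
    have "coprime (card (rcosets H)) p" using cop[OF p(1)] by (simp add: coprime_index_def)
    then show False using p by (metis coprime_absorb_right not_prime_unit)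
  qed
  then obtain C where C: "rcosets H = {C}" by (auto simp: card_1_singleton_iff)
  moreover have "H \<in> rcosets H" using subgroup.subgroup_in_rcosets[OF H is_group] .
  ultimately show ?thesis using rcosets_part_G[OF H] by auto
qed

text \<open>A Chinese remainder theorem: for coprime \<open>m\<close> and \<open>p\<close>, Bezout's identity writes every element of \<open>U\<close> as
  a product of an \<open>m\<close>-th and a \<open>p\<close>-th power, so conditions modulo \<open>U\<^sup>m\<close> and \<open>U\<^sup>p\<close> can be met
  together as long as they agree modulo \<open>U\<close>.\<close>

lemma simultaneous_approximation:
  assumes y: "y \<in> carrier G" and F: "finite F"
    and x: "\<And>p. p \<in> F \<Longrightarrow> prime p \<and> x p \<in> U #> y"
  shows "\<exists>g \<in> U #> y. \<forall>p\<in>F. g \<in> P p #> x p"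
  using F x
proof (induction F rule: finite_induct)
  case empty
  then show ?case using rcos_self[OF y is_subgroup] by blast
next
  case (insert p F)
  obtain g where g: "g \<in> U #> y" "\<forall>p\<in>F. g \<in> P p #> x p" using insert by blast
  have Uy: "U #> y \<subseteq> carrier G" using r_coset_subset_G[OF subset y] .
  have gG: "g \<in> carrier G" using g(1) Uy by blast
  have xp: "x p \<in> U #> y" "prime p" using insert.prems by blast+
  have xG: "x p \<in> carrier G" using xp(1) Uy by blast
  define m where "m = \<Prod>F"
  have "coprime m p" unfolding m_def
  proof (rule prod_coprime_left)
    fix a assume a: "a \<in> F"
    then have "a \<noteq> p" using insert.hyps(2) by blast
    then show "coprime a p" using primes_coprime[of a p] insert.prems[of a] a xp(2) by blast
  qed
  then obtain a b :: int where ab: "int m * a + int p * b = 1"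
    using bezout_int[of "int m" "int p"] by (auto simp: coprime_iff_gcd_eq_1 mult.commute)
  have "U #> x p = U #> g"
    using repr_independence[OF xp(1) y is_subgroup] repr_independence[OF g(1) y is_subgroup] by simp
  then have uU: "x p \<otimes> inv g \<in> U" using rcos_self[OF xG is_subgroup] rcos_module[OF is_group gG xG] by simp
  define u where "u = x p \<otimes> inv g"
  have uG: "u \<in> carrier G" using gG xG unfolding u_def by simp
  have xu: "x p = u \<otimes> g" unfolding u_def using gG xG by (simp add: m_assoc)
  let ?a = "(u [^] m) [^] a" and ?b = "(u [^] p) [^] b"
  have am: "?a \<in> P m" "?b \<in> P p"
    using subgroup_int_pow_closed[OF P_subgroup] pow_mem_power_subgroup uU unfolding u_def by blast+
  have eq: "u = ?b \<otimes> ?a"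
  proof -
    have "?b \<otimes> ?a = u [^] (int p * b + int m * a)"
      using uG by (simp add: int_pow_pow int_pow_mult flip: int_pow_int)
    also have "\<dots> = u" using ab uG by (simp add: add.commute)
    finally show ?thesis by simp
  qed
  have abG: "?a \<in> carrier G" "?b \<in> carrier G" using uG by auto
  have aU: "?a \<in> U" using am(1) P_subset by blast
  let ?g = "?a \<otimes> g"
  have "?g \<in> U #> y"
  proof -
    obtain v where v: "v \<in> U" "g = v \<otimes> y" using g(1) unfolding r_coset_def by blast
    have "?g = (?a \<otimes> v) \<otimes> y" using v abG y mem_carrier[OF v(1)] by (simp add: m_assoc)
    then show ?thesis using subgroup.m_closed[OF is_subgroup aU v(1)] unfolding r_coset_def by blast
  qed
  moreover have "?g \<in> P p #> x p"
  proof -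
    have "x p = ?b \<otimes> ?g" unfolding xu using abG gG by (subst eq) (simp add: m_assoc)
    then have "?g = inv ?b \<otimes> x p" using abG gG by (simp flip: m_assoc)
    then show ?thesis using subgroup.m_inv_closed[OF P_subgroup am(2)] unfolding r_coset_def by blast
  qed
  moreover have "?g \<in> P p' #> x p'" if p': "p' \<in> F" for p'
  proof -
    have "p' dvd m" unfolding m_def using p' insert.hyps(1) by (rule dvd_prodI[where f = id, simplified, rotated])
    then have ap: "?a \<in> P p'" using P_dvd am(1) by blast
    obtain v where v: "v \<in> P p'" "g = v \<otimes> x p'" using g(2) p' unfolding r_coset_def by blast
    have x'G: "x p' \<in> carrier G" using insert.prems[of p'] p' Uy by blast
    have "?g = (?a \<otimes> v) \<otimes> x p'"
      using v abG x'G subgroup.mem_carrier[OF P_subgroup v(1)] by (simp add: m_assoc)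
    then show ?thesis using subgroup.m_closed[OF P_subgroup ap v(1)] unfolding r_coset_def by blast
  qed
  ultimately show ?case by blast
qed

end

section \<open>Generators modulo all primes at once\<close>

context virtually_nilpotent
begin

text \<open>The entries \<open>hs\<close> that complete \<open>gs\<close> are not restricted modulo \<open>U\<close>: \<open>extendable_lift\<close> moves them into any
  admissible cosets of \<open>U\<close>.\<close>

definition extendable :: "nat \<Rightarrow> nat \<Rightarrow> 'a list \<Rightarrow> bool" where
  "extendable n p gs \<longleftrightarrow>
     (\<exists>hs. length gs + length hs = n \<and> generates_mod (P p) (set gs \<union> set hs))"

lemma P_carrier: "P m \<subseteq> carrier G"
  using P_subset subset by blast

lemma generates_mod_U: "generates_mod (P m) S \<Longrightarrow> generates_mod U S"
  using generates_mod_mono[OF _ P_subset subset subset_refl] unfolding generates_mod_def by blast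

lemma coprime_index_of_generates_mod:
  assumes gen: "generates_mod (P q) S" and q: "prime q"
  shows "coprime_index q (generate G S)"
  using gen coprime_index_of_supplement[OF generate_is_subgroup prime_gt_1_nat[OF q]]
  unfolding generates_mod_iff_mult[OF P_normal] by blast

lemma generates_of_generates_mod_primes:
  assumes "\<And>p. prime p \<Longrightarrow> generates_mod (P p) S"
  shows "generate G S = carrier G"
proof (rule eq_carrier_of_prime_supplements)
  show "subgroup (generate G S) G"
    using assms[OF two_is_prime_nat] unfolding generates_mod_def by (intro generate_is_subgroup) blast
  show "P p <#> generate G S = carrier G" if "prime p" for p
    using assms[OF that] unfolding generates_mod_iff_mult[OF P_normal] by blast
qed

text \<open>The elements that complete \<open>gs\<close> at \<open>q\<close> generate a subgroup of finite index together with \<open>gs\<close>, and the same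
  elements complete \<open>gs\<close> at every prime that does not divide this index.\<close>

lemma finite_not_extendable:
  assumes q: "prime q" and ext: "extendable n q gs"
  shows "finite {p. prime p \<and> \<not> extendable n p gs}"
proof -
  obtain hs where hs: "length gs + length hs = n" "generates_mod (P q) (set gs \<union> set hs)"
    using ext unfolding extendable_def by blast
  let ?S = "set gs \<union> set hs"
  let ?H = "generate G ?S"
  have S: "?S \<subseteq> carrier G" using hs(2) unfolding generates_mod_def by blast
  have fin: "finite (rcosets ?H)"
    using coprime_index_of_generates_mod[OF hs(2) q] by (simp add: coprime_index_def)
  have U: "U <#> ?H = carrier G"
    using generates_mod_U[OF hs(2)] unfolding generates_mod_iff_mult[OF normal_axioms] by blast
  have "p dvd card (rcosets ?H)" if p: "prime p" "\<not> extendable n p gs" for p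
  proof (rule ccontr)
    assume "\<not> p dvd card (rcosets ?H)"
    then have "coprime p (card (rcosets ?H))" using prime_imp_coprime[OF p(1)] by blast
    then have "P p <#> ?H = carrier G"
      using supplement_of_coprime_index[OF generate_is_subgroup[OF S] U fin _ prime_gt_0_nat[OF p(1)]] by blast
    then have "generates_mod (P p) ?S" using S unfolding generates_mod_iff_mult[OF P_normal] by blast
    then show False using hs(1) p(2) unfolding extendable_def by blast
  qed
  then have "{p. prime p \<and> \<not> extendable n p gs} \<subseteq> {p. p dvd card (rcosets ?H)}" by blast
  moreover have "card (rcosets ?H) > 0" using fin rcosets_nonempty by (simp add: card_gt_0_iff)
  ultimately show ?thesis using finite_subset finite_divisors_nat by blast
qed

lemma extendable_lift:
  assumes p: "prime p" and ext: "extendable n p gs" and len: "length gs + length zs = n"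
    and zs: "set zs \<subseteq> carrier G" and gen: "generates_mod U (set gs \<union> set zs)"
  shows "\<exists>hs. list_all2 (\<lambda>x y. x \<in> U #> y) hs zs \<and> generates_mod (P p) (set gs \<union> set hs)"
proof -
  obtain hs where hs: "length gs + length hs = n" "generates_mod (P p) (set gs \<union> set hs)"
    using ext unfolding extendable_def by blast
  show ?thesis
    using gaschuetz_mod[OF P_normal P_finite_index[OF prime_gt_0_nat[OF p]] normal_axioms P_subset zs gen hs(2)]
      len hs(1) by simp
qed

lemma extendable_lift_hd:
  assumes p: "prime p" and ext: "extendable n p gs" and len: "length gs + length (y # zs) = n"
    and zs: "set (y # zs) \<subseteq> carrier G" and gen: "generates_mod U (set gs \<union> set (y # zs))"
  shows "\<exists>x \<in> U #> y. extendable n p (gs @ [x])"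
proof -
  obtain hs where hs: "list_all2 (\<lambda>x y. x \<in> U #> y) hs (y # zs)" "generates_mod (P p) (set gs \<union> set hs)"
    using extendable_lift[OF p ext len zs gen] by blast
  then obtain x hs' where x: "hs = x # hs'" "x \<in> U #> y" by (auto simp: list_all2_Cons2)
  have "length hs' = length zs" using list_all2_lengthD[OF hs(1)] x(1) by simp
  then have "length (gs @ [x]) + length hs' = n" using len by simp
  moreover have "set (gs @ [x]) \<union> set hs' = set gs \<union> set hs" using x(1) by auto
  ultimately show ?thesis using hs(2) x(2) unfolding extendable_def by metis
qed

lemma extendable_coset:
  assumes ext: "extendable n p (gs @ [x])" and g: "g \<in> P p #> x"
  shows "extendable n p (gs @ [g])"
proof -
  obtain hs where hs: "length (gs @ [x]) + length hs = n" "generates_mod (P p) (set (gs @ [x]) \<union> set hs)"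
    using ext unfolding extendable_def by blast
  have "generates_mod (P p) (insert x (set gs \<union> set hs))" using hs(2) by simp
  then have "generates_mod (P p) (insert g (set gs \<union> set hs))"
    using generates_mod_insert_coset[OF P_normal _ g] by blast
  then show ?thesis using hs(1) unfolding extendable_def by auto
qed

lemma generates_mod_U_replace:
  assumes ys: "generates_mod U (set ys)" and gs: "list_all2 (\<lambda>x y. x \<in> U #> y) gs (take i ys)"
  shows "generates_mod U (set gs \<union> set (drop i ys))"
proof (rule generates_mod_subset[OF ys _ subset])
  have ysG: "set ys \<subseteq> carrier G" using ys unfolding generates_mod_def by blast
  have tk: "set (take i ys) \<subseteq> carrier G" "set (drop i ys) \<subseteq> carrier G"
    using ysG set_take_subset set_drop_subset by fast+
  have "set gs \<subseteq> carrier G"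
  proof
    fix x assume "x \<in> set gs"
    then obtain j where j: "j < length gs" "x = gs ! j" by (auto simp: in_set_conv_nth)
    have "x \<in> U #> take i ys ! j" using list_all2_nthD[OF gs j(1)] j(2) by simp
    moreover have "take i ys ! j \<in> set (take i ys)"
      by (rule nth_mem) (use list_all2_lengthD[OF gs] j(1) in simp)
    ultimately show "x \<in> carrier G" using r_coset_subset_G[OF subset] tk(1) by blast
  qed
  then show S: "set gs \<union> set (drop i ys) \<subseteq> carrier G" using tk(2) by blast
  show "set ys \<subseteq> generate G (U \<union> (set gs \<union> set (drop i ys)))"
  proof
    fix y assume "y \<in> set ys"
    then have "y \<in> set (take i ys) \<or> y \<in> set (drop i ys)"
      using set_append[of "take i ys" "drop i ys"] by auto
    then show "y \<in> generate G (U \<union> (set gs \<union> set (drop i ys)))"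
    proof
      assume y: "y \<in> set (take i ys)"
      then obtain j where j: "j < length (take i ys)" "y = take i ys ! j" by (auto simp: in_set_conv_nth)
      then have j': "gs ! j \<in> U #> y" "gs ! j \<in> set gs" using gs unfolding list_all2_conv_all_nth by auto
      have "y \<in> carrier G" using tk(1) y by (rule subsetD)
      from mem_generate_of_coset[OF normal_axioms this j'(1) _ S] j'(2) show ?thesis by simp
    next
      assume "y \<in> set (drop i ys)"
      then show ?thesis by (intro generate.incl) simp
    qed
  qed
qed

text \<open>The invariant of the construction. The fixed list \<open>ys\<close> determines the cosets of \<open>U\<close> from which the
  elements are taken, so that the choices at different primes are compatible; a trivial last entry
  serves for the lists of length \<open>n + 1\<close>.\<close>

lemma partial_generators:
  assumes Q: "finite Q" "Q \<noteq> {}" "\<And>p. p \<in> Q \<Longrightarrow> prime p"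
    and ys: "length ys = n" "generates_mod U (set ys)"
    and all: "\<And>p. prime p \<Longrightarrow> extendable (Suc n) p []"
    and Qn: "\<And>p. p \<in> Q \<Longrightarrow> extendable n p []"
    and i: "i \<le> n"
  shows "\<exists>gs. length gs = i \<and> list_all2 (\<lambda>x y. x \<in> U #> y) gs (take i ys) \<and>
    (\<forall>p. prime p \<longrightarrow> extendable (Suc n) p gs) \<and> (\<forall>p\<in>Q. extendable n p gs)"
  using i
proof (induction i)
  case 0
  then show ?case using all Qn by simp
next
  case (Suc i)
  then obtain gs where gs: "length gs = i" "list_all2 (\<lambda>x y. x \<in> U #> y) gs (take i ys)"
    "\<And>p. prime p \<Longrightarrow> extendable (Suc n) p gs" "\<And>p. p \<in> Q \<Longrightarrow> extendable n p gs" by auto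
  let ?y = "ys ! i" and ?zs = "drop (Suc i) ys"
  have dr: "drop i ys = ?y # ?zs" using Cons_nth_drop_Suc[of i ys] Suc.prems ys(1) by simp
  have gen: "generates_mod U (set gs \<union> set (?y # ?zs))"
    using generates_mod_U_replace[OF ys(2) gs(2)] dr by simp
  have gzs: "set gs \<union> set (?y # ?zs) \<subseteq> carrier G"
    using gen unfolding generates_mod_def by (rule conjunct1)
  then have zs: "set (?y # ?zs) \<subseteq> carrier G" and y: "?y \<in> carrier G" by simp_all
  have gen1: "generates_mod U (set gs \<union> set (?y # (?zs @ [\<one>])))"
    by (rule generates_mod_mono[OF gen subset_refl subset]) (use gzs in auto)
  define bad where "bad = {p. prime p \<and> \<not> extendable n p gs}"
  obtain q where q: "q \<in> Q" using Q(2) by blast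
  have finbad: "finite bad" unfolding bad_def using finite_not_extendable[OF Q(3)[OF q] gs(4)[OF q]] .
  have "\<forall>p\<in>bad \<union> Q. \<exists>x. x \<in> U #> ?y \<and> extendable (if p \<in> Q then n else Suc n) p (gs @ [x])"
  proof
    fix p assume p: "p \<in> bad \<union> Q"
    show "\<exists>x. x \<in> U #> ?y \<and> extendable (if p \<in> Q then n else Suc n) p (gs @ [x])"
    proof (cases "p \<in> Q")
      case True
      have "length gs + length (?y # ?zs) = n" using gs(1) ys(1) Suc.prems by simp
      from extendable_lift_hd[OF Q(3)[OF True] gs(4)[OF True] this zs gen] show ?thesis using True by auto
    next
      case False
      then have pp: "prime p" using p unfolding bad_def by blast
      have "length gs + length (?y # (?zs @ [\<one>])) = Suc n" using gs(1) ys(1) Suc.prems by simp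
      moreover have "set (?y # (?zs @ [\<one>])) \<subseteq> carrier G" using zs by simp
      ultimately show ?thesis using extendable_lift_hd[OF pp gs(3)[OF pp] _ _ gen1] False by auto
    qed
  qed
  from bchoice[OF this] obtain x where x: "\<And>p. p \<in> bad \<union> Q \<Longrightarrow>
      x p \<in> U #> ?y \<and> extendable (if p \<in> Q then n else Suc n) p (gs @ [x p])" by blast
  have fin: "finite (bad \<union> Q)" using finbad Q(1) by simp
  have "\<exists>g \<in> U #> ?y. \<forall>p\<in>bad \<union> Q. g \<in> P p #> x p"
  proof (rule simultaneous_approximation[OF y fin])
    fix p assume "p \<in> bad \<union> Q"
    then show "prime p \<and> x p \<in> U #> ?y" using x Q(3) unfolding bad_def by blast
  qed
  then obtain g where g: "g \<in> U #> ?y" "\<And>p. p \<in> bad \<union> Q \<Longrightarrow> g \<in> P p #> x p" by blast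
  have gG: "g \<in> carrier G" using g(1) r_coset_subset_G[OF subset y] by blast
  have gQ: "extendable n p (gs @ [g])" if "p \<in> Q" for p
  proof (rule extendable_coset)
    show "extendable n p (gs @ [x p])" using x[of p] that by simp
    show "g \<in> P p #> x p" using g(2)[of p] that by simp
  qed
  have gall: "extendable (Suc n) p (gs @ [g])" if p: "prime p" for p
  proof (cases "extendable n p gs")
    case True
    \<comment> \<open>The completing list has one entry to spare, so \<open>g\<close> may be arbitrary at this prime.\<close>
    then obtain hs where hs: "length gs + length hs = n" "generates_mod (P p) (set gs \<union> set hs)"
      unfolding extendable_def by blast
    have "set gs \<union> set hs \<subseteq> carrier G"
      using hs(2) unfolding generates_mod_def by (rule conjunct1)
    then have "generates_mod (P p) (set (gs @ [g]) \<union> set hs)"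
      by (intro generates_mod_mono[OF hs(2) subset_refl P_carrier]) (use gG in auto)
    then show ?thesis using hs(1) unfolding extendable_def by auto
  next
    case False
    then have pb: "p \<in> bad" "p \<notin> Q" using p gs(4) unfolding bad_def by blast+
    then have "extendable (Suc n) p (gs @ [x p])" using x[of p] by simp
    then show ?thesis using extendable_coset g(2)[of p] pb by blast
  qed
  have tk: "take (Suc i) ys = take i ys @ [?y]"
    using Suc.prems ys(1) by (intro take_Suc_conv_app_nth) simp
  have "list_all2 (\<lambda>x y. x \<in> U #> y) (gs @ [g]) (take (Suc i) ys)"
    unfolding tk using gs(2) g(1) by (intro list_all2_appendI) simp_all
  then show ?case using gs(1) gQ gall by (intro exI[of _ "gs @ [g]"]) simp
qed

text \<open>The \<open>n\<close> elements of the previous construction generate \<open>G\<close> modulo \<open>U\<^sup>p\<close> for all but finitely many \<open>p\<close>;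
  the last element is taken from \<open>U\<close> and repairs the exceptional primes.\<close>

lemma generators_exist:
  assumes Q: "finite Q" "Q \<noteq> {}" "\<And>p. p \<in> Q \<Longrightarrow> prime p"
    and all: "\<And>p. prime p \<Longrightarrow> \<exists>xs. length xs = Suc n \<and> generates_mod (P p) (set xs)"
    and Qn: "\<And>p. p \<in> Q \<Longrightarrow> \<exists>xs. length xs = n \<and> generates_mod (P p) (set xs)"
  shows "\<exists>gs g. length gs = n \<and> set gs \<subseteq> carrier G \<and> g \<in> carrier G \<and>
    generate G (insert g (set gs)) = carrier G \<and> (\<forall>p\<in>Q. generates_mod (P p) (set gs))"
proof -
  obtain q where q: "q \<in> Q" using Q(2) by blast
  obtain ys where ys: "length ys = n" "generates_mod (P q) (set ys)" using Qn[OF q] by blast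
  have "\<exists>gs. length gs = n \<and> list_all2 (\<lambda>x y. x \<in> U #> y) gs (take n ys) \<and>
      (\<forall>p. prime p \<longrightarrow> extendable (Suc n) p gs) \<and> (\<forall>p\<in>Q. extendable n p gs)"
    using all Qn by (intro partial_generators[OF Q ys(1) generates_mod_U[OF ys(2)]])
      (auto simp: extendable_def)
  then obtain gs where gs: "length gs = n" "\<And>p. prime p \<Longrightarrow> extendable (Suc n) p gs"
    "\<And>p. p \<in> Q \<Longrightarrow> extendable n p gs" by blast
  have ext: "generates_mod (P p) (set gs)" if "extendable n p gs" for p
    using that gs(1) unfolding extendable_def by auto
  have gsG: "set gs \<subseteq> carrier G" using ext[OF gs(3)[OF q]] unfolding generates_mod_def by blast
  define bad where "bad = {p. prime p \<and> \<not> extendable n p gs}"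
  have finbad: "finite bad" unfolding bad_def using finite_not_extendable[OF Q(3)[OF q] gs(3)[OF q]] .
  have genU: "generates_mod U (set gs \<union> set [\<one>])"
    using generates_mod_mono[OF generates_mod_U[OF ext[OF gs(3)[OF q]]] subset_refl subset] gsG by auto
  have "\<forall>p\<in>bad. \<exists>x. x \<in> U #> \<one> \<and> generates_mod (P p) (insert x (set gs))"
  proof
    fix p assume "p \<in> bad"
    then have p: "prime p" unfolding bad_def by blast
    obtain hs where hs: "list_all2 (\<lambda>x y. x \<in> U #> y) hs [\<one>]" "generates_mod (P p) (set gs \<union> set hs)"
      using extendable_lift[OF p gs(2)[OF p] _ _ genU] gs(1) by auto
    then obtain x where "hs = [x]" "x \<in> U #> \<one>" by (auto simp: list_all2_Cons2)
    then show "\<exists>x. x \<in> U #> \<one> \<and> generates_mod (P p) (insert x (set gs))" using hs(2) by auto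
  qed
  from bchoice[OF this] obtain x where x: "\<And>p. p \<in> bad \<Longrightarrow>
      x p \<in> U #> \<one> \<and> generates_mod (P p) (insert (x p) (set gs))" by blast
  have "\<exists>g \<in> U #> \<one>. \<forall>p\<in>bad. g \<in> P p #> x p"
  proof (rule simultaneous_approximation[OF one_closed finbad])
    fix p assume "p \<in> bad"
    then show "prime p \<and> x p \<in> U #> \<one>" using x unfolding bad_def by blast
  qed
  then obtain g where g: "g \<in> U #> \<one>" "\<And>p. p \<in> bad \<Longrightarrow> g \<in> P p #> x p" by blast
  have gG: "g \<in> carrier G" using g(1) r_coset_subset_G[OF subset one_closed] by blast
  have "generates_mod (P p) (insert g (set gs))" if p: "prime p" for p
  proof (cases "extendable n p gs")
    case True
    then show ?thesis using generates_mod_mono[OF ext subset_refl P_carrier] gG gsG by blast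
  next
    case False
    then have "p \<in> bad" using p unfolding bad_def by blast
    then show ?thesis using generates_mod_insert_coset[OF P_normal] x g(2) by blast
  qed
  then have "generate G (insert g (set gs)) = carrier G" by (rule generates_of_generates_mod_primes)
  then show ?thesis using gs(1,3) gsG gG ext by blast
qed

end

section \<open>Generators of the profinite completion\<close>

context group
begin

lemma finite_index_normals_normal: "N \<in> finite_index_normals G \<Longrightarrow> N \<lhd> G"
  by (simp add: finite_index_normals_def)

lemma coset_enlarge:
  assumes M: "M \<lhd> G" and N: "N \<lhd> G" and MN: "M \<subseteq> N" and g: "g \<in> carrier G"
  shows "N <#> (M #> g) = N #> g"
proof -
  interpret M: normal M G by fact
  interpret N: normal N G by fact
  have "N <#> M = N"
    using set_mult_subgroup_idem[OF N.is_subgroup subgroup_incl[OF M.is_subgroup N.is_subgroup MN]] .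
  then show ?thesis using setmult_rcos_assoc[OF N.subset M.subset g] by simp
qed

lemma profinite_group_product:
  "group (product_group (finite_index_normals G) (\<lambda>N. G Mod N))"
  using finite_index_normals_normal normal.factorgroup_is_group by (intro product_group) blast

lemma profinite_carrierD:
  assumes "x \<in> carrier (profinite_completion G)"
  shows "N \<in> finite_index_normals G \<Longrightarrow> x N \<in> carrier (G Mod N)"
    and "M \<in> finite_index_normals G \<Longrightarrow> N \<in> finite_index_normals G \<Longrightarrow> M \<subseteq> N \<Longrightarrow> N <#> x M = x N"
  using assms by (auto simp: profinite_completion_def)

lemma profinite_mult:
  "N \<in> finite_index_normals G \<Longrightarrow> (x \<otimes>\<^bsub>profinite_completion G\<^esub> y) N = x N <#> y N"
  by (simp add: profinite_completion_def)

lemma profinite_subgroup: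
  "subgroup (carrier (profinite_completion G)) (product_group (finite_index_normals G) (\<lambda>N. G Mod N))"
proof -
  let ?I = "finite_index_normals G" and ?C = "carrier (profinite_completion G)"
  interpret A: group "product_group ?I (\<lambda>N. G Mod N)" by (rule profinite_group_product)
  have C: "x \<in> ?C \<longleftrightarrow> x \<in> (\<Pi>\<^sub>E N \<in> ?I. carrier (G Mod N)) \<and>
      (\<forall>M \<in> ?I. \<forall>N \<in> ?I. M \<subseteq> N \<longrightarrow> N <#> x M = x N)" for x
    by (simp add: profinite_completion_def)
  have gm: "group (G Mod N)" if "N \<in> ?I" for N
    using finite_index_normals_normal[OF that] normal.factorgroup_is_group by blast
  have rep: "\<exists>a\<in>carrier G. x M = M #> a" if "x \<in> ?C" "M \<in> ?I" for x M
    using profinite_carrierD(1)[OF that] by (auto simp: carrier_FactGroup)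
  show ?thesis
  proof (rule A.subgroupI)
    show sub: "?C \<subseteq> carrier (product_group ?I (\<lambda>N. G Mod N))"
      unfolding carrier_product_group by (rule subsetI) (rule conjunct1[OF iffD1[OF C]])
    have "(\<lambda>N\<in>?I. N) \<in> ?C"
    proof -
      have "N \<in> carrier (G Mod N)" if "N \<in> ?I" for N
        using group.is_monoid[OF gm[OF that]] monoid.one_closed by fastforce
      then have "(\<lambda>N\<in>?I. N) \<in> (\<Pi>\<^sub>E N \<in> ?I. carrier (G Mod N))"
        by (intro restrict_PiE_iff[THEN iffD2] ballI)
      moreover have "N <#> M = N" if "M \<in> ?I" "N \<in> ?I" "M \<subseteq> N" for M N
      proof -
        note nM = finite_index_normals_normal[OF that(1)] and nN = finite_index_normals_normal[OF that(2)]
        have "M \<subseteq> carrier G" "N \<subseteq> carrier G"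
          using subgroup.subset[OF normal_imp_subgroup[OF nM]] subgroup.subset[OF normal_imp_subgroup[OF nN]] .
        then show ?thesis using coset_enlarge[OF nM nN that(3) one_closed] by simp
      qed
      ultimately show ?thesis by (intro iffD2[OF C] conjI ballI impI) simp_all
    qed
    then show "?C \<noteq> {}" by blast
    fix x assume x: "x \<in> ?C"
    then have xp: "x \<in> (\<Pi>\<^sub>E N \<in> ?I. carrier (G Mod N))" by (rule conjunct1[OF iffD1[OF C]])
    have iv: "inv\<^bsub>product_group ?I (\<lambda>N. G Mod N)\<^esub> x = (\<lambda>N\<in>?I. inv\<^bsub>G Mod N\<^esub> x N)"
      by (rule inv_product_group[OF xp gm])
    have "inv\<^bsub>product_group ?I (\<lambda>N. G Mod N)\<^esub> x \<in> carrier (product_group ?I (\<lambda>N. G Mod N))"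
      using A.inv_closed[OF subsetD[OF sub x]] .
    moreover have "N <#> inv\<^bsub>G Mod M\<^esub> x M = inv\<^bsub>G Mod N\<^esub> x N" if MN: "M \<in> ?I" "N \<in> ?I" "M \<subseteq> N" for M N
    proof -
      note nM = finite_index_normals_normal[OF MN(1)] and nN = finite_index_normals_normal[OF MN(2)]
      obtain a where a: "a \<in> carrier G" "x M = M #> a" using rep[OF x MN(1)] by blast
      have xN: "x N = N #> a"
        using profinite_carrierD(2)[OF x MN] a(2) coset_enlarge[OF nM nN MN(3) a(1)] by simp
      have "inv\<^bsub>G Mod K\<^esub> (K #> a) = K #> inv a" if "K \<lhd> G" for K
        using group_hom.hom_inv[OF normal.Mod_group_hom[OF that] a(1)] by simp
      then show ?thesis using nM nN a(2) xN coset_enlarge[OF nM nN MN(3)] a(1) by simp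
    qed
    ultimately show "inv\<^bsub>product_group ?I (\<lambda>N. G Mod N)\<^esub> x \<in> ?C"
      unfolding iv by (intro iffD2[OF C] conjI ballI impI) simp_all
    fix y assume y: "y \<in> ?C"
    have "x \<otimes>\<^bsub>product_group ?I (\<lambda>N. G Mod N)\<^esub> y \<in> carrier (product_group ?I (\<lambda>N. G Mod N))"
      using A.m_closed sub x y by blast
    moreover have "N <#> (x M <#> y M) = x N <#> y N" if MN: "M \<in> ?I" "N \<in> ?I" "M \<subseteq> N" for M N
    proof -
      note nM = finite_index_normals_normal[OF MN(1)] and nN = finite_index_normals_normal[OF MN(2)]
      obtain a where a: "a \<in> carrier G" "x M = M #> a" using rep[OF x MN(1)] by blast
      obtain b where b: "b \<in> carrier G" "y M = M #> b" using rep[OF y MN(1)] by blast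
      have xN: "x N = N #> a"
        using profinite_carrierD(2)[OF x MN] a(2) coset_enlarge[OF nM nN MN(3) a(1)] by simp
      have yN: "y N = N #> b"
        using profinite_carrierD(2)[OF y MN] b(2) coset_enlarge[OF nM nN MN(3) b(1)] by simp
      show ?thesis
        unfolding xN yN a(2) b(2) normal.rcos_sum[OF nM a(1) b(1)] normal.rcos_sum[OF nN a(1) b(1)]
        using coset_enlarge[OF nM nN MN(3)] a(1) b(1) by simp
    qed
    ultimately show "x \<otimes>\<^bsub>product_group ?I (\<lambda>N. G Mod N)\<^esub> y \<in> ?C"
      by (intro iffD2[OF C] conjI ballI impI) simp_all
  qed
qed

lemma profinite_group: "group (profinite_completion G)"
proof -
  have eq: "profinite_completion G =
      (product_group (finite_index_normals G) (\<lambda>N. G Mod N))\<lparr>carrier := carrier (profinite_completion G)\<rparr>"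
    by (simp add: profinite_completion_def)
  show ?thesis
    by (subst eq) (rule group.subgroup_imp_group[OF profinite_group_product profinite_subgroup])
qed

lemma profinite_projection_hom:
  assumes N: "N \<in> finite_index_normals G"
  shows "group_hom (profinite_completion G) (G Mod N) (\<lambda>x. x N)"
proof (intro group_hom.intro group_hom_axioms.intro)
  show "group (profinite_completion G)" by (rule profinite_group)
  show "group (G Mod N)" using normal.factorgroup_is_group[OF finite_index_normals_normal[OF N]] .
  show "(\<lambda>x. x N) \<in> hom (profinite_completion G) (G Mod N)"
    using profinite_carrierD(1)[OF _ N] profinite_mult[OF N] by (intro homI) simp_all
qed

lemma profinite_element_of:
  assumes g: "g \<in> carrier G"
  shows "(\<lambda>N\<in>finite_index_normals G. N #> g) \<in> carrier (profinite_completion G)"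
  using g coset_enlarge finite_index_normals_normal
  by (auto simp: profinite_completion_def carrier_FactGroup)

lemma topspace_profinite: "topspace (profinite_topology G) = carrier (profinite_completion G)"
  by (auto simp: profinite_topology_def profinite_completion_def)

text \<open>The factor group is discrete, so each fibre of the projection is open and meets the dense subgroup; the
  fibre is not empty because it contains the image of an element of \<open>G\<close>.\<close>

lemma generates_projection_of_dense:
  assumes S: "S \<subseteq> carrier (profinite_completion G)" and N: "N \<in> finite_index_normals G"
    and dense: "profinite_topology G closure_of (generate (profinite_completion G) S)
      = carrier (profinite_completion G)"
  shows "generate (G Mod N) ((\<lambda>x. x N) ` S) = carrier (G Mod N)"
proof -
  interpret h: group_hom "profinite_completion G" "G Mod N" "\<lambda>x. x N"
    by (rule profinite_projection_hom[OF N])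
  have gen: "generate (G Mod N) ((\<lambda>x. x N) ` S) = (\<lambda>x. x N) ` generate (profinite_completion G) S"
    by (rule h.generate_img[OF S])
  have cont: "continuous_map (profinite_topology G) (discrete_topology (carrier (G Mod N))) (\<lambda>x. x N)"
    unfolding profinite_topology_def
    using N by (intro continuous_map_from_subtopology continuous_map_product_projection)
  have "c \<in> (\<lambda>x. x N) ` generate (profinite_completion G) S" if c: "c \<in> carrier (G Mod N)" for c
  proof -
    obtain g where g: "g \<in> carrier G" "c = N #> g" using c by (auto simp: carrier_FactGroup)
    let ?x = "\<lambda>N\<in>finite_index_normals G. N #> g"
    let ?T = "{y \<in> topspace (profinite_topology G). y N \<in> {c}}"
    have "openin (profinite_topology G) ?T"
      using c by (intro openin_continuous_map_preimage[OF cont]) simp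
    moreover have "?x \<in> ?T" using profinite_element_of[OF g(1)] g(2) N by (simp add: topspace_profinite)
    moreover have "?x \<in> profinite_topology G closure_of (generate (profinite_completion G) S)"
      unfolding dense by (rule profinite_element_of[OF g(1)])
    then have "\<forall>T. ?x \<in> T \<and> openin (profinite_topology G) T \<longrightarrow>
        (\<exists>y. y \<in> generate (profinite_completion G) S \<and> y \<in> T)"
      unfolding in_closure_of by (rule conjunct2)
    ultimately have "\<exists>y. y \<in> generate (profinite_completion G) S \<and> y \<in> ?T"
      by (elim allE[of _ ?T] impE) (rule conjI)
    then obtain y where "y \<in> generate (profinite_completion G) S" "y N = c" by auto
    then show ?thesis by (intro image_eqI) simp_all
  qed
  then have "carrier (G Mod N) \<subseteq> generate (G Mod N) ((\<lambda>x. x N) ` S)" unfolding gen by (rule subsetI)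
  moreover have "(\<lambda>x. x N) ` S \<subseteq> carrier (G Mod N)" using S h.hom_closed by (intro image_subsetI) (rule h.hom_closed, rule subsetD)
  ultimately show ?thesis using h.H.generate_incl by (intro subset_antisym) simp_all
qed

text \<open>A basic open set restricts finitely many coordinates only, and all of them are determined by the
  coordinate at a common smaller normal subgroup \<open>K\<close>.\<close>

lemma dense_of_generates_projections:
  assumes S: "S \<subseteq> carrier (profinite_completion G)"
    and cofinal: "\<And>F. finite F \<Longrightarrow> F \<subseteq> finite_index_normals G \<Longrightarrow>
      \<exists>K \<in> finite_index_normals G. (\<forall>N\<in>F. K \<subseteq> N) \<and>
        generate (G Mod K) ((\<lambda>x. x K) ` S) = carrier (G Mod K)"
  shows "profinite_topology G closure_of (generate (profinite_completion G) S)
      = carrier (profinite_completion G)"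
proof
  let ?I = "finite_index_normals G"
  interpret A: group "profinite_completion G" by (rule profinite_group)
  show "profinite_topology G closure_of (generate (profinite_completion G) S) \<subseteq> carrier (profinite_completion G)"
    using closure_of_subset_topspace topspace_profinite by metis
  show "carrier (profinite_completion G) \<subseteq> profinite_topology G closure_of (generate (profinite_completion G) S)"
  proof
    fix x assume x: "x \<in> carrier (profinite_completion G)"
    have "\<exists>y. y \<in> generate (profinite_completion G) S \<and> y \<in> T"
      if xT: "x \<in> T" and T: "openin (profinite_topology G) T" for T
    proof -
      obtain T' where T': "openin (product_topology (\<lambda>N. discrete_topology (carrier (G Mod N))) ?I) T'"
        "T = T' \<inter> carrier (profinite_completion G)"
        using T unfolding profinite_topology_def openin_subtopology by blast
      have "x \<in> T'" using xT T'(2) by blast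
      then have "\<exists>V. finite {i \<in> ?I. V i \<noteq> topspace (discrete_topology (carrier (G Mod i)))} \<and>
          (\<forall>i\<in>?I. openin (discrete_topology (carrier (G Mod i))) (V i)) \<and> x \<in> Pi\<^sub>E ?I V \<and> Pi\<^sub>E ?I V \<subseteq> T'"
        using T'(1) unfolding openin_product_topology_alt by simp
      then obtain V where V: "finite {i \<in> ?I. V i \<noteq> carrier (G Mod i)}" "x \<in> Pi\<^sub>E ?I V" "Pi\<^sub>E ?I V \<subseteq> T'"
        by auto
      let ?F = "{i \<in> ?I. V i \<noteq> carrier (G Mod i)}"
      obtain K where K: "K \<in> ?I" "\<forall>N\<in>?F. K \<subseteq> N"
        "generate (G Mod K) ((\<lambda>x. x K) ` S) = carrier (G Mod K)"
        using cofinal[OF V(1)] by blast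
      interpret h: group_hom "profinite_completion G" "G Mod K" "\<lambda>x. x K"
        by (rule profinite_projection_hom[OF K(1)])
      have "x K \<in> (\<lambda>x. x K) ` generate (profinite_completion G) S"
        using h.generate_img[OF S] K(3) profinite_carrierD(1)[OF x K(1)] by simp
      then obtain y where y: "y \<in> generate (profinite_completion G) S" "y K = x K" by auto
      have yC: "y \<in> carrier (profinite_completion G)" using A.generate_in_carrier[OF S y(1)] .
      have "y N \<in> V N" if N: "N \<in> ?I" for N
      proof (cases "N \<in> ?F")
        case True
        then have KN: "K \<subseteq> N" using K(2) by blast
        have "y N = x N"
          using profinite_carrierD(2)[OF yC K(1) N KN] profinite_carrierD(2)[OF x K(1) N KN] y(2) by simp
        then show ?thesis using V(2) N by auto
      next
        case False
        then show ?thesis using N profinite_carrierD(1)[OF yC N] by blast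
      qed
      moreover have "y \<in> extensional ?I" using yC by (auto simp: profinite_completion_def PiE_iff)
      ultimately have "y \<in> Pi\<^sub>E ?I V" unfolding PiE_iff by blast
      then have "y \<in> T" using V(3) T'(2) yC by blast
      then show ?thesis using y(1) by blast
    qed
    then show "x \<in> profinite_topology G closure_of (generate (profinite_completion G) S)"
      using x unfolding in_closure_of topspace_profinite by blast
  qed
qed

end

context virtually_nilpotent
begin

lemma P_finite_index_normal: "m > 0 \<Longrightarrow> P m \<in> finite_index_normals G"
  using P_normal P_finite_index by (simp add: finite_index_normals_def)

text \<open>Together with \<open>P_dvd\<close> this makes the subgroups \<open>U\<^sup>m\<close> cofinal among the normal subgroups of finite
  index.\<close>

lemma P_order_subset:
  assumes N: "N \<in> finite_index_normals G"
  shows "P (Coset.order (G Mod N)) \<subseteq> N"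
proof -
  interpret N: normal N G using finite_index_normals_normal[OF N] .
  interpret Q: group "G Mod N" by (rule N.factorgroup_is_group)
  have "u [^] Coset.order (G Mod N) \<in> N" if u: "u \<in> U" for u
  proof -
    have uG: "u \<in> carrier G" using u by simp
    have "(N #> u) [^]\<^bsub>G Mod N\<^esub> Coset.order (G Mod N) = \<one>\<^bsub>G Mod N\<^esub>"
      using uG by (intro Q.pow_order_eq_1) (simp add: carrier_FactGroup)
    then have "N #> u [^] Coset.order (G Mod N) = N" using N.FactGroup_pow[OF uG] by simp
    then show ?thesis using rcos_self[OF nat_pow_closed[OF uG] N.is_subgroup] by blast
  qed
  then show ?thesis
    unfolding power_subgroup_def by (intro generate_subgroup_incl[OF _ N.is_subgroup]) blast
qed

lemma order_finite_index_pos: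
  assumes N: "N \<in> finite_index_normals G"
  shows "Coset.order (G Mod N) > 0"
proof -
  interpret Q: group "G Mod N"
    using normal.factorgroup_is_group[OF finite_index_normals_normal[OF N]] .
  show ?thesis using N Q.order_gt_0_iff_finite by (simp add: finite_index_normals_def)
qed

text \<open>Generators modulo \<open>U\<^sup>p\<close> for all prime divisors \<open>p\<close> of \<open>m\<close> are generators modulo \<open>U\<^sup>m\<close>, so it suffices to treat
  finitely many primes at once. The prime \<open>2\<close> is added to make the set of primes nonempty.\<close>

lemma generates_mod_power:
  assumes all: "\<And>p. prime p \<Longrightarrow> \<exists>xs. length xs = n \<and> generates_mod (P p) (set xs)" and m: "m > 0"
  shows "\<exists>xs. length xs = n \<and> generates_mod (P m) (set xs)"
proof -
  let ?Q = "insert 2 {p. prime p \<and> p dvd m}"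
  have finQ: "finite ?Q" using finite_divisors_nat[OF m] by (simp add: finite_subset[of "{p. prime p \<and> p dvd m}" "{p. p dvd m}"] Collect_mono)
  have allS: "\<exists>xs. length xs = Suc n \<and> generates_mod (P p) (set xs)" if p: "prime p" for p
  proof -
    obtain xs where xs: "length xs = n" "generates_mod (P p) (set xs)" using all[OF p] by blast
    have "generates_mod (P p) (set (\<one> # xs))"
      using xs(2) by (intro generates_mod_mono[OF xs(2) subset_refl P_carrier]) (auto simp: generates_mod_def)
    then show ?thesis using xs(1) by (intro exI[of _ "\<one> # xs"]) simp
  qed
  have Qp: "prime p" if "p \<in> ?Q" for p using that by auto
  have "\<exists>gs g. length gs = n \<and> set gs \<subseteq> carrier G \<and> g \<in> carrier G \<and>
      generate G (insert g (set gs)) = carrier G \<and> (\<forall>p\<in>?Q. generates_mod (P p) (set gs))"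
    by (rule generators_exist[OF finQ insert_not_empty Qp allS all[OF Qp]])
  then obtain gs where gs: "length gs = n" "\<And>p. p \<in> ?Q \<Longrightarrow> generates_mod (P p) (set gs)" by blast
  have gen: "generates_mod U (set gs)" using generates_mod_U[OF gs(2)[of 2]] by simp
  then have gG: "set gs \<subseteq> carrier G" unfolding generates_mod_def by blast
  have "P m <#> generate G (set gs) = carrier G"
  proof (rule supplement_of_prime_supplements[OF generate_is_subgroup[OF gG] _ m])
    show "U <#> generate G (set gs) = carrier G"
      using gen unfolding generates_mod_iff_mult[OF normal_axioms] by blast
    show "P p <#> generate G (set gs) = carrier G" if "prime p" "p dvd m" for p
      using gs(2)[of p] that unfolding generates_mod_iff_mult[OF P_normal] by blast
  qed
  then show ?thesis using gs(1) gG unfolding generates_mod_iff_mult[OF P_normal] by blast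
qed

text \<open>Each list of generators is lifted from one factorial to the next by Gaschuetz's lemma.\<close>

lemma compatible_generators:
  assumes all: "\<And>p. prime p \<Longrightarrow> \<exists>xs. length xs = n \<and> generates_mod (P p) (set xs)"
  shows "\<exists>t. (\<forall>i. length (t i) = n \<and> generates_mod (P (fact i)) (set (t i))) \<and>
    (\<forall>i j k. i \<le> j \<longrightarrow> k < n \<longrightarrow> t j ! k \<in> P (fact i) #> t i ! k)"
proof -
  have "\<exists>t. \<forall>i. (length (t i) = n \<and> generates_mod (P (fact i)) (set (t i))) \<and>
      list_all2 (\<lambda>x y. x \<in> P (fact i) #> y) (t (Suc i)) (t i)"
  proof (rule dependent_nat_choice)
    show "\<exists>xs. length xs = n \<and> generates_mod (P (fact 0)) (set xs)"
      by (rule generates_mod_power[OF all]) simp_all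
    fix xs i assume xs: "length xs = n \<and> generates_mod (P (fact i)) (set xs)"
    obtain zs where zs: "length zs = n" "generates_mod (P (fact (Suc i))) (set zs)"
      using generates_mod_power[OF all, of "fact (Suc i)"] by auto
    have "\<exists>ts. list_all2 (\<lambda>x y. x \<in> P (fact i) #> y) ts xs \<and> generates_mod (P (fact (Suc i))) ({} \<union> set ts)"
    proof (rule gaschuetz_mod[OF P_normal _ P_normal])
      show "finite (carrier (G Mod P (fact (Suc i))))" by (rule P_finite_index) simp
      show "P (fact (Suc i)) \<subseteq> P (fact i)" by (rule P_dvd) simp
      show "set xs \<subseteq> carrier G" using xs unfolding generates_mod_def by blast
      show "generates_mod (P (fact i)) ({} \<union> set xs)" using xs by simp
      show "generates_mod (P (fact (Suc i))) ({} \<union> set zs)" using zs(2) by simp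
      show "length xs = length zs" by (rule trans[OF conjunct1[OF xs] zs(1)[symmetric]])
    qed
    then show "\<exists>ts. (length ts = n \<and> generates_mod (P (fact (Suc i))) (set ts)) \<and>
        list_all2 (\<lambda>x y. x \<in> P (fact i) #> y) ts xs"
      using xs list_all2_lengthD by fastforce
  qed
  then obtain t where t: "\<And>i. length (t i) = n" "\<And>i. generates_mod (P (fact i)) (set (t i))"
    "\<And>i. list_all2 (\<lambda>x y. x \<in> P (fact i) #> y) (t (Suc i)) (t i)" by blast
  have tG: "t i ! k \<in> carrier G" if "k < n" for i k
  proof -
    have "t i ! k \<in> set (t i)" using that t(1) by simp
    then show ?thesis using t(2)[of i] unfolding generates_mod_def by blast
  qed
  have "t j ! k \<in> P (fact i) #> t i ! k" if ij: "i \<le> j" and k: "k < n" for i j k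
    using ij
  proof (induction j rule: dec_induct)
    case base
    then show ?case using rcos_self[OF tG[OF k] P_subgroup] .
  next
    case (step j)
    have "t (Suc j) ! k \<in> P (fact j) #> t j ! k" using list_all2_nthD[OF t(3)] k t(1) by simp
    moreover have "P (fact j) \<subseteq> P (fact i)" using step.hyps by (intro P_dvd fact_dvd) simp
    ultimately have "t (Suc j) ! k \<in> P (fact i) #> t j ! k" unfolding r_coset_def by blast
    then show ?case using repr_independence[OF step.IH tG[OF k] P_subgroup] by simp
  qed
  then show ?thesis using t by blast
qed

text \<open>The limits of a compatible sequence of generating lists. The coordinate at \<open>N\<close> is read off from the
  list with index \<open>r\<close>, the order of \<open>G/N\<close>: this list is determined modulo \<open>U\<^sup>r\<^sup>!\<close>, which lies in \<open>N\<close>.\<close>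

lemma profinite_generators:
  assumes all: "\<And>p. prime p \<Longrightarrow> \<exists>xs. length xs = n \<and> generates_mod (P p) (set xs)"
  shows "\<exists>S. finite S \<and> card S \<le> n \<and> S \<subseteq> carrier (profinite_completion G) \<and>
    profinite_topology G closure_of (generate (profinite_completion G) S) = carrier (profinite_completion G)"
proof -
  let ?I = "finite_index_normals G"
  obtain t where t: "\<And>i. length (t i) = n" "\<And>i. generates_mod (P (fact i)) (set (t i))"
    "\<And>i j k. i \<le> j \<Longrightarrow> k < n \<Longrightarrow> t j ! k \<in> P (fact i) #> t i ! k"
    using compatible_generators[OF all] by metis
  have tG: "t i ! k \<in> carrier G" if "k < n" for i k
  proof -
    have "t i ! k \<in> set (t i)" using that t(1) by simp
    then show ?thesis using t(2)[of i] unfolding generates_mod_def by blast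
  qed
  have agree: "N #> t i ! k = N #> t j ! k"
    if N: "N \<in> ?I" and ij: "i \<le> j" and k: "k < n" and PN: "P (fact i) \<subseteq> N" for N i j k
  proof -
    have "t j ! k \<in> N #> t i ! k" using t(3)[OF ij k] PN unfolding r_coset_def by blast
    then show ?thesis
      using repr_independence[OF _ tG[OF k] normal_imp_subgroup[OF finite_index_normals_normal[OF N]]] by simp
  qed
  have agree': "N #> t i ! k = N #> t j ! k"
    if "N \<in> ?I" "k < n" "P (fact i) \<subseteq> N" "P (fact j) \<subseteq> N" for N i j k
  proof (cases "i \<le> j")
    case True
    show ?thesis by (rule agree[OF that(1) True that(2,3)])
  next
    case False
    then have "j \<le> i" by simp
    from agree[OF that(1) this that(2,4)] show ?thesis by (rule sym)
  qed
  define r where "r N = Coset.order (G Mod N)" for N :: "'a set"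
  have r: "P (fact (r N)) \<subseteq> N" if N: "N \<in> ?I" for N
  proof -
    have "r N dvd fact (r N)"
      using order_finite_index_pos[OF N] unfolding r_def by (intro dvd_fact) simp_all
    then show ?thesis using P_dvd P_order_subset[OF N] unfolding r_def by blast
  qed
  define x where "x k = (\<lambda>N\<in>?I. N #> t (r N) ! k)" for k
  have xval: "x k N = N #> t i ! k" if "N \<in> ?I" "k < n" "P (fact i) \<subseteq> N" for k N i
    using agree'[OF that(1,2) r[OF that(1)] that(3)] that(1) by (simp add: x_def)
  have xC: "x k \<in> carrier (profinite_completion G)" if k: "k < n" for k
  proof -
    have "N <#> x k M = x k N" if MN: "M \<in> ?I" "N \<in> ?I" "M \<subseteq> N" for M N
    proof -
      have "x k M = M #> t (r M) ! k" using MN(1) by (simp add: x_def)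
      then have "N <#> x k M = N #> t (r M) ! k"
        using coset_enlarge[OF finite_index_normals_normal finite_index_normals_normal] MN tG[OF k] by simp
      also have "\<dots> = x k N" using xval[OF MN(2) k, of "r M"] r[OF MN(1)] MN(3) by auto
      finally show ?thesis .
    qed
    moreover have "x k \<in> (\<Pi>\<^sub>E N \<in> ?I. carrier (G Mod N))"
      using tG[OF k] by (auto simp: x_def carrier_FactGroup)
    ultimately show ?thesis by (simp add: profinite_completion_def)
  qed
  let ?S = "x ` {..<n}"
  have SC: "?S \<subseteq> carrier (profinite_completion G)" using xC by blast
  have "profinite_topology G closure_of (generate (profinite_completion G) ?S) = carrier (profinite_completion G)"
  proof (rule dense_of_generates_projections[OF SC])
    fix F assume F: "finite F" "F \<subseteq> ?I"
    define m where "m = prod r F"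
    have m: "m > 0" unfolding m_def r_def using F order_finite_index_pos by (intro prod_pos) blast
    have K: "P m \<in> ?I" by (rule P_finite_index_normal[OF m])
    have sub: "P m \<subseteq> N" if "N \<in> F" for N
    proof -
      have "r N dvd m" unfolding m_def using F(1) that by (rule dvd_prodI)
      then show ?thesis using P_dvd P_order_subset[of N] that F(2) unfolding r_def by blast
    qed
    have fm: "P (fact m) \<subseteq> P m" using m by (intro P_dvd dvd_fact) simp_all
    have "generates_mod (P m) (set (t m))"
      using generates_mod_mono[OF t(2) fm P_carrier subset_refl] t(2)[of m] unfolding generates_mod_def by blast
    moreover have "set (t m) \<subseteq> carrier G" using t(2)[of m] unfolding generates_mod_def by blast
    ultimately have "generate (G Mod P m) ((#>) (P m) ` set (t m)) = carrier (G Mod P m)"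
      using generates_Mod_iff[OF P_normal] by blast
    moreover have "(#>) (P m) ` set (t m) = (\<lambda>y. y (P m)) ` ?S"
    proof -
      have "set (t m) = (\<lambda>k. t m ! k) ` {..<n}" using t(1)[of m] by (auto simp: in_set_conv_nth)
      then show ?thesis using xval[OF K _ fm] by (auto simp: image_image intro!: image_cong)
    qed
    ultimately have "generate (G Mod P m) ((\<lambda>y. y (P m)) ` ?S) = carrier (G Mod P m)" by argo
    then show "\<exists>K\<in>?I. (\<forall>N\<in>F. K \<subseteq> N) \<and> generate (G Mod K) ((\<lambda>x. x K) ` ?S) = carrier (G Mod K)"
      by (intro bexI[OF _ K] conjI ballI sub)
  qed
  moreover have "card ?S \<le> n" using card_image_le[of "{..<n}" x] by simp
  ultimately show ?thesis using SC by blast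
qed

end

section \<open>Minimal numbers of generators\<close>

lemma min_gens_attained:
  assumes "finitely_generated G"
  shows "\<exists>S. finite S \<and> card S = min_gens G \<and> S \<subseteq> carrier G \<and> generate G S = carrier G"
proof -
  have "\<exists>n S. finite S \<and> card S = n \<and> S \<subseteq> carrier G \<and> generate G S = carrier G"
    using assms by (auto simp: finitely_generated_def)
  then show ?thesis unfolding min_gens_def by (rule LeastI_ex)
qed

lemma min_gens_le:
  assumes "finite S" "S \<subseteq> carrier G" "generate G S = carrier G"
  shows "min_gens G \<le> card S"
  unfolding min_gens_def using assms by (intro Least_le) blast

context virtually_nilpotent
begin

lemma G_finitely_generated: "finitely_generated G"
  using finitely_generated_extension[OF normal_axioms U_finitely_generated finite_quotient] .

lemma generates_mod_d_mod:
  assumes p: "prime p"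
  shows "\<exists>xs. length xs = d_mod G U p \<and> generates_mod (P p) (set xs)"
proof -
  let ?Q = "G Mod P p" and ?f = "(#>) (P p)"
  have "finitely_generated ?Q"
    using normal.finitely_generated_Mod[OF P_normal G_finitely_generated] .
  then obtain S where S: "finite S" "card S = d_mod G U p" "S \<subseteq> carrier ?Q" "generate ?Q S = carrier ?Q"
    using min_gens_attained unfolding d_mod_def by blast
  obtain cs where cs: "set cs = S" "distinct cs" using finite_distinct_list[OF S(1)] by blast
  have "\<forall>c\<in>S. \<exists>g. g \<in> carrier G \<and> c = ?f g" using S(3) by (auto simp: carrier_FactGroup)
  from bchoice[OF this] obtain r where r: "\<And>c. c \<in> S \<Longrightarrow> r c \<in> carrier G \<and> c = ?f (r c)" by blast
  let ?xs = "map r cs"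
  have "?f ` set ?xs = S"
  proof -
    have "?f ` set ?xs = (\<lambda>c. ?f (r c)) ` S" using cs(1) by (simp add: image_image)
    also have "\<dots> = (\<lambda>c. c) ` S" using r by (intro image_cong) auto
    finally show ?thesis by simp
  qed
  moreover have "set ?xs \<subseteq> carrier G" using r cs(1) by auto
  ultimately have "generates_mod (P p) (set ?xs)" using generates_Mod_iff[OF P_normal, of "set ?xs" p] S(4) by simp
  moreover have "length ?xs = d_mod G U p" using S(2) cs distinct_card by fastforce
  ultimately show ?thesis by blast
qed

lemma d_mod_le_card:
  assumes "generates_mod (P p) S" "finite S"
  shows "d_mod G U p \<le> card S"
proof -
  have S: "S \<subseteq> carrier G" using assms unfolding generates_mod_def by blast
  have "generate (G Mod P p) ((#>) (P p) ` S) = carrier (G Mod P p)"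
    using generates_Mod_iff[OF P_normal S] assms(1) by blast
  then have "d_mod G U p \<le> card ((#>) (P p) ` S)"
    unfolding d_mod_def using assms(2) S
    by (intro min_gens_le) (auto simp: carrier_FactGroup)
  also have "\<dots> \<le> card S" by (rule card_image_le[OF assms(2)])
  finally show ?thesis .
qed

lemma generates_mod_of_d_mod_le:
  assumes p: "prime p" and n: "d_mod G U p \<le> n"
  shows "\<exists>xs. length xs = n \<and> generates_mod (P p) (set xs)"
proof -
  obtain xs where xs: "length xs = d_mod G U p" "generates_mod (P p) (set xs)"
    using generates_mod_d_mod[OF p] by blast
  let ?ys = "xs @ replicate (n - d_mod G U p) \<one>"
  have xsG: "set xs \<subseteq> carrier G" using xs(2) unfolding generates_mod_def by blast
  have "generates_mod (P p) (set ?ys)"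
    by (rule generates_mod_mono[OF xs(2) subset_refl P_carrier]) (use xsG in auto)
  moreover have "length ?ys = n" using xs(1) n by simp
  ultimately show ?thesis by blast
qed

text \<open>The number \<open>n\<close> is the maximum of the \<open>d\<^sub>p\<close>: so many limits of generators suffice, and a dense subgroup
  maps onto \<open>G/U\<^sup>q\<close>, which needs \<open>n\<close> generators.\<close>

lemma profinite_min_gens_eq:
  assumes le: "\<And>p. prime p \<Longrightarrow> d_mod G U p \<le> n" and q: "prime q" "d_mod G U q = n"
  shows "profinite_min_gens G = n"
proof -
  let ?T = "\<lambda>m. \<exists>S. finite S \<and> card S = m \<and> S \<subseteq> carrier (profinite_completion G) \<and>
    profinite_topology G closure_of (generate (profinite_completion G) S) = carrier (profinite_completion G)"
  obtain S where S: "finite S" "card S \<le> n" "S \<subseteq> carrier (profinite_completion G)"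
    "profinite_topology G closure_of (generate (profinite_completion G) S) = carrier (profinite_completion G)"
    using profinite_generators[OF generates_mod_of_d_mod_le[OF _ le]] by blast
  have T: "?T (card S)" using S by blast
  have "profinite_min_gens G \<le> card S" unfolding profinite_min_gens_def by (rule Least_le[of ?T, OF T])
  then have "profinite_min_gens G \<le> n" using S(2) by (rule le_trans)
  moreover have attained: "?T (profinite_min_gens G)"
    unfolding profinite_min_gens_def by (rule LeastI[of ?T, OF T])
  have "n \<le> m" if "?T m" for m
  proof -
    from that obtain S where S: "finite S" "card S = m" "S \<subseteq> carrier (profinite_completion G)"
      "profinite_topology G closure_of (generate (profinite_completion G) S) = carrier (profinite_completion G)"
      by (elim exE conjE)
    have K: "P q \<in> finite_index_normals G" by (rule P_finite_index_normal[OF prime_gt_0_nat[OF q(1)]])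
    have gen: "generate (G Mod P q) ((\<lambda>x. x (P q)) ` S) = carrier (G Mod P q)"
      by (rule generates_projection_of_dense[OF S(3) K S(4)])
    have "(\<lambda>x. x (P q)) ` S \<subseteq> carrier (G Mod P q)"
      by (intro image_subsetI profinite_carrierD(1)[OF _ K] subsetD[OF S(3)])
    then have "d_mod G U q \<le> card ((\<lambda>x. x (P q)) ` S)"
      unfolding d_mod_def by (intro min_gens_le gen finite_imageI S(1))
    also have "\<dots> \<le> card S" by (rule card_image_le[OF S(1)])
    finally show ?thesis using q(2) S(2) by simp
  qed
  from this[OF attained] have "n \<le> profinite_min_gens G" .
  ultimately show ?thesis by (rule le_antisym)
qed

lemma d_mod_le_min_gens: "d_mod G U p \<le> min_gens G"
  unfolding d_mod_def by (rule min_gens_Mod_le[OF P_normal G_finitely_generated])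

text \<open>Here \<open>a\<close> is the maximum of the \<open>d\<^sub>p\<close>, and the prime \<open>q\<close> with a smaller value allows the construction to be
  started with \<open>a - 1\<close> elements. The list is distinct because \<open>G\<close> has no smaller generating set.\<close>

lemma generators_if_not_constant:
  assumes le: "\<And>p. prime p \<Longrightarrow> d_mod G U p \<le> a" and p0: "prime p0" "d_mod G U p0 = a"
    and q: "prime q" "d_mod G U q < a"
  shows "\<exists>gs. length gs = a \<and> distinct gs \<and> set gs \<subseteq> carrier G \<and> generate G (set gs) = carrier G"
proof -
  have a: "a = Suc (a - 1)" using q(2) by simp
  have "\<exists>gs g. length gs = a - 1 \<and> set gs \<subseteq> carrier G \<and> g \<in> carrier G \<and>
      generate G (insert g (set gs)) = carrier G \<and> (\<forall>p\<in>{q}. generates_mod (P p) (set gs))"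
  proof (rule generators_exist)
    show "\<exists>xs. length xs = Suc (a - 1) \<and> generates_mod (P p) (set xs)" if "prime p" for p
      using generates_mod_of_d_mod_le[OF that le[OF that]] a by simp
    show "\<exists>xs. length xs = a - 1 \<and> generates_mod (P p) (set xs)" if "p \<in> {q}" for p
      using generates_mod_of_d_mod_le[OF q(1), of "a - 1"] that q(2) by simp
  qed (use q(1) in simp_all)
  then obtain gs g where gs: "length gs = a - 1" "set gs \<subseteq> carrier G" "g \<in> carrier G"
    "generate G (insert g (set gs)) = carrier G" by blast
  let ?gs = "gs @ [g]"
  have len: "length ?gs = a" using gs(1) a by simp
  have gen: "generate G (set ?gs) = carrier G" and sub: "set ?gs \<subseteq> carrier G" using gs by simp_all
  have "min_gens G \<le> card (set ?gs)" by (rule min_gens_le[OF finite_set sub gen])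
  then have "a \<le> card (set ?gs)" using d_mod_le_min_gens[of p0] p0(2) by simp
  then have "distinct ?gs" using len card_length[of ?gs] by (intro card_distinct) simp
  then show ?thesis using len gen sub by blast
qed

text \<open>The first \<open>a\<close> elements generate \<open>G\<close> modulo \<open>U\<^sup>p\<close> for the prime divisors \<open>p\<close> of \<open>N\<close>, which makes the index of
  their subgroup prime to \<open>N\<close>. The prime \<open>2\<close> is added so that they generate modulo some \<open>U\<^sup>p\<close> and are
  distinct even if \<open>N = 1\<close>. If the last element repeats an earlier one, it is superfluous, and the
  neutral element replaces it; that one is not among the others, since \<open>a\<close> is minimal.\<close>

lemma generators_if_constant:
  assumes eq: "\<And>p. prime p \<Longrightarrow> d_mod G U p = a" and N: "N > 0"
  shows "\<exists>gs. length gs = Suc a \<and> distinct gs \<and> set gs \<subseteq> carrier G \<and> generate G (set gs) = carrier G \<and>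
    coprime_index N (generate G (set (take a gs)))"
proof -
  let ?Q = "insert 2 {p. prime p \<and> p dvd N}"
  have finQ: "finite ?Q"
    using finite_subset[of "{p. prime p \<and> p dvd N}" "{p. p dvd N}"] finite_divisors_nat[OF N] by auto
  have Qp: "prime p" if "p \<in> ?Q" for p using that by auto
  have "\<exists>gs g. length gs = a \<and> set gs \<subseteq> carrier G \<and> g \<in> carrier G \<and>
      generate G (insert g (set gs)) = carrier G \<and> (\<forall>p\<in>?Q. generates_mod (P p) (set gs))"
  proof (rule generators_exist[OF finQ insert_not_empty Qp])
    show "\<exists>xs. length xs = Suc a \<and> generates_mod (P p) (set xs)" if "prime p" for p
      using generates_mod_of_d_mod_le[OF that] eq[OF that] by simp
    show "\<exists>xs. length xs = a \<and> generates_mod (P p) (set xs)" if "p \<in> ?Q" for p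
      using generates_mod_of_d_mod_le[OF Qp[OF that]] eq[OF Qp[OF that]] by simp
  qed
  then obtain gs g where gs: "length gs = a" "set gs \<subseteq> carrier G" "g \<in> carrier G"
    "generate G (insert g (set gs)) = carrier G" "\<And>p. p \<in> ?Q \<Longrightarrow> generates_mod (P p) (set gs)" by blast
  have g2: "generates_mod (P 2) (set gs)" using gs(5) by blast
  have d2: "d_mod G U 2 = a" using eq two_is_prime_nat by blast
  have "a \<le> card (set gs)" using d_mod_le_card[OF g2] d2 by simp
  then have dist: "distinct gs" using gs(1) card_length[of gs] by (intro card_distinct) simp
  have ind: "coprime_index p (generate G (set gs))" if "p \<in> ?Q" for p
    using coprime_index_of_generates_mod[OF gs(5)[OF that] Qp[OF that]] .
  have fin: "finite (rcosets (generate G (set gs)))" using ind[of 2] unfolding coprime_index_def by blast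
  have "coprime (card (rcosets (generate G (set gs)))) N"
  proof (rule ccontr)
    assume "\<not> coprime (card (rcosets (generate G (set gs)))) N"
    then have "gcd (card (rcosets (generate G (set gs)))) N \<noteq> 1" by (simp add: coprime_iff_gcd_eq_1)
    then obtain p where "prime p" "p dvd gcd (card (rcosets (generate G (set gs)))) N"
      using prime_factor_nat by blast
    then have p: "prime p" "p dvd N" "p dvd card (rcosets (generate G (set gs)))" by auto
    then have "coprime (card (rcosets (generate G (set gs)))) p"
      using ind[of p] unfolding coprime_index_def by blast
    then show False using p(1,3) by (metis coprime_absorb_right not_prime_unit)
  qed
  then have cN: "coprime_index N (generate G (set gs))" using fin unfolding coprime_index_def by blast
  have "\<exists>h. h \<in> carrier G \<and> h \<notin> set gs \<and> generate G (insert h (set gs)) = carrier G"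
  proof (cases "g \<in> set gs")
    case False
    then show ?thesis using gs by blast
  next
    case True
    then have gen: "generate G (set gs) = carrier G" using gs(4) by (simp add: insert_absorb)
    have "\<one> \<notin> set gs"
    proof
      assume one: "\<one> \<in> set gs"
      have "generates_mod (P 2) (set gs - {\<one>})"
      proof (rule generates_mod_subset[OF g2 _ P_carrier])
        show "set gs - {\<one>} \<subseteq> carrier G" using gs(2) by blast
        show "set gs \<subseteq> generate G (P 2 \<union> (set gs - {\<one>}))"
          using generate.one[of G "P 2 \<union> (set gs - {\<one>})"] by (auto intro: generate.incl)
      qed
      then have "a \<le> card (set gs - {\<one>})" using d_mod_le_card[of 2 "set gs - {\<one>}"] d2 by simp
      moreover have "card (set gs - {\<one>}) < card (set gs)" using one by (intro card_Diff1_less) simp_all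
      ultimately show False using card_length[of gs] gs(1) by simp
    qed
    moreover have "generate G (insert \<one> (set gs)) = carrier G"
      using gen mono_generate[of "set gs" "insert \<one> (set gs)"] generate_incl[of "insert \<one> (set gs)"] gs(2) by auto
    ultimately show ?thesis using one_closed by blast
  qed
  then obtain h where h: "h \<in> carrier G" "h \<notin> set gs" "generate G (insert h (set gs)) = carrier G" by blast
  show ?thesis
    using h gs(1,2) dist cN by (intro exI[of _ "gs @ [h]"]) simp
qed

end

theorem theorem2:
  fixes G :: "('a, 'b) monoid_scheme" and U :: "'a set"
  assumes "group G"
    and "U \<lhd> G"
    and "finitely_generated (G\<lparr>carrier := U\<rparr>)"
    and "comm_group (G\<lparr>carrier := U\<rparr>) \<or> nilpotent_group (G\<lparr>carrier := U\<rparr>)"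
    and "finite (carrier (G Mod U))"
  shows "let \<alpha> = Max (d_mod G U ` {p. prime p});
             \<beta> = Min (d_mod G U ` {p. prime p});
             k = max \<alpha> (\<beta> + 1)
         in \<alpha> = profinite_min_gens G \<and>
            profinite_min_gens G \<le> min_gens G \<and>
            min_gens G \<le> k \<and>
            k \<le> profinite_min_gens G + 1 \<and>
            (\<forall>N::nat. N > 0 \<longrightarrow>
              (\<exists>gs. length gs = k \<and> distinct gs \<and> set gs \<subseteq> carrier G \<and>
                 generate G (set gs) = carrier G \<and>
                 (let H = generate G (set (take (profinite_min_gens G) gs))
                  in finite (rcosets\<^bsub>G\<^esub> H) \<and> coprime (card (rcosets\<^bsub>G\<^esub> H)) N)))"
proof -
  interpret normal U G by fact
  interpret virtually_nilpotent U G
    using assms(3-5) comm_group_imp_nilpotent by unfold_locales blast+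
  let ?D = "d_mod G U ` {p. prime p}"
  define \<alpha> where "\<alpha> = Max ?D"
  define \<beta> where "\<beta> = Min ?D"
  define k where "k = max \<alpha> (\<beta> + 1)"
  have fin: "finite ?D" by (rule finite_range_d_mod[OF assms(2,3,5)])
  have ne: "?D \<noteq> {}" using two_is_prime_nat by blast
  have le: "d_mod G U p \<le> \<alpha>" and ge: "\<beta> \<le> d_mod G U p" if "prime p" for p
    unfolding \<alpha>_def \<beta>_def using that by (auto intro!: Max_ge[OF fin] Min_le[OF fin])
  obtain p0 where p0: "prime p0" "d_mod G U p0 = \<alpha>" using Max_in[OF fin ne] unfolding \<alpha>_def by auto
  obtain q0 where q0: "prime q0" "d_mod G U q0 = \<beta>" using Min_in[OF fin ne] unfolding \<beta>_def by auto
  have prof: "profinite_min_gens G = \<alpha>" by (rule profinite_min_gens_eq[OF le p0])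
  have \<beta>\<alpha>: "\<beta> \<le> \<alpha>" using ge[OF p0(1)] p0(2) by simp
  have gens: "\<exists>gs. length gs = k \<and> distinct gs \<and> set gs \<subseteq> carrier G \<and> generate G (set gs) = carrier G \<and>
      coprime_index N (generate G (set (take \<alpha> gs)))" if N: "N > 0" for N
  proof (cases "\<beta> < \<alpha>")
    case True
    then have k: "k = \<alpha>" by (simp add: k_def)
    obtain gs where gs: "length gs = \<alpha>" "distinct gs" "set gs \<subseteq> carrier G" "generate G (set gs) = carrier G"
      using generators_if_not_constant[OF le p0 q0(1)] q0(2) True by blast
    have "coprime_index N (generate G (set (take \<alpha> gs)))"
      using gs(1,4) coprime_index_carrier by simp
    then show ?thesis using gs k by blast
  next
    case False
    then have "\<beta> = \<alpha>" using \<beta>\<alpha> by simp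
    then have k: "k = Suc \<alpha>" by (simp add: k_def)
    have "d_mod G U p = \<alpha>" if "prime p" for p
      using le[OF that] ge[OF that] \<open>\<beta> = \<alpha>\<close> by simp
    from generators_if_constant[OF this N] show ?thesis unfolding k .
  qed
  have "min_gens G \<le> k"
  proof -
    obtain gs where gs: "length gs = k" "distinct gs" "set gs \<subseteq> carrier G" "generate G (set gs) = carrier G"
      using gens[of 1] by auto
    have "min_gens G \<le> card (set gs)" by (rule min_gens_le[OF finite_set gs(3,4)])
    then show ?thesis using distinct_card[OF gs(2)] gs(1) by simp
  qed
  moreover have "\<alpha> \<le> min_gens G" using d_mod_le_min_gens[of p0] p0(2) by simp
  moreover have "k \<le> \<alpha> + 1" using \<beta>\<alpha> by (simp add: k_def)
  ultimately show ?thesis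
    using gens unfolding Let_def prof \<alpha>_def[symmetric] \<beta>_def[symmetric] k_def[symmetric] coprime_index_def
    by simp
qed

end
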